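(* Let $\Bbbk$ be a commutative, associative, unital ring, let $\mathcal{C}$ be a small EI category, and let $M$ be a $\Bbbk\mathcal{C}$-module. Assume that the upper set generated by $\operatorname{supp}(M)$ in $\operatorname{cl}(\operatorname{obj}\mathcal{C})$ is Artinian. (1) If the rings $\Bbbk[c]$ are perfect for all $\operatorname{cl}(c)\in\,\uparrow\operatorname{minsupp}(M)$, then $M$ has a minimal projective resolution. If in addition all projective $\Bbbk[c]$-modules are free for all $\operatorname{cl}(c)\in\,\uparrow\operatorname{minsupp}(M)$, then the minimal projective resolution of $M$ is a free resolution. (2) If the rings $\Bbbk[c]$ are semi-perfect for all $\operatorname{cl}(c)\in\,\uparrow\operatorname{minsupp}(M)$, and if $M$ is finitely generated, then $M$ has a projective cover. If additionally the category of $\Bbbk\mathcal{C}$-modules is Noetherian, then $M$ has a minimal projective resolution.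
   Context: Modules over categories. A $\Bbbk\mathcal{C}$-module is a functor $\mathcal{C}\to\Bbbk\text{-Mod}$; homomorphisms are natural transformations; this is an abelian category with exactness checked objectwise. Given a family of sets $B=(B(c))_{c\in\operatorname{obj}\mathcal{C}}$, the free module with basis $B$ is $\bigoplus_{c}\bigoplus_{B(c)}\Bbbk[\operatorname{mor}_{\mathcal{C}}(c,-)]$; a module is free if isomorphic to one of these. Write $\operatorname{cl}(c)$ for the isomorphism class of an object $c$, and $\operatorname{cl}(\operatorname{obj}\mathcal{C})$ for the set of isomorphism classes of objects. The family $B$ is of finite type if the set $\{\operatorname{cl}(c)\in\operatorname{cl}(\operatorname{obj}\mathcal{C}): B(c)\ne\emptyset\}$ is finite; $B$ is finite if it is of finite type and moreover $\#B(c)<\infty$ for each $c\in\operatorname{obj}\mathcal{C}$. $M$ is finitely generated if it is a quotient of a free module with a finite basis. The category of $\Bbbk\mathcal{C}$-modules is Noetherian if every submodule of a finitely generated module is again finitely generated. EI categories. A category is EI if every endomorphism is an isomorphism. For EI $\mathcal{C}$, $\operatorname{cl}(\operatorname{obj}\mathcal{C})$ is partially ordered by $\operatorname{cl}(c)\le\operatorname{cl}(d)$ iff there is a morphism $c\to d$. A subset is Artinian if every descending chain in it stabilizes; $\uparrow S$ is the upper set generated by $S$, i.e. the smallest subset containing $S$ that contains $b$ whenever it contains some $a\le b$. $\Bbbk[c]$ denotes the group ring $\Bbbk[\operatorname{aut}_{\mathcal{C}}(c)]$. Supports. $\operatorname{supp}(M)=\{\operatorname{cl}(c):M(c)\ne0\}$.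 $\mathfrak{S}M(c)$ is the quotient of $M(c)$ by the sum of the images of all $M(u)$ with $u\colon b\to c$ a non-isomorphism; $\operatorname{minsupp}(M)=\{\operatorname{cl}(c):\mathfrak{S}M(c)\ne0\}$. Covers and resolutions. In an abelian category an epimorphism $f\colon L\to M$ is superfluous if for every $g\colon K\to L$, $g$ is epic iff $fg$ is epic. A projective cover of $M$ is a superfluous epimorphism $P\to M$ with $P$ projective. A projective resolution $\varepsilon\colon P_\bullet\to M$ is minimal if $\varepsilon\colon P_0\to M$ and $d_n\colon P_n\to\operatorname{im}(d_n)=\ker(d_{n-1})$ ($d_0=\varepsilon$, $n\ge1$) are projective covers. A ring is perfect (resp. semi-perfect) if every (resp. every finitely generated) module over it has a projective cover.
   Formalization: A finite basis must have finitely many elements per isomorphism class of objects, not just per object (else (2) fails: C indiscrete on N, k=Z_(p), M constant Q); modules, and tests of projectivity etc., range over a universe that is infinite and at least as large as k and mor C. *)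

theory Defs
  imports Complex_Main "HOL-Algebra.AbelCoset" "HOL-Algebra.Module" "HOL-Library.Equipollence"
begin

section \<open>Categories\<close>

record ('o, 'm) category =
  Obj :: "'o set"
  Mor :: "'m set"
  Dom :: "'m \<Rightarrow> 'o"
  Cod :: "'m \<Rightarrow> 'o"
  Id :: "'o \<Rightarrow> 'm"
  Comp :: "'m \<Rightarrow> 'm \<Rightarrow> 'm" (infixl \<open>\<diamondop>\<index>\<close> 70)

definition homs :: "('o, 'm) category \<Rightarrow> 'o \<Rightarrow> 'o \<Rightarrow> 'm set" where
  "homs C a b = {f \<in> Mor C. Dom C f = a \<and> Cod C f = b}"

locale category =
  fixes C :: "('o, 'm) category" (structure)
  assumes Dom_closed: "f \<in> Mor C \<Longrightarrow> Dom C f \<in> Obj C"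
    and Cod_closed: "f \<in> Mor C \<Longrightarrow> Cod C f \<in> Obj C"
    and Id_closed: "a \<in> Obj C \<Longrightarrow> Id C a \<in> homs C a a"
    and Comp_closed: "f \<in> homs C a b \<Longrightarrow> g \<in> homs C b c \<Longrightarrow> g \<diamondop> f \<in> homs C a c"
    and Comp_assoc: "f \<in> homs C a b \<Longrightarrow> g \<in> homs C b c \<Longrightarrow> h \<in> homs C c d \<Longrightarrow>
      h \<diamondop> g \<diamondop> f = h \<diamondop> (g \<diamondop> f)"
    and Comp_Id_right: "f \<in> homs C a b \<Longrightarrow> f \<diamondop> Id C a = f"
    and Comp_Id_left: "f \<in> homs C a b \<Longrightarrow> Id C b \<diamondop> f = f"

definition iso_mor :: "('o, 'm) category \<Rightarrow> 'm \<Rightarrow> bool" where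
  "iso_mor C f \<longleftrightarrow> f \<in> Mor C \<and>
    (\<exists>g \<in> homs C (Cod C f) (Dom C f).
      g \<diamondop>\<^bsub>C\<^esub> f = Id C (Dom C f) \<and> f \<diamondop>\<^bsub>C\<^esub> g = Id C (Cod C f))"

definition epic :: "('o, 'm) category \<Rightarrow> 'm \<Rightarrow> bool" where
  "epic C f \<longleftrightarrow> f \<in> Mor C \<and>
    (\<forall>b \<in> Obj C. \<forall>g \<in> homs C (Cod C f) b. \<forall>h \<in> homs C (Cod C f) b.
      g \<diamondop>\<^bsub>C\<^esub> f = h \<diamondop>\<^bsub>C\<^esub> f \<longrightarrow> g = h)"

definition projective :: "('o, 'm) category \<Rightarrow> 'o \<Rightarrow> bool" where
  "projective C P \<longleftrightarrow> P \<in> Obj C \<and>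
    (\<forall>e f. epic C e \<and> f \<in> homs C P (Cod C e) \<longrightarrow>
      (\<exists>g \<in> homs C P (Dom C e). e \<diamondop>\<^bsub>C\<^esub> g = f))"

definition superfluous :: "('o, 'm) category \<Rightarrow> 'm \<Rightarrow> bool" where
  "superfluous C f \<longleftrightarrow> epic C f \<and>
    (\<forall>g \<in> Mor C. Cod C g = Dom C f \<longrightarrow> (epic C g \<longleftrightarrow> epic C (f \<diamondop>\<^bsub>C\<^esub> g)))"

definition projective_cover :: "('o, 'm) category \<Rightarrow> 'm \<Rightarrow> 'o \<Rightarrow> bool" where
  "projective_cover C p M \<longleftrightarrow>
    p \<in> Mor C \<and> Cod C p = M \<and> projective C (Dom C p) \<and> superfluous C p"


section \<open>EI categories and the poset of isomorphism classes\<close>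

definition EI_category :: "('o, 'm) category \<Rightarrow> bool" where
  "EI_category C \<longleftrightarrow> category C \<and> (\<forall>c \<in> Obj C. \<forall>u \<in> homs C c c. iso_mor C u)"

definition cl :: "('o, 'm) category \<Rightarrow> 'o \<Rightarrow> 'o set" where
  "cl C c = {d \<in> Obj C. \<exists>u \<in> homs C c d. iso_mor C u}"

definition cl_le :: "('o, 'm) category \<Rightarrow> 'o set \<Rightarrow> 'o set \<Rightarrow> bool" where
  "cl_le C X Y \<longleftrightarrow>
    (\<exists>c \<in> Obj C. \<exists>d \<in> Obj C. X = cl C c \<and> Y = cl C d \<and> homs C c d \<noteq> {})"

definition artinian :: "('o, 'm) category \<Rightarrow> 'o set set \<Rightarrow> bool" where
  "artinian C A \<longleftrightarrow>
    (\<forall>f :: nat \<Rightarrow> 'o set. (\<forall>n. f n \<in> A) \<and> (\<forall>n. cl_le C (f (Suc n)) (f n)) \<longrightarrow>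
      (\<exists>N. \<forall>n \<ge> N. f n = f N))"

definition upper_set :: "('o, 'm) category \<Rightarrow> 'o set set \<Rightarrow> bool" where
  "upper_set C T \<longleftrightarrow> T \<subseteq> cl C ` Obj C \<and>
    (\<forall>a \<in> T. \<forall>b \<in> cl C ` Obj C. cl_le C a b \<longrightarrow> b \<in> T)"

definition upper_closure :: "('o, 'm) category \<Rightarrow> 'o set set \<Rightarrow> 'o set set" where
  "upper_closure C S = upper_set C hull S"

definition aut_group :: "('o, 'm) category \<Rightarrow> 'o \<Rightarrow> 'm monoid" where
  "aut_group C c = units_of \<lparr>carrier = homs C c c, mult = Comp C, one = Id C c\<rparr>"

lemma aut_group_carrier: assumes "category C" "c \<in> Obj C"
  shows "carrier (aut_group C c) = {u \<in> homs C c c. iso_mor C u}"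
  using assms by (auto simp: aut_group_def units_of_def Units_def iso_mor_def homs_def)


section \<open>Left modules over a ring\<close>

text \<open>The library's \<^locale>\<open>module\<close> requires the ring of scalars to be commutative, which group
  rings are not. The ring operations \<^const>\<open>mult\<close> and \<^const>\<open>one\<close> in the record type of modules
  carry no meaning.\<close>

locale left_module = R?: ring + M?: abelian_group M for M (structure) +
  assumes smult_closed:
      "\<lbrakk>a \<in> carrier R; x \<in> carrier M\<rbrakk> \<Longrightarrow> a \<odot>\<^bsub>M\<^esub> x \<in> carrier M"
    and smult_l_distr:
      "\<lbrakk>a \<in> carrier R; b \<in> carrier R; x \<in> carrier M\<rbrakk> \<Longrightarrow>
        (a \<oplus> b) \<odot>\<^bsub>M\<^esub> x = a \<odot>\<^bsub>M\<^esub> x \<oplus>\<^bsub>M\<^esub> b \<odot>\<^bsub>M\<^esub> x"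
    and smult_r_distr:
      "\<lbrakk>a \<in> carrier R; x \<in> carrier M; y \<in> carrier M\<rbrakk> \<Longrightarrow>
        a \<odot>\<^bsub>M\<^esub> (x \<oplus>\<^bsub>M\<^esub> y) = a \<odot>\<^bsub>M\<^esub> x \<oplus>\<^bsub>M\<^esub> a \<odot>\<^bsub>M\<^esub> y"
    and smult_assoc1:
      "\<lbrakk>a \<in> carrier R; b \<in> carrier R; x \<in> carrier M\<rbrakk> \<Longrightarrow>
        (a \<otimes> b) \<odot>\<^bsub>M\<^esub> x = a \<odot>\<^bsub>M\<^esub> (b \<odot>\<^bsub>M\<^esub> x)"
    and smult_one: "x \<in> carrier M \<Longrightarrow> \<one> \<odot>\<^bsub>M\<^esub> x = x"

lemma left_module_iff_module:
  assumes "cring K" shows "left_module K N \<longleftrightarrow> module K N"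
  using assms
  by (auto simp: left_module_def module_def left_module_axioms_def module_axioms_def cring.axioms(1))

definition lin_homs ::
  "'r ring \<Rightarrow> ('r, 'a) module \<Rightarrow> ('r, 'b) module \<Rightarrow> ('a \<Rightarrow> 'b) set" where
  "lin_homs R M N = {f \<in> carrier M \<rightarrow> carrier N.
    (\<forall>x \<in> carrier M. \<forall>y \<in> carrier M. f (x \<oplus>\<^bsub>M\<^esub> y) = f x \<oplus>\<^bsub>N\<^esub> f y) \<and>
    (\<forall>r \<in> carrier R. \<forall>x \<in> carrier M. f (r \<odot>\<^bsub>M\<^esub> x) = r \<odot>\<^bsub>N\<^esub> f x)}"

text \<open>A morphism of modules remembers its source and its target, and its underlying map is
  \<^const>\<open>extensional\<close>, so that equality of morphisms is pointwise equality on the carrier.\<close>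

record ('a, 'f) arrow =
  src :: 'a
  tgt :: 'a
  fn :: 'f

definition Mod_cat ::
  "'r ring \<Rightarrow> (('r, 'u) module, (('r, 'u) module, 'u \<Rightarrow> 'u) arrow) category" where
  "Mod_cat R = \<lparr>
    Obj = {N. left_module R N},
    Mor = {f. left_module R (src f) \<and> left_module R (tgt f) \<and>
      fn f \<in> lin_homs R (src f) (tgt f) \<inter> extensional (carrier (src f))},
    Dom = src,
    Cod = tgt,
    Id = (\<lambda>N. \<lparr>src = N, tgt = N, fn = (\<lambda>x \<in> carrier N. x)\<rparr>),
    Comp = (\<lambda>g f. \<lparr>src = src f, tgt = tgt g, fn = compose (carrier (src f)) (fn g) (fn f)\<rparr>)\<rparr>"

lemma category_Mod_cat: "category (Mod_cat R)"
proof (unfold_locales, goal_cases)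
  case (3 N)
  then have "abelian_monoid N" "left_module_axioms R N"
    by (auto simp: Mod_cat_def left_module_def abelian_group_def)
  with 3 show ?case
    by (simp add: Mod_cat_def homs_def lin_homs_def abelian_monoid.a_closed left_module_axioms_def)
next
  case (4 f a b g c)
  then show ?case
    by (auto simp: Mod_cat_def homs_def lin_homs_def compose_def left_module_def
        abelian_group_def abelian_monoid.a_closed left_module_axioms_def Pi_iff)
next
  case (5 f a b g c h d)
  then show ?case by (auto simp: Mod_cat_def homs_def lin_homs_def intro!: compose_assoc[symmetric])
next
  case (6 f a b)
  then show ?case
    by (cases f) (auto simp: Mod_cat_def homs_def intro: compose_Id)
next
  case (7 f a b)
  then show ?case
    by (cases f) (auto simp: Mod_cat_def homs_def lin_homs_def intro: Id_compose)
qed (auto simp: Mod_cat_def)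

definition fin_gen_left_module :: "'r ring \<Rightarrow> ('r, 'u) module \<Rightarrow> bool" where
  "fin_gen_left_module R N \<longleftrightarrow> left_module R N \<and>
    (\<exists>S. finite S \<and> S \<subseteq> carrier N \<and> (\<lambda>H. submodule H R N) hull S = carrier N)"

text \<open>In HOL one cannot quantify over modules of all types. A type \<open>'u\<close> therefore plays the role
  of the universe: ``every module'' means every module whose carrier is a set of elements
  of \<open>'u\<close>. The main theorem assumes that \<open>'u\<close> is infinite and at least as large as the ground ring
  and the category, so that modules in \<open>'u\<close> are closed (up to isomorphism) under all constructions
  needed; projectivity, superfluity, finite generation and freeness of such a module do not then
  depend on \<open>'u\<close>. A suitable \<open>'u\<close> that moreover contains a copy of any given type \<open>'a\<close> always
  exists:\<close>

lemma universe_exists: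
  fixes K :: "'k ring" and C :: "('o, 'm) category"
  shows "infinite (UNIV :: ('k + 'm + 'a) list set)"
    "carrier K \<lesssim> (UNIV :: ('k + 'm + 'a) list set)"
    "Mor C \<lesssim> (UNIV :: ('k + 'm + 'a) list set)"
  subgoal by (rule infinite_UNIV_listI)
  subgoal unfolding lepoll_def by (rule exI[of _ "\<lambda>x. [Inl x]"]) (auto simp: inj_on_def)
  subgoal unfolding lepoll_def by (rule exI[of _ "\<lambda>x. [Inr (Inl x)]"]) (auto simp: inj_on_def)
  done

definition perfect_ring :: "'u itself \<Rightarrow> 'r ring \<Rightarrow> bool" where
  "perfect_ring _ R \<longleftrightarrow>
    (\<forall>N :: ('r, 'u) module. left_module R N \<longrightarrow> (\<exists>p. projective_cover (Mod_cat R) p N))"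

definition semiperfect_ring :: "'u itself \<Rightarrow> 'r ring \<Rightarrow> bool" where
  "semiperfect_ring _ R \<longleftrightarrow>
    (\<forall>N :: ('r, 'u) module. fin_gen_left_module R N \<longrightarrow>
      (\<exists>p. projective_cover (Mod_cat R) p N))"

definition direct_sum :: "'i set \<Rightarrow> ('i \<Rightarrow> ('r, 'a) module) \<Rightarrow> ('r, 'i \<Rightarrow> 'a) module" where
  "direct_sum I X = \<lparr>
    carrier = {x \<in> \<Pi>\<^sub>E i\<in>I. carrier (X i). finite {i \<in> I. x i \<noteq> \<zero>\<^bsub>X i\<^esub>}},
    mult = undefined,
    one = undefined,
    zero = (\<lambda>i\<in>I. \<zero>\<^bsub>X i\<^esub>),
    add = (\<lambda>x y. \<lambda>i\<in>I. x i \<oplus>\<^bsub>X i\<^esub> y i),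
    smult = (\<lambda>r x. \<lambda>i\<in>I. r \<odot>\<^bsub>X i\<^esub> x i)\<rparr>"

definition regular_module :: "'r ring \<Rightarrow> ('r, 'r) module" where
  "regular_module R = \<lparr>carrier = carrier R, mult = undefined, one = undefined,
    zero = \<zero>\<^bsub>R\<^esub>, add = (\<oplus>\<^bsub>R\<^esub>), smult = (\<otimes>\<^bsub>R\<^esub>)\<rparr>"

definition span_module :: "'r ring \<Rightarrow> 's set \<Rightarrow> ('r, 's \<Rightarrow> 'r) module" where
  "span_module R S = direct_sum S (\<lambda>_. regular_module R)"

text \<open>Over a nonzero ring a basis of a free module embeds into the module, and the zero module has
  the empty basis; so it suffices to consider index sets in \<open>'u\<close>.\<close>

definition free_left_module :: "'r ring \<Rightarrow> ('r, 'u) module \<Rightarrow> bool" where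
  "free_left_module R N \<longleftrightarrow> left_module R N \<and>
    (\<exists>(B :: 'u set) f. f \<in> lin_homs R (span_module R B) N \<and>
      bij_betw f (carrier (span_module R B)) (carrier N))"

definition group_ring :: "'k ring \<Rightarrow> 'g monoid \<Rightarrow> ('g \<Rightarrow> 'k) ring" where
  "group_ring K G = \<lparr>
    carrier = carrier (span_module K (carrier G)),
    mult = (\<lambda>x y. \<lambda>g \<in> carrier G.
      finsum K (\<lambda>(a, b). x a \<otimes>\<^bsub>K\<^esub> y b)
        {(a, b) \<in> carrier G \<times> carrier G.
          x a \<noteq> \<zero>\<^bsub>K\<^esub> \<and> y b \<noteq> \<zero>\<^bsub>K\<^esub> \<and> a \<otimes>\<^bsub>G\<^esub> b = g}),
    one = (\<lambda>g \<in> carrier G. if g = \<one>\<^bsub>G\<^esub> then \<one>\<^bsub>K\<^esub> else \<zero>\<^bsub>K\<^esub>),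
    zero = \<zero>\<^bsub>span_module K (carrier G)\<^esub>,
    add = (\<oplus>\<^bsub>span_module K (carrier G)\<^esub>)\<rparr>"

definition quotient_module :: "('r, 'a) module \<Rightarrow> 'a set \<Rightarrow> ('r, 'a set) module" where
  "quotient_module N H = \<lparr>
    carrier = a_rcosets\<^bsub>N\<^esub> H,
    mult = undefined,
    one = undefined,
    zero = H,
    add = set_add N,
    smult = (\<lambda>r X. \<Union>x\<in>X. H +>\<^bsub>N\<^esub> (r \<odot>\<^bsub>N\<^esub> x))\<rparr>"


section \<open>Modules over a category\<close>

text \<open>A functor from a category to \<open>K\<close>-modules, given by its values \<open>val\<close> on objects and its
  action \<open>act\<close> on morphisms. Only the restriction of \<open>act M u\<close> to the carrier of the value at the
  domain of \<open>u\<close> matters.\<close>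

record ('o, 'm, 'k, 'u) kc_module =
  val :: "'o \<Rightarrow> ('k, 'u) module"
  act :: "'m \<Rightarrow> 'u \<Rightarrow> 'u"

definition is_kc_module ::
  "'k ring \<Rightarrow> ('o, 'm) category \<Rightarrow> ('o, 'm, 'k, 'u) kc_module \<Rightarrow> bool" where
  "is_kc_module K C M \<longleftrightarrow>
    (\<forall>c \<in> Obj C. module K (val M c)) \<and>
    (\<forall>u \<in> Mor C. act M u \<in> lin_homs K (val M (Dom C u)) (val M (Cod C u))) \<and>
    (\<forall>c \<in> Obj C. \<forall>x \<in> carrier (val M c). act M (Id C c) x = x) \<and>
    (\<forall>u \<in> Mor C. \<forall>v \<in> Mor C. Cod C u = Dom C v \<longrightarrow>
      (\<forall>x \<in> carrier (val M (Dom C u)). act M (v \<diamondop>\<^bsub>C\<^esub> u) x = act M v (act M u x)))"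

definition nat_trans ::
  "'k ring \<Rightarrow> ('o, 'm) category \<Rightarrow> ('o, 'm, 'k, 'a) kc_module \<Rightarrow> ('o, 'm, 'k, 'b) kc_module \<Rightarrow>
    ('o \<Rightarrow> 'a \<Rightarrow> 'b) set" where
  "nat_trans K C M N =
    {f \<in> \<Pi>\<^sub>E c\<in>Obj C. lin_homs K (val M c) (val N c) \<inter> extensional (carrier (val M c)).
      \<forall>u \<in> Mor C. \<forall>x \<in> carrier (val M (Dom C u)).
        f (Cod C u) (act M u x) = act N u (f (Dom C u) x)}"

type_synonym ('o, 'm, 'k, 'u) kc_arrow = "(('o, 'm, 'k, 'u) kc_module, 'o \<Rightarrow> 'u \<Rightarrow> 'u) arrow"

definition kC_cat ::
  "'k ring \<Rightarrow> ('o, 'm) category \<Rightarrow>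
    (('o, 'm, 'k, 'u) kc_module, ('o, 'm, 'k, 'u) kc_arrow) category" where
  "kC_cat K C = \<lparr>
    Obj = {M. is_kc_module K C M},
    Mor = {f. is_kc_module K C (src f) \<and> is_kc_module K C (tgt f) \<and>
      fn f \<in> nat_trans K C (src f) (tgt f)},
    Dom = src,
    Cod = tgt,
    Id = (\<lambda>M. \<lparr>src = M, tgt = M, fn = (\<lambda>c \<in> Obj C. \<lambda>x \<in> carrier (val M c). x)\<rparr>),
    Comp = (\<lambda>g f. \<lparr>src = src f, tgt = tgt g,
      fn = (\<lambda>c \<in> Obj C. compose (carrier (val (src f) c)) (fn g c) (fn f c))\<rparr>)\<rparr>"

lemma category_kC_cat:
  fixes K :: "'k ring" and C :: "('o, 'm) category"
  assumes "category C"
  shows "category (kC_cat K C :: (('o, 'm, 'k, 'u) kc_module, _) category)"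
proof -
  interpret category C by fact
  have lin: "(\<lambda>x\<in>carrier N. x) \<in> lin_homs K N N" if "module K N" for N :: "('k, 'u) module"
  proof -
    interpret module K N by fact
    show ?thesis by (auto simp: lin_homs_def)
  qed
  have lin_comp: "compose (carrier L) g f \<in> lin_homs K L Q"
    if "f \<in> lin_homs K L N" "g \<in> lin_homs K N Q" "module K L" for f g and L N Q :: "('k, 'u) module"
  proof -
    interpret module K L by fact
    show ?thesis using that by (auto simp: lin_homs_def compose_def Pi_iff)
  qed
  show ?thesis
  proof (unfold_locales, goal_cases)
    case (3 M)
    then have M: "\<And>c. c \<in> Obj C \<Longrightarrow> module K (val M c)"
      and a: "\<And>u x. u \<in> Mor C \<Longrightarrow> x \<in> carrier (val M (Dom C u)) \<Longrightarrow> act M u x \<in> carrier (val M (Cod C u))"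
      by (auto simp: kC_cat_def is_kc_module_def lin_homs_def)
    with 3 show ?case
      by (auto simp: kC_cat_def homs_def nat_trans_def lin Dom_closed Cod_closed)
  next
    case (4 f a b g c)
    have "(\<lambda>c\<in>Obj C. compose (carrier (val a c)) (fn g c) (fn f c)) \<in> nat_trans K C a c"
    proof -
      have f: "fn f \<in> nat_trans K C a b" and g: "fn g \<in> nat_trans K C b c" and M: "is_kc_module K C a"
        using 4 by (auto simp: kC_cat_def homs_def)
      have a: "\<And>u x. u \<in> Mor C \<Longrightarrow> x \<in> carrier (val a (Dom C u)) \<Longrightarrow> act a u x \<in> carrier (val a (Cod C u))"
        using M by (auto simp: is_kc_module_def lin_homs_def)
      have f': "\<And>c x. c \<in> Obj C \<Longrightarrow> x \<in> carrier (val a c) \<Longrightarrow> fn f c x \<in> carrier (val b c)"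
        using f by (auto simp: nat_trans_def lin_homs_def PiE_iff)
      show ?thesis
        using f g M unfolding nat_trans_def is_kc_module_def
        by (auto simp: PiE_iff Dom_closed Cod_closed a f' compose_eq intro!: lin_comp)
    qed
    with 4 show ?case by (auto simp: kC_cat_def homs_def)
  next
    case (5 f a b g c h d)
    then show ?case
      by (auto simp: kC_cat_def homs_def nat_trans_def lin_homs_def PiE_iff intro!: restrict_ext compose_assoc[symmetric])
  next
    case (6 f a b)
    then show ?case
      by (cases f) (auto simp: kC_cat_def homs_def nat_trans_def PiE_iff extensional_def fun_eq_iff compose_def)
  next
    case (7 f a b)
    then show ?case
      by (cases f) (auto simp: kC_cat_def homs_def nat_trans_def lin_homs_def PiE_iff extensional_def fun_eq_iff compose_def Pi_iff)
  qed (auto simp: kC_cat_def)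
qed


subsection \<open>Free and finitely generated modules\<close>

definition representable ::
  "'k ring \<Rightarrow> ('o, 'm) category \<Rightarrow> 'o \<Rightarrow> ('o, 'm, 'k, 'm \<Rightarrow> 'k) kc_module" where
  "representable K C c = \<lparr>
    val = (\<lambda>d. span_module K (homs C c d)),
    act = (\<lambda>u x. \<lambda>w \<in> homs C c (Cod C u).
      \<Oplus>\<^bsub>K\<^esub>v \<in> {v \<in> homs C c (Dom C u). x v \<noteq> \<zero>\<^bsub>K\<^esub> \<and> u \<diamondop>\<^bsub>C\<^esub> v = w}. x v)\<rparr>"

definition kc_direct_sum ::
  "'i set \<Rightarrow> ('i \<Rightarrow> ('o, 'm, 'k, 'a) kc_module) \<Rightarrow> ('o, 'm, 'k, 'i \<Rightarrow> 'a) kc_module" where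
  "kc_direct_sum I X = \<lparr>
    val = (\<lambda>d. direct_sum I (\<lambda>i. val (X i) d)),
    act = (\<lambda>u x. \<lambda>i\<in>I. act (X i) u (x i))\<rparr>"

definition free_on ::
  "'k ring \<Rightarrow> ('o, 'm) category \<Rightarrow> ('o \<Rightarrow> 'b set) \<Rightarrow>
    ('o, 'm, 'k, 'o \<times> 'b \<Rightarrow> 'm \<Rightarrow> 'k) kc_module" where
  "free_on K C B = kc_direct_sum (SIGMA c : Obj C. B c) (\<lambda>(c, b). representable K C c)"

definition free_kc_module ::
  "'k ring \<Rightarrow> ('o, 'm) category \<Rightarrow> ('o, 'm, 'k, 'u) kc_module \<Rightarrow> bool" where
  "free_kc_module K C M \<longleftrightarrow> is_kc_module K C M \<and>
    (\<exists>(B :: 'o \<Rightarrow> 'u set) f. f \<in> nat_trans K C (free_on K C B) M \<and>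
      (\<forall>d \<in> Obj C. bij_betw (f d) (carrier (val (free_on K C B) d)) (carrier (val M d))))"

definition finite_type :: "('o, 'm) category \<Rightarrow> ('o \<Rightarrow> 'b set) \<Rightarrow> bool" where
  "finite_type C B \<longleftrightarrow> finite {cl C c | c. c \<in> Obj C \<and> B c \<noteq> {}}"

text \<open>Finiteness of the individual \<open>B c\<close> has to be understood per isomorphism class: if a class
  contains infinitely many objects, one basis element at each of them would otherwise be a
  ``finite'' basis. For a skeletal category the union below is just \<open>B c\<close>.\<close>

definition finite_basis :: "('o, 'm) category \<Rightarrow> ('o \<Rightarrow> 'b set) \<Rightarrow> bool" where
  "finite_basis C B \<longleftrightarrow> finite_type C B \<and> (\<forall>c \<in> Obj C. finite (SIGMA d : cl C c. B d))"

definition fin_gen ::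
  "'k ring \<Rightarrow> ('o, 'm) category \<Rightarrow> ('o, 'm, 'k, 'u) kc_module \<Rightarrow> bool" where
  "fin_gen K C M \<longleftrightarrow> is_kc_module K C M \<and>
    (\<exists>(B :: 'o \<Rightarrow> nat set) f. finite_basis C B \<and> f \<in> nat_trans K C (free_on K C B) M \<and>
      (\<forall>d \<in> Obj C. f d ` carrier (val (free_on K C B) d) = carrier (val M d)))"

definition kc_submodule ::
  "'k ring \<Rightarrow> ('o, 'm) category \<Rightarrow> ('o, 'm, 'k, 'u) kc_module \<Rightarrow> ('o \<Rightarrow> 'u set) \<Rightarrow> bool" where
  "kc_submodule K C M N \<longleftrightarrow>
    (\<forall>c \<in> Obj C. submodule (N c) K (val M c)) \<and>
    (\<forall>u \<in> Mor C. act M u ` N (Dom C u) \<subseteq> N (Cod C u))"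

definition restrict_kc ::
  "('o, 'm, 'k, 'u) kc_module \<Rightarrow> ('o \<Rightarrow> 'u set) \<Rightarrow> ('o, 'm, 'k, 'u) kc_module" where
  "restrict_kc M N = M\<lparr>val := \<lambda>c. (val M c)\<lparr>carrier := N c\<rparr>\<rparr>"

definition noetherian_kc :: "'u itself \<Rightarrow> 'k ring \<Rightarrow> ('o, 'm) category \<Rightarrow> bool" where
  "noetherian_kc _ K C \<longleftrightarrow>
    (\<forall>(M :: ('o, 'm, 'k, 'u) kc_module) N.
      fin_gen K C M \<and> kc_submodule K C M N \<longrightarrow> fin_gen K C (restrict_kc M N))"


subsection \<open>Supports\<close>

definition supp :: "('o, 'm) category \<Rightarrow> ('o, 'm, 'k, 'u) kc_module \<Rightarrow> 'o set set" where
  "supp C M = {cl C c | c. c \<in> Obj C \<and> carrier (val M c) \<noteq> {\<zero>\<^bsub>val M c\<^esub>}}"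

definition noniso_sum ::
  "'k ring \<Rightarrow> ('o, 'm) category \<Rightarrow> ('o, 'm, 'k, 'u) kc_module \<Rightarrow> 'o \<Rightarrow> 'u set" where
  "noniso_sum K C M c = (\<lambda>H. submodule H K (val M c)) hull
    (\<Union>u \<in> {u \<in> Mor C. Cod C u = c \<and> \<not> iso_mor C u}. act M u ` carrier (val M (Dom C u)))"

definition split_quotient ::
  "'k ring \<Rightarrow> ('o, 'm) category \<Rightarrow> ('o, 'm, 'k, 'u) kc_module \<Rightarrow> 'o \<Rightarrow> ('k, 'u set) module" where
  "split_quotient K C M c = quotient_module (val M c) (noniso_sum K C M c)"

definition minsupp :: "'k ring \<Rightarrow> ('o, 'm) category \<Rightarrow> ('o, 'm, 'k, 'u) kc_module \<Rightarrow> 'o set set" where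
  "minsupp K C M = {cl C c | c. c \<in> Obj C \<and>
    carrier (split_quotient K C M c) \<noteq> {\<zero>\<^bsub>split_quotient K C M c\<^esub>}}"


subsection \<open>Resolutions\<close>

definition arrow_image :: "('o, 'm, 'k, 'u) kc_arrow \<Rightarrow> 'o \<Rightarrow> 'u set" where
  "arrow_image f c = fn f c ` carrier (val (src f) c)"

definition arrow_kernel :: "('o, 'm, 'k, 'u) kc_arrow \<Rightarrow> 'o \<Rightarrow> 'u set" where
  "arrow_kernel f c = {x \<in> carrier (val (src f) c). fn f c x = \<zero>\<^bsub>val (tgt f) c\<^esub>}"

text \<open>A resolution of \<open>M\<close> is a pair of sequences \<open>P\<close>, \<open>d\<close>, where \<open>d 0\<close> is the augmentation
  from \<open>P 0\<close> to \<open>M\<close> and \<open>d (Suc n)\<close> is the differential from \<open>P (Suc n)\<close> to \<open>P n\<close>.\<close>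

definition projective_resolution ::
  "'k ring \<Rightarrow> ('o, 'm) category \<Rightarrow> ('o, 'm, 'k, 'u) kc_module \<Rightarrow>
    (nat \<Rightarrow> ('o, 'm, 'k, 'u) kc_module) \<Rightarrow> (nat \<Rightarrow> ('o, 'm, 'k, 'u) kc_arrow) \<Rightarrow> bool" where
  "projective_resolution K C M P d \<longleftrightarrow>
    (\<forall>n. projective (kC_cat K C) (P n)) \<and>
    d 0 \<in> homs (kC_cat K C) (P 0) M \<and>
    (\<forall>n. d (Suc n) \<in> homs (kC_cat K C) (P (Suc n)) (P n)) \<and>
    epic (kC_cat K C) (d 0) \<and>
    (\<forall>n. \<forall>c \<in> Obj C. arrow_image (d (Suc n)) c = arrow_kernel (d n) c)"

definition corestrict :: "('o, 'm, 'k, 'u) kc_arrow \<Rightarrow> ('o, 'm, 'k, 'u) kc_arrow" where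
  "corestrict f = f\<lparr>tgt := restrict_kc (tgt f) (arrow_image f)\<rparr>"

definition minimal_projective_resolution ::
  "'k ring \<Rightarrow> ('o, 'm) category \<Rightarrow> ('o, 'm, 'k, 'u) kc_module \<Rightarrow>
    (nat \<Rightarrow> ('o, 'm, 'k, 'u) kc_module) \<Rightarrow> (nat \<Rightarrow> ('o, 'm, 'k, 'u) kc_arrow) \<Rightarrow> bool" where
  "minimal_projective_resolution K C M P d \<longleftrightarrow>
    projective_resolution K C M P d \<and>
    projective_cover (kC_cat K C) (d 0) M \<and>
    (\<forall>n. projective_cover (kC_cat K C) (corestrict (d (Suc n)))
      (restrict_kc (P n) (arrow_image (d (Suc n)))))"

end

theory Submission
  imports Defs
begin

text \<open>Write \<open>S\<close> for the split quotient \<open>M(c) / (images of non-isomorphisms into c)\<close>, a module over the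
  group ring \<open>k[c]\<close>. As the support generates an Artinian upper set, a Nakayama lemma holds: a
  submodule of \<open>M\<close> that maps onto every split quotient is \<open>M\<close>. Choose one object \<open>c\<close> in each
  isomorphism class, a projective cover \<open>p : Q \<rightarrow> S\<close> over \<open>k[c]\<close> and generators of \<open>Q\<close>. Let \<open>F\<close> be
  the free module on all these generators and \<open>f : F \<rightarrow> M\<close> a lift of their images under \<open>p\<close>. The
  module \<open>k[mor(c, -)] \<otimes> Q\<close> induced from \<open>Q\<close> is not built as a tensor product but as the image of
  an idempotent of \<open>F\<close>: projectivity gives a section of \<open>F(c) \<rightarrow> Q\<close>, which can be chosen inside
  the summand of \<open>F(c)\<close> spanned by automorphisms, and sending each generator to its image under
  the section defines the idempotent. By Nakayama the restriction of \<open>f\<close> to its image \<open>P\<close> is a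
  superfluous epimorphism, because \<open>p\<close> is one. If the chosen generators form a basis of \<open>Q\<close>, the
  idempotent is the identity. Iterating the construction on kernels gives the minimal resolution;
  uniqueness of projective covers transfers freeness to every minimal resolution.\<close>

section \<open>Left modules\<close>

text \<open>Everything has to stay inside the one type \<open>'u\<close>, and this dictates the
  constructions. Cokernels are carried by chosen coset representatives, and free modules are copied
  into \<open>'u\<close> along injections, which exist because finitely supported functions are no
  more numerous than \<open>'u\<close>. An idempotent of the copied free module has its image in the
  same carrier, whereas a tensor product would require a new one.

  A second constraint comes from iteration. The ring hypotheses concern the upper set generated by
  \<open>minsupp K C M\<close>, while every syzygy has a minimal support of its own. But a cover is
  generated at objects of that upper set, hence vanishes elsewhere, and so does its kernel; in this
  way the hypotheses are inherited by every syzygy.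

  The statement on freeness is about an arbitrary minimal resolution and not only about the
  constructed one. Its induction therefore runs along the given resolution and carries the support
  bound together with freeness.\<close>

declare left_module.smult_closed [simp, intro] left_module.smult_one [simp]

context left_module
begin

lemma smult_zero_left [simp]: "x \<in> carrier M \<Longrightarrow> \<zero> \<odot>\<^bsub>M\<^esub> x = \<zero>\<^bsub>M\<^esub>"
  using smult_l_distr[of \<zero> \<zero> x] M.add.r_cancel_one'[of "\<zero> \<odot>\<^bsub>M\<^esub> x" "\<zero> \<odot>\<^bsub>M\<^esub> x"]
  by (simp add: smult_closed)

lemma smult_zero_right [simp]: "a \<in> carrier R \<Longrightarrow> a \<odot>\<^bsub>M\<^esub> \<zero>\<^bsub>M\<^esub> = \<zero>\<^bsub>M\<^esub>"
  using smult_r_distr[of a "\<zero>\<^bsub>M\<^esub>" "\<zero>\<^bsub>M\<^esub>"] M.add.r_cancel_one'[of "a \<odot>\<^bsub>M\<^esub> \<zero>\<^bsub>M\<^esub>" "a \<odot>\<^bsub>M\<^esub> \<zero>\<^bsub>M\<^esub>"]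
  by (simp add: smult_closed)

lemma smult_minus_one: "x \<in> carrier M \<Longrightarrow> (\<ominus> \<one>) \<odot>\<^bsub>M\<^esub> x = \<ominus>\<^bsub>M\<^esub> x"
  using smult_l_distr[of "\<ominus> \<one>" \<one> x]
  by (simp add: R.l_neg smult_closed smult_one M.minus_equality)

text \<open>Negatives come from the action of \<open>\<ominus> \<one>\<close>, so the additive
  subgroup inside the library notion is obtained from zero and sums.\<close>

lemma submodule_iff:
  "submodule H R M \<longleftrightarrow> H \<subseteq> carrier M \<and> \<zero>\<^bsub>M\<^esub> \<in> H \<and> (\<forall>x \<in> H. \<forall>y \<in> H. x \<oplus>\<^bsub>M\<^esub> y \<in> H) \<and>
    (\<forall>a \<in> carrier R. \<forall>x \<in> H. a \<odot>\<^bsub>M\<^esub> x \<in> H)" (is "?L \<longleftrightarrow> ?Q")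
proof
  assume ?L
  then interpret submodule H R M .
  show ?Q using subset one_closed m_closed by auto
next
  assume Q: ?Q
  have "\<ominus>\<^bsub>M\<^esub> x \<in> H" if "x \<in> H" for x
    using smult_minus_one[of x] Q that by (metis R.a_inv_closed R.one_closed subsetD)
  with Q show ?L
    by (auto intro!: submodule.intro subgroup.intro submodule_axioms.intro simp flip: a_inv_def)
qed

lemma submodule_carrier: "submodule (carrier M) R M"
  by (simp add: submodule_iff smult_closed)

lemma submodule_zero: "submodule {\<zero>\<^bsub>M\<^esub>} R M"
  by (simp add: submodule_iff)

lemma submodule_hull:
  assumes "S \<subseteq> carrier M" shows "submodule ((\<lambda>H. submodule H R M) hull S) R M"
  unfolding submodule_iff hull_def
  using assms submodule_carrier by (auto simp: submodule_iff smult_closed)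

lemma submodule_minus:
  assumes "submodule H R M" "x \<in> H" "y \<in> H" shows "x \<ominus>\<^bsub>M\<^esub> y \<in> H"
  using assms smult_minus_one[of y] unfolding submodule_iff a_minus_def
  by (metis R.a_inv_closed R.one_closed subsetD)

lemma minus_eq_zero_iff: "x \<in> carrier M \<Longrightarrow> y \<in> carrier M \<Longrightarrow> x \<ominus>\<^bsub>M\<^esub> y = \<zero>\<^bsub>M\<^esub> \<longleftrightarrow> x = y"
  by (metis M.a_inv_closed M.minus_equality M.minus_minus M.r_neg a_minus_def)

lemma minus_add_cancel: "x \<in> carrier M \<Longrightarrow> y \<in> carrier M \<Longrightarrow> (x \<ominus>\<^bsub>M\<^esub> y) \<oplus>\<^bsub>M\<^esub> y = x"
  by (simp add: a_minus_def M.a_assoc M.l_neg)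

end

lemma left_moduleI:
  fixes R (structure) and M (structure)
  assumes "ring R"
    and "\<zero>\<^bsub>M\<^esub> \<in> carrier M"
    and "\<And>x y. x \<in> carrier M \<Longrightarrow> y \<in> carrier M \<Longrightarrow> x \<oplus>\<^bsub>M\<^esub> y \<in> carrier M"
    and "\<And>x y z. x \<in> carrier M \<Longrightarrow> y \<in> carrier M \<Longrightarrow> z \<in> carrier M \<Longrightarrow>
      (x \<oplus>\<^bsub>M\<^esub> y) \<oplus>\<^bsub>M\<^esub> z = x \<oplus>\<^bsub>M\<^esub> (y \<oplus>\<^bsub>M\<^esub> z)"
    and "\<And>x y. x \<in> carrier M \<Longrightarrow> y \<in> carrier M \<Longrightarrow> x \<oplus>\<^bsub>M\<^esub> y = y \<oplus>\<^bsub>M\<^esub> x"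
    and "\<And>x. x \<in> carrier M \<Longrightarrow> \<zero>\<^bsub>M\<^esub> \<oplus>\<^bsub>M\<^esub> x = x"
    and "\<And>x. x \<in> carrier M \<Longrightarrow> \<exists>y \<in> carrier M. y \<oplus>\<^bsub>M\<^esub> x = \<zero>\<^bsub>M\<^esub>"
    and "\<And>a x. a \<in> carrier R \<Longrightarrow> x \<in> carrier M \<Longrightarrow> a \<odot>\<^bsub>M\<^esub> x \<in> carrier M"
    and "\<And>a b x. a \<in> carrier R \<Longrightarrow> b \<in> carrier R \<Longrightarrow> x \<in> carrier M \<Longrightarrow>
      (a \<oplus> b) \<odot>\<^bsub>M\<^esub> x = a \<odot>\<^bsub>M\<^esub> x \<oplus>\<^bsub>M\<^esub> b \<odot>\<^bsub>M\<^esub> x"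
    and "\<And>a x y. a \<in> carrier R \<Longrightarrow> x \<in> carrier M \<Longrightarrow> y \<in> carrier M \<Longrightarrow>
      a \<odot>\<^bsub>M\<^esub> (x \<oplus>\<^bsub>M\<^esub> y) = a \<odot>\<^bsub>M\<^esub> x \<oplus>\<^bsub>M\<^esub> a \<odot>\<^bsub>M\<^esub> y"
    and "\<And>a b x. a \<in> carrier R \<Longrightarrow> b \<in> carrier R \<Longrightarrow> x \<in> carrier M \<Longrightarrow>
      (a \<otimes> b) \<odot>\<^bsub>M\<^esub> x = a \<odot>\<^bsub>M\<^esub> (b \<odot>\<^bsub>M\<^esub> x)"
    and "\<And>x. x \<in> carrier M \<Longrightarrow> \<one> \<odot>\<^bsub>M\<^esub> x = x"
  shows "left_module R M"
  by (intro left_module.intro left_module_axioms.intro abelian_groupI) (use assms in auto)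

text \<open>\<open>N\<close> is only a record of operations here. The axioms are equations, closure
  conditions and the existence of negatives, all of which pass to an image. Quotients and
  transported modules get their structure this way.\<close>

lemma left_module_surj_image:
  assumes "left_module R M"
    and surj: "f ` carrier M = carrier N"
    and add: "\<And>x y. x \<in> carrier M \<Longrightarrow> y \<in> carrier M \<Longrightarrow> f (x \<oplus>\<^bsub>M\<^esub> y) = f x \<oplus>\<^bsub>N\<^esub> f y"
    and smult: "\<And>a x. a \<in> carrier R \<Longrightarrow> x \<in> carrier M \<Longrightarrow> f (a \<odot>\<^bsub>M\<^esub> x) = a \<odot>\<^bsub>N\<^esub> f x"
    and zero: "f \<zero>\<^bsub>M\<^esub> = \<zero>\<^bsub>N\<^esub>"
  shows "left_module R N"
proof -
  interpret left_module R M by fact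
  have *: "(\<And>x. x \<in> carrier M \<Longrightarrow> P (f x)) \<Longrightarrow> y \<in> carrier N \<Longrightarrow> P y" for P y
    by (metis image_iff surj)
  have cl: "\<And>x. x \<in> carrier M \<Longrightarrow> f x \<in> carrier N"
    using surj by auto
  have ad: "\<And>x y. x \<in> carrier M \<Longrightarrow> y \<in> carrier M \<Longrightarrow> f x \<oplus>\<^bsub>N\<^esub> f y = f (x \<oplus>\<^bsub>M\<^esub> y)"
    and sm: "\<And>a x. a \<in> carrier R \<Longrightarrow> x \<in> carrier M \<Longrightarrow> a \<odot>\<^bsub>N\<^esub> f x = f (a \<odot>\<^bsub>M\<^esub> x)"
    by (simp_all add: add smult)
  note rules = cl ad sm zero[symmetric] smult_closed
  show ?thesis
  proof (rule left_moduleI)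
    show "\<zero>\<^bsub>N\<^esub> \<in> carrier N" by (simp add: rules)
    show "x \<oplus>\<^bsub>N\<^esub> y \<in> carrier N" if "x \<in> carrier N" "y \<in> carrier N" for x y
      using that by (elim *[rotated]) (simp add: rules)
    show "(x \<oplus>\<^bsub>N\<^esub> y) \<oplus>\<^bsub>N\<^esub> z = x \<oplus>\<^bsub>N\<^esub> (y \<oplus>\<^bsub>N\<^esub> z)"
      if "x \<in> carrier N" "y \<in> carrier N" "z \<in> carrier N" for x y z
      using that surj by (auto simp: rules M.a_assoc image_iff set_eq_iff) (smt (verit, best) rules M.a_assoc M.a_closed)
    show "x \<oplus>\<^bsub>N\<^esub> y = y \<oplus>\<^bsub>N\<^esub> x" if "x \<in> carrier N" "y \<in> carrier N" for x y
      using that unfolding surj[symmetric] by (auto simp: rules M.a_comm)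
    show "\<zero>\<^bsub>N\<^esub> \<oplus>\<^bsub>N\<^esub> x = x" if "x \<in> carrier N" for x
      using that by (elim *[rotated]) (simp add: rules)
    show "\<exists>y \<in> carrier N. y \<oplus>\<^bsub>N\<^esub> x = \<zero>\<^bsub>N\<^esub>" if "x \<in> carrier N" for x
    proof -
      obtain z where "z \<in> carrier M" "x = f z" using \<open>x \<in> carrier N\<close> surj by auto
      then show ?thesis by (intro bexI[of _ "f (\<ominus>\<^bsub>M\<^esub> z)"]) (simp_all add: rules M.l_neg)
    qed
    show "a \<odot>\<^bsub>N\<^esub> x \<in> carrier N" if "a \<in> carrier R" "x \<in> carrier N" for a x
      using that(2,1) by (elim *[rotated]) (simp add: rules)
    show "(a \<oplus>\<^bsub>R\<^esub> b) \<odot>\<^bsub>N\<^esub> x = a \<odot>\<^bsub>N\<^esub> x \<oplus>\<^bsub>N\<^esub> b \<odot>\<^bsub>N\<^esub> x"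
      if "a \<in> carrier R" "b \<in> carrier R" "x \<in> carrier N" for a b x
      using that(3,1,2) by (elim *[rotated]) (simp add: rules smult_l_distr)
    show "a \<odot>\<^bsub>N\<^esub> (x \<oplus>\<^bsub>N\<^esub> y) = a \<odot>\<^bsub>N\<^esub> x \<oplus>\<^bsub>N\<^esub> a \<odot>\<^bsub>N\<^esub> y"
      if "a \<in> carrier R" "x \<in> carrier N" "y \<in> carrier N" for a x y
      using that unfolding surj[symmetric] by (auto simp: rules smult_r_distr)
    show "(a \<otimes>\<^bsub>R\<^esub> b) \<odot>\<^bsub>N\<^esub> x = a \<odot>\<^bsub>N\<^esub> (b \<odot>\<^bsub>N\<^esub> x)"
      if "a \<in> carrier R" "b \<in> carrier R" "x \<in> carrier N" for a b x
      using that(3,1,2) by (elim *[rotated]) (simp add: rules smult_assoc1)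
    show "\<one>\<^bsub>R\<^esub> \<odot>\<^bsub>N\<^esub> x = x" if "x \<in> carrier N" for x
      using that by (elim *[rotated]) (simp add: rules smult_one)
  qed (rule R.ring_axioms)
qed

lemma (in left_module) left_module_submodule:
  assumes "submodule H R M" shows "left_module R (M\<lparr>carrier := H\<rparr>)"
proof (rule left_moduleI)
  note * = assms[unfolded submodule_iff]
  show "\<exists>y \<in> carrier (M\<lparr>carrier := H\<rparr>). y \<oplus>\<^bsub>M\<lparr>carrier := H\<rparr>\<^esub> x = \<zero>\<^bsub>M\<lparr>carrier := H\<rparr>\<^esub>"
    if "x \<in> carrier (M\<lparr>carrier := H\<rparr>)" for x
    using that * submodule_minus[OF assms, of "\<zero>\<^bsub>M\<^esub>" x] M.l_neg[of x]
    by (intro bexI[of _ "\<ominus>\<^bsub>M\<^esub> x"]) (auto simp: a_minus_def)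
qed (use assms in \<open>auto simp: submodule_iff subset_eq M.a_ac smult_l_distr smult_r_distr smult_assoc1 smult_one R.ring_axioms\<close>)

lemma lin_homsI:
  assumes "\<And>x. x \<in> carrier M \<Longrightarrow> f x \<in> carrier N"
    and "\<And>x y. x \<in> carrier M \<Longrightarrow> y \<in> carrier M \<Longrightarrow> f (x \<oplus>\<^bsub>M\<^esub> y) = f x \<oplus>\<^bsub>N\<^esub> f y"
    and "\<And>r x. r \<in> carrier R \<Longrightarrow> x \<in> carrier M \<Longrightarrow> f (r \<odot>\<^bsub>M\<^esub> x) = r \<odot>\<^bsub>N\<^esub> f x"
  shows "f \<in> lin_homs R M N"
  using assms by (auto simp: lin_homs_def)

lemma lin_homs_closed: "f \<in> lin_homs R M N \<Longrightarrow> x \<in> carrier M \<Longrightarrow> f x \<in> carrier N"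
  and lin_homs_add: "f \<in> lin_homs R M N \<Longrightarrow> x \<in> carrier M \<Longrightarrow> y \<in> carrier M \<Longrightarrow>
    f (x \<oplus>\<^bsub>M\<^esub> y) = f x \<oplus>\<^bsub>N\<^esub> f y"
  and lin_homs_smult: "f \<in> lin_homs R M N \<Longrightarrow> r \<in> carrier R \<Longrightarrow> x \<in> carrier M \<Longrightarrow>
    f (r \<odot>\<^bsub>M\<^esub> x) = r \<odot>\<^bsub>N\<^esub> f x"
  by (auto simp: lin_homs_def)

lemma lin_homs_zero:
  assumes "left_module R M" "left_module R N" "f \<in> lin_homs R M N"
  shows "f \<zero>\<^bsub>M\<^esub> = \<zero>\<^bsub>N\<^esub>"
proof -
  interpret M: left_module R M by fact
  interpret N: left_module R N by fact
  show ?thesis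
    using lin_homs_smult[OF assms(3), of "\<zero>\<^bsub>R\<^esub>" "\<zero>\<^bsub>M\<^esub>"] lin_homs_closed[OF assms(3), of "\<zero>\<^bsub>M\<^esub>"] by simp
qed

lemma lin_homs_minus:
  assumes "left_module R M" "left_module R N" "f \<in> lin_homs R M N" "x \<in> carrier M" "y \<in> carrier M"
  shows "f (x \<ominus>\<^bsub>M\<^esub> y) = f x \<ominus>\<^bsub>N\<^esub> f y"
proof -
  interpret M: left_module R M by fact
  interpret N: left_module R N by fact
  show ?thesis using assms
    by (simp add: a_minus_def lin_homs_add lin_homs_closed lin_homs_smult
        flip: M.smult_minus_one N.smult_minus_one)
qed

lemma lin_homs_compose:
  "f \<in> lin_homs R L M \<Longrightarrow> g \<in> lin_homs R M N \<Longrightarrow> (\<lambda>x. g (f x)) \<in> lin_homs R L N"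
  by (auto simp: lin_homs_def Pi_iff)

lemma lin_homs_cong:
  assumes "left_module R M" "\<And>x. x \<in> carrier M \<Longrightarrow> f x = g x"
  shows "f \<in> lin_homs R M N \<longleftrightarrow> g \<in> lin_homs R M N"
proof -
  interpret left_module R M by fact
  show ?thesis using assms(2) by (auto simp: lin_homs_def Pi_iff smult_closed)
qed

lemma lin_homs_submodule:
  "f \<in> lin_homs R M N \<Longrightarrow> H \<subseteq> carrier M \<Longrightarrow> f ` H \<subseteq> K \<Longrightarrow>
    f \<in> lin_homs R (M\<lparr>carrier := H\<rparr>) (N\<lparr>carrier := K\<rparr>)"
  by (auto simp: lin_homs_def image_subset_iff subset_iff)

lemma submodule_image:
  assumes "left_module R M" "left_module R N" "f \<in> lin_homs R M N" "submodule H R M"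
  shows "submodule (f ` H) R N"
proof -
  interpret M: left_module R M by fact
  interpret N: left_module R N by fact
  have H: "H \<subseteq> carrier M" "\<zero>\<^bsub>M\<^esub> \<in> H" "\<And>x y. x \<in> H \<Longrightarrow> y \<in> H \<Longrightarrow> x \<oplus>\<^bsub>M\<^esub> y \<in> H"
    "\<And>a x. a \<in> carrier R \<Longrightarrow> x \<in> H \<Longrightarrow> a \<odot>\<^bsub>M\<^esub> x \<in> H"
    using assms(4) by (auto simp: M.submodule_iff)
  have "f x \<oplus>\<^bsub>N\<^esub> f y \<in> f ` H" if "x \<in> H" "y \<in> H" for x y
    using that H by (auto simp: subset_iff simp flip: lin_homs_add[OF assms(3)])
  moreover have "a \<odot>\<^bsub>N\<^esub> f x \<in> f ` H" if "a \<in> carrier R" "x \<in> H" for a x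
    using that H by (auto simp: subset_iff simp flip: lin_homs_smult[OF assms(3)])
  moreover have "\<zero>\<^bsub>N\<^esub> \<in> f ` H"
    using lin_homs_zero[OF assms(1-3)] H by force
  ultimately show ?thesis
    using H lin_homs_closed[OF assms(3)] by (auto simp: N.submodule_iff)
qed

lemma submodule_vimage:
  assumes "left_module R M" "left_module R N" "f \<in> lin_homs R M N" "submodule H R N"
  shows "submodule {x \<in> carrier M. f x \<in> H} R M"
proof -
  interpret M: left_module R M by fact
  interpret N: left_module R N by fact
  show ?thesis using assms
    by (auto simp: M.submodule_iff N.submodule_iff lin_homs_zero lin_homs_add lin_homs_smult)
qed

text \<open>The source of the uniqueness arguments below: if two linear maps agree on generators,
  their equalizer is a submodule containing the generators.\<close>

lemma submodule_equalizer:
  assumes "left_module R M" "left_module R N" "f \<in> lin_homs R M N" "g \<in> lin_homs R M N"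
  shows "submodule {x \<in> carrier M. f x = g x} R M"
proof -
  interpret M: left_module R M by fact
  show ?thesis using assms lin_homs_zero[OF assms(1-3)] lin_homs_zero[OF assms(1,2,4)]
    by (auto simp: M.submodule_iff lin_homs_add lin_homs_smult)
qed


subsection \<open>Quotients on coset representatives\<close>

definition coset_rep :: "('r, 'a) module \<Rightarrow> 'a set \<Rightarrow> 'a \<Rightarrow> 'a" where
  "coset_rep M H x = (SOME y. y \<in> carrier M \<and> x \<ominus>\<^bsub>M\<^esub> y \<in> H)"

text \<open>Representing cosets by chosen elements keeps a quotient inside the type of the module, hence
  inside the universe.\<close>

definition rep_quotient :: "('r, 'a) module \<Rightarrow> 'a set \<Rightarrow> ('r, 'a) module" where
  "rep_quotient M H = M\<lparr>carrier := coset_rep M H ` carrier M,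
     zero := coset_rep M H \<zero>\<^bsub>M\<^esub>,
     add := \<lambda>x y. coset_rep M H (x \<oplus>\<^bsub>M\<^esub> y),
     smult := \<lambda>r x. coset_rep M H (r \<odot>\<^bsub>M\<^esub> x)\<rparr>"

lemma rep_quotient_simps [simp]:
  "carrier (rep_quotient M H) = coset_rep M H ` carrier M"
  "\<zero>\<^bsub>rep_quotient M H\<^esub> = coset_rep M H \<zero>\<^bsub>M\<^esub>"
  "x \<oplus>\<^bsub>rep_quotient M H\<^esub> y = coset_rep M H (x \<oplus>\<^bsub>M\<^esub> y)"
  "r \<odot>\<^bsub>rep_quotient M H\<^esub> x = coset_rep M H (r \<odot>\<^bsub>M\<^esub> x)"
  by (simp_all add: rep_quotient_def)

context
  fixes R :: "'r ring" and M :: "('r, 'a) module" and H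
  assumes M: "left_module R M" and H: "submodule H R M"
begin

interpretation left_module R M by (rule M)

lemma coset_rep:
  assumes "x \<in> carrier M"
  shows coset_rep_closed: "coset_rep M H x \<in> carrier M"
    and minus_coset_rep: "x \<ominus>\<^bsub>M\<^esub> coset_rep M H x \<in> H"
proof -
  have "x \<in> carrier M \<and> x \<ominus>\<^bsub>M\<^esub> x \<in> H"
    using assms H by (simp add: minus_eq_zero_iff[THEN iffD2] submodule_iff)
  then have "coset_rep M H x \<in> carrier M \<and> x \<ominus>\<^bsub>M\<^esub> coset_rep M H x \<in> H"
    unfolding coset_rep_def by (rule someI)
  then show "coset_rep M H x \<in> carrier M" "x \<ominus>\<^bsub>M\<^esub> coset_rep M H x \<in> H" by auto
qed

text \<open>The choice in \<open>coset_rep\<close> depends on \<open>x\<close> only through the set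
  of \<open>y\<close> with \<open>x - y\<close> in \<open>H\<close>, and congruent elements define
  the same set. So the representative is an invariant of the coset.\<close>

lemma coset_rep_eq_iff:
  assumes x: "x \<in> carrier M" and y: "y \<in> carrier M"
  shows "coset_rep M H x = coset_rep M H y \<longleftrightarrow> x \<ominus>\<^bsub>M\<^esub> y \<in> H"
proof
  have *: "(a \<ominus>\<^bsub>M\<^esub> b) \<oplus>\<^bsub>M\<^esub> (b \<ominus>\<^bsub>M\<^esub> c) = a \<ominus>\<^bsub>M\<^esub> c" if "a \<in> carrier M" "b \<in> carrier M" "c \<in> carrier M" for a b c
    using that by (simp add: a_minus_def M.a_assoc M.r_neg1)
  have neg: "b \<ominus>\<^bsub>M\<^esub> a \<in> H" if "a \<ominus>\<^bsub>M\<^esub> b \<in> H" "a \<in> carrier M" "b \<in> carrier M" for a b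
    using submodule_minus[OF H, of "\<zero>\<^bsub>M\<^esub>" "a \<ominus>\<^bsub>M\<^esub> b"] that H
    by (simp add: submodule_iff a_minus_def M.minus_add M.a_comm)
  have tr: "a \<ominus>\<^bsub>M\<^esub> c \<in> H"
    if "a \<ominus>\<^bsub>M\<^esub> b \<in> H" "b \<ominus>\<^bsub>M\<^esub> c \<in> H" "a \<in> carrier M" "b \<in> carrier M" "c \<in> carrier M" for a b c
    using *[of a b c] that H by (metis submodule_iff)
  show "x \<ominus>\<^bsub>M\<^esub> y \<in> H" if "coset_rep M H x = coset_rep M H y"
    using that coset_rep x y tr neg by metis
  show "coset_rep M H x = coset_rep M H y" if xy: "x \<ominus>\<^bsub>M\<^esub> y \<in> H"
  proof -
    have "x \<ominus>\<^bsub>M\<^esub> z \<in> H \<longleftrightarrow> y \<ominus>\<^bsub>M\<^esub> z \<in> H" if "z \<in> carrier M" for z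
      using xy x y that tr[of x y z] tr[of y x z] neg[of x y] by blast
    then show ?thesis unfolding coset_rep_def by metis
  qed
qed

lemma coset_rep_idem: "x \<in> carrier M \<Longrightarrow> coset_rep M H (coset_rep M H x) = coset_rep M H x"
  using coset_rep_eq_iff coset_rep by metis

lemma coset_rep_eq_zero_iff:
  "x \<in> carrier M \<Longrightarrow> coset_rep M H x = coset_rep M H \<zero>\<^bsub>M\<^esub> \<longleftrightarrow> x \<in> H"
  by (simp add: coset_rep_eq_iff a_minus_def M.minus_equality[of "\<zero>\<^bsub>M\<^esub>" "\<zero>\<^bsub>M\<^esub>"])

lemma coset_rep_add:
  assumes "x \<in> carrier M" "y \<in> carrier M"
  shows "coset_rep M H (x \<oplus>\<^bsub>M\<^esub> y) = coset_rep M H x \<oplus>\<^bsub>rep_quotient M H\<^esub> coset_rep M H y"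
proof -
  have "(x \<oplus>\<^bsub>M\<^esub> y) \<ominus>\<^bsub>M\<^esub> (coset_rep M H x \<oplus>\<^bsub>M\<^esub> coset_rep M H y) =
      (x \<ominus>\<^bsub>M\<^esub> coset_rep M H x) \<oplus>\<^bsub>M\<^esub> (y \<ominus>\<^bsub>M\<^esub> coset_rep M H y)"
    using assms coset_rep by (simp add: a_minus_def M.minus_add M.a_ac)
  then show ?thesis
    using assms coset_rep H by (simp add: coset_rep_eq_iff submodule_iff)
qed

lemma coset_rep_smult:
  assumes "a \<in> carrier R" "x \<in> carrier M"
  shows "coset_rep M H (a \<odot>\<^bsub>M\<^esub> x) = a \<odot>\<^bsub>rep_quotient M H\<^esub> coset_rep M H x"
proof -
  have "(a \<odot>\<^bsub>M\<^esub> x) \<ominus>\<^bsub>M\<^esub> (a \<odot>\<^bsub>M\<^esub> coset_rep M H x) = a \<odot>\<^bsub>M\<^esub> (x \<ominus>\<^bsub>M\<^esub> coset_rep M H x)"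
    using assms coset_rep smult_assoc1[of a "\<ominus>\<^bsub>R\<^esub> \<one>\<^bsub>R\<^esub>" "coset_rep M H x"]
      smult_assoc1[of "\<ominus>\<^bsub>R\<^esub> \<one>\<^bsub>R\<^esub>" a "coset_rep M H x"]
    by (simp add: a_minus_def smult_r_distr smult_closed R.l_minus R.r_minus flip: smult_minus_one)
  then show ?thesis
    using assms coset_rep H by (simp add: coset_rep_eq_iff submodule_iff smult_closed)
qed

lemma left_module_rep_quotient: "left_module R (rep_quotient M H)"
  by (rule left_module_surj_image[OF M, of "coset_rep M H"])
    (use coset_rep_add coset_rep_smult in auto)

lemma coset_rep_lin: "coset_rep M H \<in> lin_homs R M (rep_quotient M H)"
  by (rule lin_homsI) (use coset_rep_add coset_rep_smult in auto)

end


subsection \<open>Transport of structure along injections\<close>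

text \<open>Free modules are built on function types; this copies them onto a subset of the
  universe. Operations are computed on preimages, so injectivity on the carrier is all that
  \<open>\<phi>\<close> must satisfy.\<close>

definition transport_module :: "('a \<Rightarrow> 'b) \<Rightarrow> ('r, 'a) module \<Rightarrow> ('r, 'b) module" where
  "transport_module \<phi> N = \<lparr>carrier = \<phi> ` carrier N, mult = undefined, one = undefined,
     zero = \<phi> \<zero>\<^bsub>N\<^esub>,
     add = \<lambda>x y. \<phi> (inv_into (carrier N) \<phi> x \<oplus>\<^bsub>N\<^esub> inv_into (carrier N) \<phi> y),
     smult = \<lambda>r x. \<phi> (r \<odot>\<^bsub>N\<^esub> inv_into (carrier N) \<phi> x)\<rparr>"

context
  fixes R :: "'r ring" and N :: "('r, 'a) module" and \<phi> :: "'a \<Rightarrow> 'b"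
  assumes N: "left_module R N" and inj: "inj_on \<phi> (carrier N)"
begin

interpretation left_module R N by (rule N)

lemma transport_lin: "\<phi> \<in> lin_homs R N (transport_module \<phi> N)"
  by (rule lin_homsI) (use inj in \<open>auto simp: transport_module_def\<close>)

lemma transport_inv_lin: "inv_into (carrier N) \<phi> \<in> lin_homs R (transport_module \<phi> N) N"
  by (rule lin_homsI) (use inj in \<open>auto simp: transport_module_def smult_closed\<close>)

end


subsection \<open>Direct sums\<close>

definition ds_single :: "('i \<Rightarrow> ('r, 'a) module) \<Rightarrow> 'i set \<Rightarrow> 'i \<Rightarrow> 'a \<Rightarrow> 'i \<Rightarrow> 'a" where
  "ds_single X I i a = (\<lambda>j\<in>I. if j = i then a else \<zero>\<^bsub>X j\<^esub>)"

text \<open>The map out of the coproduct determined by maps \<open>f i\<close> on the summands.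
  Summing over the support keeps the index set finite.\<close>

definition ds_lift ::
  "('i \<Rightarrow> ('r, 'a) module) \<Rightarrow> 'i set \<Rightarrow> ('r, 'b) module \<Rightarrow> ('i \<Rightarrow> 'a \<Rightarrow> 'b) \<Rightarrow> ('i \<Rightarrow> 'a) \<Rightarrow> 'b" where
  "ds_lift X I N f x = (\<Oplus>\<^bsub>N\<^esub> i \<in> {i \<in> I. x i \<noteq> \<zero>\<^bsub>X i\<^esub>}. f i (x i))"

lemma direct_sum_simps [simp]:
  "carrier (direct_sum I X) = {x \<in> \<Pi>\<^sub>E i\<in>I. carrier (X i). finite {i \<in> I. x i \<noteq> \<zero>\<^bsub>X i\<^esub>}}"
  "\<zero>\<^bsub>direct_sum I X\<^esub> = (\<lambda>i\<in>I. \<zero>\<^bsub>X i\<^esub>)"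
  "x \<oplus>\<^bsub>direct_sum I X\<^esub> y = (\<lambda>i\<in>I. x i \<oplus>\<^bsub>X i\<^esub> y i)"
  "r \<odot>\<^bsub>direct_sum I X\<^esub> x = (\<lambda>i\<in>I. r \<odot>\<^bsub>X i\<^esub> x i)"
  by (simp_all add: direct_sum_def)

context
  fixes R :: "'r ring" and X :: "'i \<Rightarrow> ('r, 'a) module" and I :: "'i set"
  assumes R: "ring R" and X: "\<And>i. i \<in> I \<Longrightarrow> left_module R (X i)"
begin

interpretation R: ring R by (rule R)

lemma summand_zero: "i \<in> I \<Longrightarrow> \<zero>\<^bsub>X i\<^esub> \<in> carrier (X i)"
  and summand_add: "i \<in> I \<Longrightarrow> a \<in> carrier (X i) \<Longrightarrow> b \<in> carrier (X i) \<Longrightarrow> a \<oplus>\<^bsub>X i\<^esub> b \<in> carrier (X i)"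
  and summand_zero_add: "i \<in> I \<Longrightarrow> a \<in> carrier (X i) \<Longrightarrow> \<zero>\<^bsub>X i\<^esub> \<oplus>\<^bsub>X i\<^esub> a = a"
  and summand_add_zero: "i \<in> I \<Longrightarrow> a \<in> carrier (X i) \<Longrightarrow> a \<oplus>\<^bsub>X i\<^esub> \<zero>\<^bsub>X i\<^esub> = a"
  and summand_smult_zero: "i \<in> I \<Longrightarrow> r \<in> carrier R \<Longrightarrow> r \<odot>\<^bsub>X i\<^esub> \<zero>\<^bsub>X i\<^esub> = \<zero>\<^bsub>X i\<^esub>"
  and summand_smult: "i \<in> I \<Longrightarrow> r \<in> carrier R \<Longrightarrow> a \<in> carrier (X i) \<Longrightarrow> r \<odot>\<^bsub>X i\<^esub> a \<in> carrier (X i)"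
proof -
  assume "i \<in> I"
  interpret left_module R "X i" by (rule X) fact
  show "\<zero>\<^bsub>X i\<^esub> \<in> carrier (X i)"
    "a \<in> carrier (X i) \<Longrightarrow> b \<in> carrier (X i) \<Longrightarrow> a \<oplus>\<^bsub>X i\<^esub> b \<in> carrier (X i)"
    "a \<in> carrier (X i) \<Longrightarrow> \<zero>\<^bsub>X i\<^esub> \<oplus>\<^bsub>X i\<^esub> a = a"
    "a \<in> carrier (X i) \<Longrightarrow> a \<oplus>\<^bsub>X i\<^esub> \<zero>\<^bsub>X i\<^esub> = a"
    "r \<in> carrier R \<Longrightarrow> r \<odot>\<^bsub>X i\<^esub> \<zero>\<^bsub>X i\<^esub> = \<zero>\<^bsub>X i\<^esub>"
    "r \<in> carrier R \<Longrightarrow> a \<in> carrier (X i) \<Longrightarrow> r \<odot>\<^bsub>X i\<^esub> a \<in> carrier (X i)"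
    by (simp_all add: smult_closed)
qed

lemma direct_sum_add_closed:
  assumes "x \<in> carrier (direct_sum I X)" "y \<in> carrier (direct_sum I X)"
  shows "x \<oplus>\<^bsub>direct_sum I X\<^esub> y \<in> carrier (direct_sum I X)"
proof -
  have "{i \<in> I. x i \<oplus>\<^bsub>X i\<^esub> y i \<noteq> \<zero>\<^bsub>X i\<^esub>} \<subseteq> {i \<in> I. x i \<noteq> \<zero>\<^bsub>X i\<^esub>} \<union> {i \<in> I. y i \<noteq> \<zero>\<^bsub>X i\<^esub>}"
    using summand_zero_add summand_zero by fastforce
  with assms show ?thesis
    by (auto simp: PiE_iff summand_add cong: conj_cong intro: finite_subset)
qed

lemma direct_sum_smult_closed:
  assumes "r \<in> carrier R" "x \<in> carrier (direct_sum I X)"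
  shows "r \<odot>\<^bsub>direct_sum I X\<^esub> x \<in> carrier (direct_sum I X)"
proof -
  have "{i \<in> I. r \<odot>\<^bsub>X i\<^esub> x i \<noteq> \<zero>\<^bsub>X i\<^esub>} \<subseteq> {i \<in> I. x i \<noteq> \<zero>\<^bsub>X i\<^esub>}"
    using assms summand_smult_zero by auto
  with assms show ?thesis
    by (auto simp: PiE_iff summand_smult cong: conj_cong intro: finite_subset)
qed

lemma left_module_direct_sum: "left_module R (direct_sum I X)"
proof (rule left_moduleI[OF R])
  fix x assume x: "x \<in> carrier (direct_sum I X)"
  have neg: "(\<ominus>\<^bsub>R\<^esub> \<one>\<^bsub>R\<^esub>) \<odot>\<^bsub>X i\<^esub> x i \<oplus>\<^bsub>X i\<^esub> x i = \<zero>\<^bsub>X i\<^esub>" if "i \<in> I" for i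
  proof -
    interpret left_module R "X i" by (rule X) fact
    show ?thesis using x that
      by (simp add: PiE_iff smult_minus_one M.l_neg)
  qed
  show "\<exists>y \<in> carrier (direct_sum I X). y \<oplus>\<^bsub>direct_sum I X\<^esub> x = \<zero>\<^bsub>direct_sum I X\<^esub>"
    by (rule bexI[OF _ direct_sum_smult_closed[OF _ x, of "\<ominus>\<^bsub>R\<^esub> \<one>\<^bsub>R\<^esub>"]])
      (use neg in \<open>auto simp: fun_eq_iff\<close>)
next
  fix x y z
  assume "x \<in> carrier (direct_sum I X)" "y \<in> carrier (direct_sum I X)" "z \<in> carrier (direct_sum I X)"
  then have "x i \<in> carrier (X i)" "y i \<in> carrier (X i)" "z i \<in> carrier (X i)" if "i \<in> I" for i
    using that by (auto simp: PiE_iff)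
  then have "x i \<oplus>\<^bsub>X i\<^esub> y i \<oplus>\<^bsub>X i\<^esub> z i = x i \<oplus>\<^bsub>X i\<^esub> (y i \<oplus>\<^bsub>X i\<^esub> z i)" if "i \<in> I" for i
    using abelian_monoid.a_assoc[OF abelian_group.axioms(1)[OF left_module.axioms(2)[OF X[OF that]]]] that by simp
  then show "x \<oplus>\<^bsub>direct_sum I X\<^esub> y \<oplus>\<^bsub>direct_sum I X\<^esub> z = x \<oplus>\<^bsub>direct_sum I X\<^esub> (y \<oplus>\<^bsub>direct_sum I X\<^esub> z)"
    by (auto simp: fun_eq_iff)
next
  fix x y
  assume "x \<in> carrier (direct_sum I X)" "y \<in> carrier (direct_sum I X)"
  then have "x i \<in> carrier (X i)" "y i \<in> carrier (X i)" if "i \<in> I" for i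
    using that by (auto simp: PiE_iff)
  then have "x i \<oplus>\<^bsub>X i\<^esub> y i = y i \<oplus>\<^bsub>X i\<^esub> x i" if "i \<in> I" for i
    using abelian_monoid.a_comm[OF abelian_group.axioms(1)[OF left_module.axioms(2)[OF X[OF that]]]] that by simp
  then show "x \<oplus>\<^bsub>direct_sum I X\<^esub> y = y \<oplus>\<^bsub>direct_sum I X\<^esub> x"
    by (auto simp: fun_eq_iff)
next
  fix a x y
  assume a: "a \<in> carrier R"
    and "x \<in> carrier (direct_sum I X)" "y \<in> carrier (direct_sum I X)"
  then have "x i \<in> carrier (X i)" "y i \<in> carrier (X i)" if "i \<in> I" for i
    using that by (auto simp: PiE_iff)
  then have "a \<odot>\<^bsub>X i\<^esub> (x i \<oplus>\<^bsub>X i\<^esub> y i) = a \<odot>\<^bsub>X i\<^esub> x i \<oplus>\<^bsub>X i\<^esub> a \<odot>\<^bsub>X i\<^esub> y i" if "i \<in> I" for i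
    using left_module.smult_r_distr[OF X[OF that] a] that by simp
  then show "a \<odot>\<^bsub>direct_sum I X\<^esub> (x \<oplus>\<^bsub>direct_sum I X\<^esub> y) =
      a \<odot>\<^bsub>direct_sum I X\<^esub> x \<oplus>\<^bsub>direct_sum I X\<^esub> a \<odot>\<^bsub>direct_sum I X\<^esub> y"
    by (auto simp: fun_eq_iff)
next
  fix a b x
  assume ab: "a \<in> carrier R" "b \<in> carrier R" and "x \<in> carrier (direct_sum I X)"
  then have x: "x i \<in> carrier (X i)" if "i \<in> I" for i
    using that by (auto simp: PiE_iff)
  have "(a \<oplus>\<^bsub>R\<^esub> b) \<odot>\<^bsub>X i\<^esub> x i = a \<odot>\<^bsub>X i\<^esub> x i \<oplus>\<^bsub>X i\<^esub> b \<odot>\<^bsub>X i\<^esub> x i"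
    "(a \<otimes>\<^bsub>R\<^esub> b) \<odot>\<^bsub>X i\<^esub> x i = a \<odot>\<^bsub>X i\<^esub> (b \<odot>\<^bsub>X i\<^esub> x i)" if "i \<in> I" for i
    using left_module.smult_l_distr[OF X[OF that] ab x[OF that]]
      left_module.smult_assoc1[OF X[OF that] ab x[OF that]] by auto
  then show "(a \<oplus>\<^bsub>R\<^esub> b) \<odot>\<^bsub>direct_sum I X\<^esub> x =
      a \<odot>\<^bsub>direct_sum I X\<^esub> x \<oplus>\<^bsub>direct_sum I X\<^esub> b \<odot>\<^bsub>direct_sum I X\<^esub> x"
    "(a \<otimes>\<^bsub>R\<^esub> b) \<odot>\<^bsub>direct_sum I X\<^esub> x = a \<odot>\<^bsub>direct_sum I X\<^esub> (b \<odot>\<^bsub>direct_sum I X\<^esub> x)"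
    by (auto simp: fun_eq_iff)
next
  fix x assume x: "x \<in> carrier (direct_sum I X)"
  have "\<one>\<^bsub>R\<^esub> \<odot>\<^bsub>X i\<^esub> x i = x i" if "i \<in> I" for i
    using left_module.smult_one[OF X[OF that]] x that by (auto simp: PiE_iff)
  with x show "\<one>\<^bsub>R\<^esub> \<odot>\<^bsub>direct_sum I X\<^esub> x = x"
    by (auto simp: fun_eq_iff PiE_iff extensional_def)
  from x show "\<zero>\<^bsub>direct_sum I X\<^esub> \<oplus>\<^bsub>direct_sum I X\<^esub> x = x"
    by (auto simp: fun_eq_iff PiE_iff extensional_def summand_zero_add)
qed (use direct_sum_add_closed direct_sum_smult_closed summand_zero in
    \<open>auto simp del: direct_sum_simps(3,4) cong: conj_cong\<close>)

lemma ds_single_closed: "i \<in> I \<Longrightarrow> a \<in> carrier (X i) \<Longrightarrow> ds_single X I i a \<in> carrier (direct_sum I X)"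
  by (auto simp: ds_single_def summand_zero)

text \<open>Induction on a finite set containing the support; each step splits off one coordinate as
  a \<open>ds_single\<close>.\<close>

lemma direct_sum_induct [consumes 1, case_names zero single add]:
  assumes x: "x \<in> carrier (direct_sum I X)"
    and zero: "P \<zero>\<^bsub>direct_sum I X\<^esub>"
    and single: "\<And>i a. i \<in> I \<Longrightarrow> a \<in> carrier (X i) \<Longrightarrow> P (ds_single X I i a)"
    and add: "\<And>x y. x \<in> carrier (direct_sum I X) \<Longrightarrow> y \<in> carrier (direct_sum I X) \<Longrightarrow>
      P x \<Longrightarrow> P y \<Longrightarrow> P (x \<oplus>\<^bsub>direct_sum I X\<^esub> y)"
  shows "P x"
proof -
  have "finite A \<Longrightarrow> A \<subseteq> I \<Longrightarrow> x \<in> carrier (direct_sum I X) \<Longrightarrow>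
      {i \<in> I. x i \<noteq> \<zero>\<^bsub>X i\<^esub>} \<subseteq> A \<Longrightarrow> P x" for A x
  proof (induction A arbitrary: x rule: finite_induct)
    case empty
    then have "x = \<zero>\<^bsub>direct_sum I X\<^esub>"
      by (auto simp: fun_eq_iff PiE_iff extensional_def)
    then show ?case using zero by (simp only:)
  next
    case (insert i A)
    let ?y = "\<lambda>j\<in>I. if j = i then \<zero>\<^bsub>X j\<^esub> else x j"
    have y: "?y \<in> carrier (direct_sum I X)"
      using insert by (auto simp: PiE_iff summand_zero elim!: rev_finite_subset)
    have "x = ds_single X I i (x i) \<oplus>\<^bsub>direct_sum I X\<^esub> ?y"
      using insert.prems by (auto simp: ds_single_def fun_eq_iff PiE_iff extensional_def
          summand_zero_add summand_add_zero)
    moreover have "P ?y"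
      by (rule insert.IH) (use insert.prems y in auto)
    moreover have "x i \<in> carrier (X i)"
      using insert.prems by auto
    ultimately show ?case
      using insert.prems single[of i "x i"] ds_single_closed[of i "x i"] add[of "ds_single X I i (x i)" ?y] y
      by simp
  qed
  from this[of "{i \<in> I. x i \<noteq> \<zero>\<^bsub>X i\<^esub>}" x] x show ?thesis by auto
qed

context
  fixes N :: "('r, 'b) module" and f :: "'i \<Rightarrow> 'a \<Rightarrow> 'b"
  assumes N: "left_module R N" and f: "\<And>i. i \<in> I \<Longrightarrow> f i \<in> lin_homs R (X i) N"
begin

interpretation N: left_module R N by (rule N)

text \<open>Two elements and their sum have different supports. Additivity is proved by evaluating
  all three over one common finite index set.\<close>

lemma ds_lift_superset:
  assumes "x \<in> carrier (direct_sum I X)" "finite A" "A \<subseteq> I" "{i \<in> I. x i \<noteq> \<zero>\<^bsub>X i\<^esub>} \<subseteq> A"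
  shows "ds_lift X I N f x = (\<Oplus>\<^bsub>N\<^esub> i \<in> A. f i (x i))"
  unfolding ds_lift_def
proof (rule N.M.add.finprod_mono_neutral_cong_left)
  fix i assume "i \<in> A - {i \<in> I. x i \<noteq> \<zero>\<^bsub>X i\<^esub>}"
  then have "i \<in> I" "x i = \<zero>\<^bsub>X i\<^esub>" using assms by auto
  then show "f i (x i) = \<zero>\<^bsub>N\<^esub>" using lin_homs_zero[OF X N f] by simp
next
  show "(\<lambda>i. f i (x i)) \<in> A \<rightarrow> carrier N"
    using assms f by (auto intro!: lin_homs_closed[OF f])
qed (use assms in auto)

lemma ds_lift_lin: "ds_lift X I N f \<in> lin_homs R (direct_sum I X) N"
proof (rule lin_homsI)
  fix x assume x: "x \<in> carrier (direct_sum I X)"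
  show cl: "ds_lift X I N f x \<in> carrier N"
    unfolding ds_lift_def using x by (auto intro!: N.M.finsum_closed lin_homs_closed[OF f])
  { fix y assume y: "y \<in> carrier (direct_sum I X)"
    let ?A = "{i \<in> I. x i \<noteq> \<zero>\<^bsub>X i\<^esub>} \<union> {i \<in> I. y i \<noteq> \<zero>\<^bsub>X i\<^esub>}"
    have fin: "finite ?A" using x y by auto
    have sub: "{i \<in> I. (x \<oplus>\<^bsub>direct_sum I X\<^esub> y) i \<noteq> \<zero>\<^bsub>X i\<^esub>} \<subseteq> ?A"
      using summand_zero_add summand_zero by fastforce
    have "ds_lift X I N f (x \<oplus>\<^bsub>direct_sum I X\<^esub> y) = (\<Oplus>\<^bsub>N\<^esub> i \<in> ?A. f i ((x \<oplus>\<^bsub>direct_sum I X\<^esub> y) i))"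
      by (rule ds_lift_superset[OF direct_sum_add_closed[OF x y] fin _ sub]) auto
    also have "\<dots> = (\<Oplus>\<^bsub>N\<^esub> i \<in> ?A. f i (x i) \<oplus>\<^bsub>N\<^esub> f i (y i))"
      using x y by (intro N.M.finsum_cong') (auto simp: lin_homs_add[OF f] PiE_iff
          intro!: lin_homs_closed[OF f])
    also have "\<dots> = (\<Oplus>\<^bsub>N\<^esub> i \<in> ?A. f i (x i)) \<oplus>\<^bsub>N\<^esub> (\<Oplus>\<^bsub>N\<^esub> i \<in> ?A. f i (y i))"
      using x y by (intro N.M.finsum_addf) (auto intro!: lin_homs_closed[OF f])
    also have "\<dots> = ds_lift X I N f x \<oplus>\<^bsub>N\<^esub> ds_lift X I N f y"
      using ds_lift_superset[OF x fin] ds_lift_superset[OF y fin] by auto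
    finally show "ds_lift X I N f (x \<oplus>\<^bsub>direct_sum I X\<^esub> y) = ds_lift X I N f x \<oplus>\<^bsub>N\<^esub> ds_lift X I N f y" . }
  { fix r assume r: "r \<in> carrier R"
    let ?A = "{i \<in> I. x i \<noteq> \<zero>\<^bsub>X i\<^esub>}"
    have fin: "finite ?A" using x by auto
    have sub: "{i \<in> I. (r \<odot>\<^bsub>direct_sum I X\<^esub> x) i \<noteq> \<zero>\<^bsub>X i\<^esub>} \<subseteq> ?A"
      using summand_smult_zero r by auto
    have fA: "(\<lambda>i. f i (x i)) \<in> ?A \<rightarrow> carrier N"
      using x by (auto intro!: lin_homs_closed[OF f])
    have dist: "finite B \<Longrightarrow> g \<in> B \<rightarrow> carrier N \<Longrightarrow>
        r \<odot>\<^bsub>N\<^esub> (\<Oplus>\<^bsub>N\<^esub> i \<in> B. g i) = (\<Oplus>\<^bsub>N\<^esub> i \<in> B. r \<odot>\<^bsub>N\<^esub> g i)" for B and g :: "'i \<Rightarrow> 'b"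
      by (induction B rule: finite_induct) (auto simp: r N.smult_r_distr N.smult_closed Pi_iff)
    have "ds_lift X I N f (r \<odot>\<^bsub>direct_sum I X\<^esub> x) = (\<Oplus>\<^bsub>N\<^esub> i \<in> ?A. f i ((r \<odot>\<^bsub>direct_sum I X\<^esub> x) i))"
      by (rule ds_lift_superset[OF direct_sum_smult_closed[OF r x] fin _ sub]) auto
    also have "\<dots> = (\<Oplus>\<^bsub>N\<^esub> i \<in> ?A. r \<odot>\<^bsub>N\<^esub> f i (x i))"
      using x r by (intro N.M.finsum_cong') (auto simp: lin_homs_smult[OF f] PiE_iff
          intro!: N.smult_closed lin_homs_closed[OF f])
    also have "\<dots> = r \<odot>\<^bsub>N\<^esub> ds_lift X I N f x"
      unfolding ds_lift_def using dist[OF fin fA] by simp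
    finally show "ds_lift X I N f (r \<odot>\<^bsub>direct_sum I X\<^esub> x) = r \<odot>\<^bsub>N\<^esub> ds_lift X I N f x" . }
qed

lemma ds_lift_single:
  assumes "i \<in> I" "a \<in> carrier (X i)"
  shows "ds_lift X I N f (ds_single X I i a) = f i a"
proof -
  have "ds_lift X I N f (ds_single X I i a) = (\<Oplus>\<^bsub>N\<^esub> j \<in> {i}. f j (ds_single X I i a j))"
    by (rule ds_lift_superset) (use assms ds_single_closed in \<open>auto simp: ds_single_def split: if_splits\<close>)
  also have "\<dots> = f i a"
    using assms lin_homs_closed[OF f] by (simp add: ds_single_def)
  finally show ?thesis .
qed

end

end

lemma ring_regular_module: "ring R \<Longrightarrow> left_module R (regular_module R)"
proof -
  assume "ring R"
  then interpret ring R .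
  show ?thesis
    by (rule left_moduleI) (auto simp: regular_module_def a_ac m_assoc l_distr r_distr
        ring_axioms intro: add.l_inv_ex)
qed

lemma span_module_simps [simp]:
  "carrier (span_module R S) = {x \<in> S \<rightarrow>\<^sub>E carrier R. finite {s \<in> S. x s \<noteq> \<zero>\<^bsub>R\<^esub>}}"
  "\<zero>\<^bsub>span_module R S\<^esub> = (\<lambda>s\<in>S. \<zero>\<^bsub>R\<^esub>)"
  "x \<oplus>\<^bsub>span_module R S\<^esub> y = (\<lambda>s\<in>S. x s \<oplus>\<^bsub>R\<^esub> y s)"
  "r \<odot>\<^bsub>span_module R S\<^esub> x = (\<lambda>s\<in>S. r \<otimes>\<^bsub>R\<^esub> x s)"
  by (simp_all add: span_module_def regular_module_def)

definition delta :: "'r ring \<Rightarrow> 's set \<Rightarrow> 's \<Rightarrow> 'r \<Rightarrow> 's \<Rightarrow> 'r" where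
  "delta R S s r = (\<lambda>t\<in>S. if t = s then r else \<zero>\<^bsub>R\<^esub>)"

lemma delta_single: "delta R S = ds_single (\<lambda>_. regular_module R) S"
  by (simp add: fun_eq_iff delta_def ds_single_def regular_module_def)

definition span_lift :: "'r ring \<Rightarrow> 's set \<Rightarrow> ('r, 'b) module \<Rightarrow> ('s \<Rightarrow> 'b) \<Rightarrow> ('s \<Rightarrow> 'r) \<Rightarrow> 'b" where
  "span_lift R S N y = ds_lift (\<lambda>_. regular_module R) S N (\<lambda>s r. r \<odot>\<^bsub>N\<^esub> y s)"

context
  fixes R :: "'r ring" and S :: "'s set"
  assumes R: "ring R"
begin

lemma left_module_span: "left_module R (span_module R S)"
  unfolding span_module_def by (rule left_module_direct_sum[OF R ring_regular_module[OF R]])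

lemma delta_closed: "s \<in> S \<Longrightarrow> r \<in> carrier R \<Longrightarrow> delta R S s r \<in> carrier (span_module R S)"
  unfolding delta_single span_module_def
  by (rule ds_single_closed[OF R ring_regular_module[OF R]]) (auto simp: regular_module_def)

lemma span_induct [consumes 1, case_names zero delta add]:
  assumes "x \<in> carrier (span_module R S)"
    and "P \<zero>\<^bsub>span_module R S\<^esub>"
    and "\<And>s r. s \<in> S \<Longrightarrow> r \<in> carrier R \<Longrightarrow> P (delta R S s r)"
    and "\<And>x y. x \<in> carrier (span_module R S) \<Longrightarrow> y \<in> carrier (span_module R S) \<Longrightarrow>
      P x \<Longrightarrow> P y \<Longrightarrow> P (x \<oplus>\<^bsub>span_module R S\<^esub> y)"
  shows "P x"
  using direct_sum_induct[OF R ring_regular_module[OF R], of x S P] assms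
  unfolding span_module_def delta_single by (simp del: direct_sum_simps add: regular_module_def)

context
  fixes N :: "('r, 'b) module" and y :: "'s \<Rightarrow> 'b"
  assumes N: "left_module R N" and y: "\<And>s. s \<in> S \<Longrightarrow> y s \<in> carrier N"
begin

interpretation N: left_module R N by (rule N)

lemma smult_lin: "s \<in> S \<Longrightarrow> (\<lambda>r. r \<odot>\<^bsub>N\<^esub> y s) \<in> lin_homs R (regular_module R) N"
  by (rule lin_homsI) (auto simp: regular_module_def y N.smult_closed N.smult_l_distr N.smult_assoc1)

lemma span_lift_lin: "span_lift R S N y \<in> lin_homs R (span_module R S) N"
  unfolding span_module_def span_lift_def
  by (rule ds_lift_lin[OF R ring_regular_module[OF R] N smult_lin])

lemma span_lift_delta:
  "s \<in> S \<Longrightarrow> r \<in> carrier R \<Longrightarrow> span_lift R S N y (delta R S s r) = r \<odot>\<^bsub>N\<^esub> y s"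
  unfolding span_lift_def delta_single
  by (rule ds_lift_single[OF R ring_regular_module[OF R] N smult_lin]) (auto simp: regular_module_def)

end

end

section \<open>Group rings\<close>

lemma group_ring_simps [simp]:
  "carrier (group_ring K G) = carrier (span_module K (carrier G))"
  "\<zero>\<^bsub>group_ring K G\<^esub> = \<zero>\<^bsub>span_module K (carrier G)\<^esub>"
  "x \<oplus>\<^bsub>group_ring K G\<^esub> y = x \<oplus>\<^bsub>span_module K (carrier G)\<^esub> y"
  "\<one>\<^bsub>group_ring K G\<^esub> = delta K (carrier G) \<one>\<^bsub>G\<^esub> \<one>\<^bsub>K\<^esub>"
  by (simp_all add: group_ring_def delta_def)

section \<open>Restriction of scalars to the ground ring, and group ring modules from linear
  actions\<close>

definition scalar_module :: "'k ring \<Rightarrow> 'g monoid \<Rightarrow> ('g \<Rightarrow> 'k, 'u) module \<Rightarrow> ('k, 'u) module" where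
  "scalar_module K G Q = \<lparr>carrier = carrier Q, mult = mult Q, one = one Q, zero = zero Q,
     add = add Q, smult = \<lambda>r. smult Q (delta K (carrier G) \<one>\<^bsub>G\<^esub> r)\<rparr>"

lemma scalar_module_simps [simp]:
  "carrier (scalar_module K G Q) = carrier Q"
  "\<zero>\<^bsub>scalar_module K G Q\<^esub> = \<zero>\<^bsub>Q\<^esub>"
  "x \<oplus>\<^bsub>scalar_module K G Q\<^esub> y = x \<oplus>\<^bsub>Q\<^esub> y"
  by (simp_all add: scalar_module_def)

lemma scalar_smult: "r \<odot>\<^bsub>scalar_module K G Q\<^esub> x = delta K (carrier G) \<one>\<^bsub>G\<^esub> r \<odot>\<^bsub>Q\<^esub> x"
  by (simp add: scalar_module_def)

text \<open>The passage from a linear representation to a group ring module: a formal sum of group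
  elements acts by linear extension of \<open>g\<close> to \<open>\<alpha> g x\<close>.\<close>

definition action_module ::
  "'k ring \<Rightarrow> 'g monoid \<Rightarrow> ('k, 'u) module \<Rightarrow> ('g \<Rightarrow> 'u \<Rightarrow> 'u) \<Rightarrow> ('g \<Rightarrow> 'k, 'u) module" where
  "action_module K G N \<alpha> = \<lparr>carrier = carrier N, mult = mult N, one = one N, zero = zero N,
     add = add N, smult = \<lambda>a x. span_lift K (carrier G) N (\<lambda>g. \<alpha> g x) a\<rparr>"

context
  fixes K :: "'k ring" and G :: "'g monoid"
  assumes K: "cring K" and G: "monoid G"
begin

interpretation K: cring K by (rule K)
interpretation G: monoid G by (rule G)

abbreviation (input) "gr \<equiv> group_ring K G"
abbreviation (input) "gd \<equiv> delta K (carrier G)"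

lemma left_module_gr_span: "left_module K (span_module K (carrier G))"
  by (rule left_module_span[OF K.ring_axioms])

lemma gd_closed: "g \<in> carrier G \<Longrightarrow> r \<in> carrier K \<Longrightarrow> gd g r \<in> carrier gr"
  using delta_closed[OF K.ring_axioms, of g "carrier G" r] by simp

text \<open>The defining convolution sums over pairs from the supports. Pairs outside contribute
  zero, so the index set may be enlarged; distributivity needs this to compare sums over different
  supports.\<close>

lemma gr_mult_superset:
  assumes x: "x \<in> carrier gr" and y: "y \<in> carrier gr"
    and A: "finite A" "A \<subseteq> carrier G" "{a \<in> carrier G. x a \<noteq> \<zero>\<^bsub>K\<^esub>} \<subseteq> A"
    and B: "finite B" "B \<subseteq> carrier G" "{a \<in> carrier G. y a \<noteq> \<zero>\<^bsub>K\<^esub>} \<subseteq> B"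
    and g: "g \<in> carrier G"
  shows "(x \<otimes>\<^bsub>gr\<^esub> y) g = finsum K (\<lambda>(a, b). x a \<otimes>\<^bsub>K\<^esub> y b) {(a, b) \<in> A \<times> B. a \<otimes>\<^bsub>G\<^esub> b = g}"
proof -
  have xy: "x a \<in> carrier K" "y a \<in> carrier K" if "a \<in> carrier G" for a
    using that x y by auto
  have "finsum K (\<lambda>(a, b). x a \<otimes>\<^bsub>K\<^esub> y b) {(a, b) \<in> carrier G \<times> carrier G. x a \<noteq> \<zero>\<^bsub>K\<^esub> \<and> y b \<noteq> \<zero>\<^bsub>K\<^esub> \<and> a \<otimes>\<^bsub>G\<^esub> b = g} =
      finsum K (\<lambda>(a, b). x a \<otimes>\<^bsub>K\<^esub> y b) {(a, b) \<in> A \<times> B. a \<otimes>\<^bsub>G\<^esub> b = g}"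
  proof (rule K.add.finprod_mono_neutral_cong_left)
    show "finite {(a, b) \<in> A \<times> B. a \<otimes>\<^bsub>G\<^esub> b = g}"
      using A B by (intro finite_subset[OF _ finite_cartesian_product[of A B]]) auto
    fix p assume "p \<in> {(a, b) \<in> A \<times> B. a \<otimes>\<^bsub>G\<^esub> b = g} - {(a, b) \<in> carrier G \<times> carrier G.
          x a \<noteq> \<zero>\<^bsub>K\<^esub> \<and> y b \<noteq> \<zero>\<^bsub>K\<^esub> \<and> a \<otimes>\<^bsub>G\<^esub> b = g}"
    then obtain a b where "p = (a, b)" "a \<in> carrier G" "b \<in> carrier G" "x a = \<zero>\<^bsub>K\<^esub> \<or> y b = \<zero>\<^bsub>K\<^esub>"
      using A(2) B(2) by blast
    then show "(case p of (a, b) \<Rightarrow> x a \<otimes>\<^bsub>K\<^esub> y b) = \<zero>\<^bsub>K\<^esub>"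
      using xy by auto
  qed (use A B xy subsetD[OF A(2)] subsetD[OF B(2)] in auto)
  then show ?thesis using g by (simp add: group_ring_def)
qed

text \<open>The support of a product is contained in the set of products of elements of the two
  supports, which is finite.\<close>

lemma gr_mult_closed:
  assumes x: "x \<in> carrier gr" and y: "y \<in> carrier gr"
  shows "x \<otimes>\<^bsub>gr\<^esub> y \<in> carrier gr"
proof -
  let ?A = "{a \<in> carrier G. x a \<noteq> \<zero>\<^bsub>K\<^esub>}" and ?B = "{a \<in> carrier G. y a \<noteq> \<zero>\<^bsub>K\<^esub>}"
  have fin: "finite ?A" "finite ?B" using x y by auto
  have eq: "(x \<otimes>\<^bsub>gr\<^esub> y) g = finsum K (\<lambda>(a, b). x a \<otimes>\<^bsub>K\<^esub> y b) {(a, b) \<in> ?A \<times> ?B. a \<otimes>\<^bsub>G\<^esub> b = g}"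
    if "g \<in> carrier G" for g
    by (rule gr_mult_superset[OF x y]) (use fin that in auto)
  have xy: "x a \<in> carrier K" "y a \<in> carrier K" if "a \<in> carrier G" for a
    using that x y by auto
  have "(x \<otimes>\<^bsub>gr\<^esub> y) g \<in> carrier K" if "g \<in> carrier G" for g
    unfolding eq[OF that] by (rule K.finsum_closed) (use xy in auto)
  moreover have "{g \<in> carrier G. (x \<otimes>\<^bsub>gr\<^esub> y) g \<noteq> \<zero>\<^bsub>K\<^esub>} \<subseteq> (\<lambda>(a, b). a \<otimes>\<^bsub>G\<^esub> b) ` (?A \<times> ?B)"
  proof
    fix g assume g: "g \<in> {g \<in> carrier G. (x \<otimes>\<^bsub>gr\<^esub> y) g \<noteq> \<zero>\<^bsub>K\<^esub>}"
    have "{(a, b) \<in> ?A \<times> ?B. a \<otimes>\<^bsub>G\<^esub> b = g} \<noteq> {}"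
    proof
      assume e: "{(a, b) \<in> ?A \<times> ?B. a \<otimes>\<^bsub>G\<^esub> b = g} = {}"
      show False using eq[of g] g unfolding e by simp
    qed
    then show "g \<in> (\<lambda>(a, b). a \<otimes>\<^bsub>G\<^esub> b) ` (?A \<times> ?B)" by auto
  qed
  then have "finite {g \<in> carrier G. (x \<otimes>\<^bsub>gr\<^esub> y) g \<noteq> \<zero>\<^bsub>K\<^esub>}"
    by (rule finite_subset) (use fin in auto)
  moreover have "x \<otimes>\<^bsub>gr\<^esub> y \<in> extensional (carrier G)"
    by (simp add: group_ring_def)
  ultimately show ?thesis by (auto simp: PiE_iff)
qed

lemma gr_add_closed: "x \<in> carrier gr \<Longrightarrow> y \<in> carrier gr \<Longrightarrow> x \<oplus>\<^bsub>gr\<^esub> y \<in> carrier gr"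
proof -
  interpret left_module K "span_module K (carrier G)" by (rule left_module_gr_span)
  show "x \<in> carrier gr \<Longrightarrow> y \<in> carrier gr \<Longrightarrow> x \<oplus>\<^bsub>gr\<^esub> y \<in> carrier gr"
    unfolding group_ring_simps by (rule M.a_closed)
qed

lemma gr_mult_ext: "x \<otimes>\<^bsub>gr\<^esub> y \<in> extensional (carrier G)"
  by (simp add: group_ring_def)

lemma gr_l_distr:
  assumes x: "x \<in> carrier gr" and y: "y \<in> carrier gr" and z: "z \<in> carrier gr"
  shows "(x \<oplus>\<^bsub>gr\<^esub> y) \<otimes>\<^bsub>gr\<^esub> z = x \<otimes>\<^bsub>gr\<^esub> z \<oplus>\<^bsub>gr\<^esub> y \<otimes>\<^bsub>gr\<^esub> z"
proof (rule extensionalityI[OF gr_mult_ext])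
  show "x \<otimes>\<^bsub>gr\<^esub> z \<oplus>\<^bsub>gr\<^esub> y \<otimes>\<^bsub>gr\<^esub> z \<in> extensional (carrier G)" by simp
  fix g assume g: "g \<in> carrier G"
  let ?A = "{a \<in> carrier G. x a \<noteq> \<zero>\<^bsub>K\<^esub>} \<union> {a \<in> carrier G. y a \<noteq> \<zero>\<^bsub>K\<^esub>}"
    and ?B = "{a \<in> carrier G. z a \<noteq> \<zero>\<^bsub>K\<^esub>}"
  let ?S = "{(a, b) \<in> ?A \<times> ?B. a \<otimes>\<^bsub>G\<^esub> b = g}"
  have fin: "finite ?A" "finite ?B" using x y z by auto
  have cl: "x a \<in> carrier K" "y a \<in> carrier K" "z a \<in> carrier K" if "a \<in> carrier G" for a
    using that x y z by auto
  have sub: "{a \<in> carrier G. (x \<oplus>\<^bsub>gr\<^esub> y) a \<noteq> \<zero>\<^bsub>K\<^esub>} \<subseteq> ?A" by auto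
  have "((x \<oplus>\<^bsub>gr\<^esub> y) \<otimes>\<^bsub>gr\<^esub> z) g = finsum K (\<lambda>(a, b). (x \<oplus>\<^bsub>gr\<^esub> y) a \<otimes>\<^bsub>K\<^esub> z b) ?S"
    by (rule gr_mult_superset[OF gr_add_closed[OF x y] z fin(1) _ sub fin(2) _ _ g]) auto
  also have "\<dots> = finsum K (\<lambda>p. (case p of (a, b) \<Rightarrow> x a \<otimes>\<^bsub>K\<^esub> z b) \<oplus>\<^bsub>K\<^esub> (case p of (a, b) \<Rightarrow> y a \<otimes>\<^bsub>K\<^esub> z b)) ?S"
    by (intro K.finsum_cong') (auto simp: cl K.l_distr)
  also have "\<dots> = finsum K (\<lambda>(a, b). x a \<otimes>\<^bsub>K\<^esub> z b) ?S \<oplus>\<^bsub>K\<^esub> finsum K (\<lambda>(a, b). y a \<otimes>\<^bsub>K\<^esub> z b) ?S"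
    by (rule K.finsum_addf) (auto simp: cl)
  also have "finsum K (\<lambda>(a, b). x a \<otimes>\<^bsub>K\<^esub> z b) ?S = (x \<otimes>\<^bsub>gr\<^esub> z) g"
    by (rule gr_mult_superset[OF x z fin(1) _ _ fin(2) _ _ g, symmetric]) auto
  also have "finsum K (\<lambda>(a, b). y a \<otimes>\<^bsub>K\<^esub> z b) ?S = (y \<otimes>\<^bsub>gr\<^esub> z) g"
    by (rule gr_mult_superset[OF y z fin(1) _ _ fin(2) _ _ g, symmetric]) auto
  finally have *: "((x \<oplus>\<^bsub>gr\<^esub> y) \<otimes>\<^bsub>gr\<^esub> z) g = (x \<otimes>\<^bsub>gr\<^esub> z) g \<oplus>\<^bsub>K\<^esub> (y \<otimes>\<^bsub>gr\<^esub> z) g" .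
  show "((x \<oplus>\<^bsub>gr\<^esub> y) \<otimes>\<^bsub>gr\<^esub> z) g = (x \<otimes>\<^bsub>gr\<^esub> z \<oplus>\<^bsub>gr\<^esub> y \<otimes>\<^bsub>gr\<^esub> z) g"
    unfolding * using g by simp
qed

lemma gr_r_distr:
  assumes x: "x \<in> carrier gr" and y: "y \<in> carrier gr" and z: "z \<in> carrier gr"
  shows "z \<otimes>\<^bsub>gr\<^esub> (x \<oplus>\<^bsub>gr\<^esub> y) = z \<otimes>\<^bsub>gr\<^esub> x \<oplus>\<^bsub>gr\<^esub> z \<otimes>\<^bsub>gr\<^esub> y"
proof (rule extensionalityI[OF gr_mult_ext])
  show "z \<otimes>\<^bsub>gr\<^esub> x \<oplus>\<^bsub>gr\<^esub> z \<otimes>\<^bsub>gr\<^esub> y \<in> extensional (carrier G)" by simp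
  fix g assume g: "g \<in> carrier G"
  let ?A = "{a \<in> carrier G. x a \<noteq> \<zero>\<^bsub>K\<^esub>} \<union> {a \<in> carrier G. y a \<noteq> \<zero>\<^bsub>K\<^esub>}"
    and ?B = "{a \<in> carrier G. z a \<noteq> \<zero>\<^bsub>K\<^esub>}"
  let ?S = "{(b, a) \<in> ?B \<times> ?A. b \<otimes>\<^bsub>G\<^esub> a = g}"
  have fin: "finite ?A" "finite ?B" using x y z by auto
  have cl: "x a \<in> carrier K" "y a \<in> carrier K" "z a \<in> carrier K" if "a \<in> carrier G" for a
    using that x y z by auto
  have sub: "{a \<in> carrier G. (x \<oplus>\<^bsub>gr\<^esub> y) a \<noteq> \<zero>\<^bsub>K\<^esub>} \<subseteq> ?A" by auto
  have "(z \<otimes>\<^bsub>gr\<^esub> (x \<oplus>\<^bsub>gr\<^esub> y)) g = finsum K (\<lambda>(b, a). z b \<otimes>\<^bsub>K\<^esub> (x \<oplus>\<^bsub>gr\<^esub> y) a) ?S"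
    by (rule gr_mult_superset[OF z gr_add_closed[OF x y] fin(2) _ _ fin(1) _ sub g]) auto
  also have "\<dots> = finsum K (\<lambda>p. (case p of (b, a) \<Rightarrow> z b \<otimes>\<^bsub>K\<^esub> x a) \<oplus>\<^bsub>K\<^esub> (case p of (b, a) \<Rightarrow> z b \<otimes>\<^bsub>K\<^esub> y a)) ?S"
    by (intro K.finsum_cong') (auto simp: cl K.r_distr)
  also have "\<dots> = finsum K (\<lambda>(b, a). z b \<otimes>\<^bsub>K\<^esub> x a) ?S \<oplus>\<^bsub>K\<^esub> finsum K (\<lambda>(b, a). z b \<otimes>\<^bsub>K\<^esub> y a) ?S"
    by (rule K.finsum_addf) (auto simp: cl)
  also have "finsum K (\<lambda>(b, a). z b \<otimes>\<^bsub>K\<^esub> x a) ?S = (z \<otimes>\<^bsub>gr\<^esub> x) g"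
    by (rule gr_mult_superset[OF z x fin(2) _ _ fin(1) _ _ g, symmetric]) auto
  also have "finsum K (\<lambda>(b, a). z b \<otimes>\<^bsub>K\<^esub> y a) ?S = (z \<otimes>\<^bsub>gr\<^esub> y) g"
    by (rule gr_mult_superset[OF z y fin(2) _ _ fin(1) _ _ g, symmetric]) auto
  finally have *: "(z \<otimes>\<^bsub>gr\<^esub> (x \<oplus>\<^bsub>gr\<^esub> y)) g = (z \<otimes>\<^bsub>gr\<^esub> x) g \<oplus>\<^bsub>K\<^esub> (z \<otimes>\<^bsub>gr\<^esub> y) g" .
  show "(z \<otimes>\<^bsub>gr\<^esub> (x \<oplus>\<^bsub>gr\<^esub> y)) g = (z \<otimes>\<^bsub>gr\<^esub> x \<oplus>\<^bsub>gr\<^esub> z \<otimes>\<^bsub>gr\<^esub> y) g"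
    unfolding * using g by simp
qed

lemma gr_delta_mult:
  assumes a: "a \<in> carrier G" and b: "b \<in> carrier G" and r: "r \<in> carrier K" and s: "s \<in> carrier K"
  shows "gd a r \<otimes>\<^bsub>gr\<^esub> gd b s = gd (a \<otimes>\<^bsub>G\<^esub> b) (r \<otimes>\<^bsub>K\<^esub> s)"
proof (rule extensionalityI[OF gr_mult_ext])
  show "gd (a \<otimes>\<^bsub>G\<^esub> b) (r \<otimes>\<^bsub>K\<^esub> s) \<in> extensional (carrier G)" by (simp add: delta_def)
  fix g assume g: "g \<in> carrier G"
  have eq: "(gd a r \<otimes>\<^bsub>gr\<^esub> gd b s) g =
      finsum K (\<lambda>(x, y). gd a r x \<otimes>\<^bsub>K\<^esub> gd b s y) {(x, y) \<in> {a} \<times> {b}. x \<otimes>\<^bsub>G\<^esub> y = g}"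
    by (rule gr_mult_superset[OF gd_closed[OF a r] gd_closed[OF b s] _ _ _ _ _ _ g])
      (use a b in \<open>auto simp: delta_def split: if_splits\<close>)
  show "(gd a r \<otimes>\<^bsub>gr\<^esub> gd b s) g = gd (a \<otimes>\<^bsub>G\<^esub> b) (r \<otimes>\<^bsub>K\<^esub> s) g"
  proof (cases "a \<otimes>\<^bsub>G\<^esub> b = g")
    case True
    then have e: "{(x, y) \<in> {a} \<times> {b}. x \<otimes>\<^bsub>G\<^esub> y = g} = {(a, b)}" by auto
    show ?thesis
      unfolding eq e using True g assms by (simp add: delta_def)
  next
    case False
    then have e: "{(x, y) \<in> {a} \<times> {b}. x \<otimes>\<^bsub>G\<^esub> y = g} = {}" by auto
    show ?thesis
      unfolding eq e using False g assms by (auto simp: delta_def)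
  qed
qed

lemma gr_induct [consumes 1, case_names zero delta add]:
  assumes "a \<in> carrier gr" and "P \<zero>\<^bsub>gr\<^esub>"
    and "\<And>g r. g \<in> carrier G \<Longrightarrow> r \<in> carrier K \<Longrightarrow> P (gd g r)"
    and "\<And>a b. a \<in> carrier gr \<Longrightarrow> b \<in> carrier gr \<Longrightarrow> P a \<Longrightarrow> P b \<Longrightarrow> P (a \<oplus>\<^bsub>gr\<^esub> b)"
  shows "P a"
  using span_induct[OF K.ring_axioms, of a "carrier G" P] assms
  by (simp only: group_ring_simps)

text \<open>Associativity holds for point masses because it holds in \<open>G\<close> and in
  \<open>K\<close>. Additivity then extends it to arbitrary elements in one argument at a time: the
  third in \<open>m1\<close>, the second in \<open>m2\<close>, the first in
  \<open>m3\<close>.\<close>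

lemma ring_group_ring: "ring gr"
proof -
  interpret S: left_module K "span_module K (carrier G)" by (rule left_module_gr_span)
  have ag: "abelian_group gr"
    using S.M.a_closed S.M.a_assoc S.M.a_comm S.M.l_neg S.M.a_inv_closed
    by (intro abelian_groupI; unfold group_ring_simps)
      (auto simp del: span_module_simps simp: S.M.a_ac intro: S.M.l_neg)
  interpret A: abelian_group gr by (rule ag)
  have zero: "\<zero>\<^bsub>gr\<^esub> \<otimes>\<^bsub>gr\<^esub> x = \<zero>\<^bsub>gr\<^esub>" "x \<otimes>\<^bsub>gr\<^esub> \<zero>\<^bsub>gr\<^esub> = \<zero>\<^bsub>gr\<^esub>" if "x \<in> carrier gr" for x
  proof -
    show "\<zero>\<^bsub>gr\<^esub> \<otimes>\<^bsub>gr\<^esub> x = \<zero>\<^bsub>gr\<^esub>"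
      using gr_l_distr[of "\<zero>\<^bsub>gr\<^esub>" "\<zero>\<^bsub>gr\<^esub>" x] A.l_zero A.zero_closed gr_mult_closed that
        A.add.r_cancel_one' by metis
    show "x \<otimes>\<^bsub>gr\<^esub> \<zero>\<^bsub>gr\<^esub> = \<zero>\<^bsub>gr\<^esub>"
      using gr_r_distr[of "\<zero>\<^bsub>gr\<^esub>" "\<zero>\<^bsub>gr\<^esub>" x] A.l_zero A.zero_closed gr_mult_closed that
        A.add.r_cancel_one' by metis
  qed
  have one: "\<one>\<^bsub>gr\<^esub> \<in> carrier gr"
    using gd_closed[of "\<one>\<^bsub>G\<^esub>" "\<one>\<^bsub>K\<^esub>"] by (simp only: group_ring_simps) simp
  have m1: "(gd g r \<otimes>\<^bsub>gr\<^esub> gd h s) \<otimes>\<^bsub>gr\<^esub> z = gd g r \<otimes>\<^bsub>gr\<^esub> (gd h s \<otimes>\<^bsub>gr\<^esub> z)"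
    if "z \<in> carrier gr" "g \<in> carrier G" "r \<in> carrier K" "h \<in> carrier G" "s \<in> carrier K" for g r h s z
    using that
  proof (induction rule: gr_induct)
    case (delta k t)
    then show ?case by (simp add: gr_delta_mult G.m_assoc K.m_assoc)
  qed (simp_all only: zero gr_r_distr gr_mult_closed gd_closed)
  have m2: "(gd g r \<otimes>\<^bsub>gr\<^esub> y) \<otimes>\<^bsub>gr\<^esub> z = gd g r \<otimes>\<^bsub>gr\<^esub> (y \<otimes>\<^bsub>gr\<^esub> z)"
    if "y \<in> carrier gr" "z \<in> carrier gr" "g \<in> carrier G" "r \<in> carrier K" for g r y z
    using that
  proof (induction rule: gr_induct)
    case (delta k t)
    then show ?case by (simp only: m1)
  qed (simp_all only: zero gr_r_distr gr_l_distr gr_mult_closed gd_closed)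
  have m3: "(x \<otimes>\<^bsub>gr\<^esub> y) \<otimes>\<^bsub>gr\<^esub> z = x \<otimes>\<^bsub>gr\<^esub> (y \<otimes>\<^bsub>gr\<^esub> z)"
    if "x \<in> carrier gr" "y \<in> carrier gr" "z \<in> carrier gr" for x y z
    using that
  proof (induction rule: gr_induct)
    case (delta k t)
    then show ?case by (simp only: m2)
  qed (simp_all only: zero gr_l_distr gr_mult_closed gd_closed)
  have l1: "\<one>\<^bsub>gr\<^esub> \<otimes>\<^bsub>gr\<^esub> x = x" if "x \<in> carrier gr" for x
    using that
  proof (induction rule: gr_induct)
    case (delta k t)
    then show ?case by (simp add: gr_delta_mult)
  qed (simp_all only: zero one gr_r_distr)
  have r1: "x \<otimes>\<^bsub>gr\<^esub> \<one>\<^bsub>gr\<^esub> = x" if "x \<in> carrier gr" for x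
    using that
  proof (induction rule: gr_induct)
    case (delta k t)
    then show ?case by (simp add: gr_delta_mult)
  qed (simp_all only: zero one gr_l_distr)
  show ?thesis
    by (intro ringI ag monoidI gr_mult_closed gr_l_distr gr_r_distr m3 l1 r1 one)
qed

context
  fixes Q :: "('g \<Rightarrow> 'k, 'u) module"
  assumes Q: "left_module gr Q"
begin

interpretation Q: left_module gr Q by (rule Q)

lemma left_module_scalar: "left_module K (scalar_module K G Q)"
proof (rule left_moduleI)
  note simps = scalar_smult Q.M.a_ac Q.M.l_zero Q.smult_closed gd_closed Q.smult_r_distr
  show "ring K" by (rule K.ring_axioms)
  fix x assume "x \<in> carrier (scalar_module K G Q)"
  then have x: "x \<in> carrier Q" by (simp add: scalar_smult)
  then show "\<exists>y \<in> carrier (scalar_module K G Q). y \<oplus>\<^bsub>scalar_module K G Q\<^esub> x = \<zero>\<^bsub>scalar_module K G Q\<^esub>"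
    by (auto simp: scalar_smult intro: Q.M.add.l_inv_ex)
  show "\<one>\<^bsub>K\<^esub> \<odot>\<^bsub>scalar_module K G Q\<^esub> x = x"
    using Q.smult_one[OF x] by (simp add: scalar_smult)
  fix a b assume ab: "a \<in> carrier K" "b \<in> carrier K"
  have "gd \<one>\<^bsub>G\<^esub> (a \<oplus>\<^bsub>K\<^esub> b) = gd \<one>\<^bsub>G\<^esub> a \<oplus>\<^bsub>gr\<^esub> gd \<one>\<^bsub>G\<^esub> b"
    by (auto simp: delta_def fun_eq_iff)
  then show "(a \<oplus>\<^bsub>K\<^esub> b) \<odot>\<^bsub>scalar_module K G Q\<^esub> x =
      a \<odot>\<^bsub>scalar_module K G Q\<^esub> x \<oplus>\<^bsub>scalar_module K G Q\<^esub> b \<odot>\<^bsub>scalar_module K G Q\<^esub> x"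
    using Q.smult_l_distr[OF gd_closed gd_closed x] ab by (simp add: scalar_smult del: group_ring_simps)
  have "gd \<one>\<^bsub>G\<^esub> (a \<otimes>\<^bsub>K\<^esub> b) = gd \<one>\<^bsub>G\<^esub> a \<otimes>\<^bsub>gr\<^esub> gd \<one>\<^bsub>G\<^esub> b"
    using ab by (simp add: gr_delta_mult)
  then show "(a \<otimes>\<^bsub>K\<^esub> b) \<odot>\<^bsub>scalar_module K G Q\<^esub> x =
      a \<odot>\<^bsub>scalar_module K G Q\<^esub> (b \<odot>\<^bsub>scalar_module K G Q\<^esub> x)"
    using Q.smult_assoc1[OF gd_closed gd_closed x] ab by (simp add: scalar_smult del: group_ring_simps)
qed (use gd_closed in \<open>auto simp: scalar_smult Q.M.a_ac Q.smult_closed Q.smult_r_distr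
  simp del: group_ring_simps\<close>)

text \<open>Multiples of the unit are central in the group ring, since \<open>K\<close> is
  commutative; thus group elements act by \<open>K\<close>-linear maps.\<close>

lemma gd_smult:
  assumes "g \<in> carrier G" "r \<in> carrier K" "x \<in> carrier Q"
  shows "gd g r \<odot>\<^bsub>Q\<^esub> x = r \<odot>\<^bsub>scalar_module K G Q\<^esub> (gd g \<one>\<^bsub>K\<^esub> \<odot>\<^bsub>Q\<^esub> x)"
    and "gd g r \<odot>\<^bsub>Q\<^esub> x = gd g \<one>\<^bsub>K\<^esub> \<odot>\<^bsub>Q\<^esub> (r \<odot>\<^bsub>scalar_module K G Q\<^esub> x)"
  using assms Q.smult_assoc1[OF gd_closed gd_closed, of "\<one>\<^bsub>G\<^esub>" r g "\<one>\<^bsub>K\<^esub>" x]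
    Q.smult_assoc1[OF gd_closed gd_closed, of g "\<one>\<^bsub>K\<^esub>" "\<one>\<^bsub>G\<^esub>" r x]
  by (simp_all add: scalar_smult gr_delta_mult del: group_ring_simps)

text \<open>Point masses span the group ring additively, and each is a scalar times a group element.
  So stability under these two kinds of elements is enough.\<close>

lemma gr_submoduleI:
  assumes "submodule H K (scalar_module K G Q)"
    and "\<And>g x. g \<in> carrier G \<Longrightarrow> x \<in> H \<Longrightarrow> gd g \<one>\<^bsub>K\<^esub> \<odot>\<^bsub>Q\<^esub> x \<in> H"
  shows "submodule H gr Q"
proof -
  interpret S: left_module K "scalar_module K G Q" by (rule left_module_scalar)
  have H: "H \<subseteq> carrier Q" "\<zero>\<^bsub>Q\<^esub> \<in> H" "\<And>x y. x \<in> H \<Longrightarrow> y \<in> H \<Longrightarrow> x \<oplus>\<^bsub>Q\<^esub> y \<in> H"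
    "\<And>a x. a \<in> carrier K \<Longrightarrow> x \<in> H \<Longrightarrow> a \<odot>\<^bsub>scalar_module K G Q\<^esub> x \<in> H"
    using assms(1) by (auto simp: S.submodule_iff scalar_smult)
  have "a \<odot>\<^bsub>Q\<^esub> x \<in> H" if "a \<in> carrier gr" "x \<in> H" for a x
    using that
  proof (induction rule: gr_induct)
    case zero
    then show ?case using H Q.smult_zero_left[of x] by (auto simp del: group_ring_simps)
  next
    case (delta g r)
    then show ?case using H assms(2) gd_smult(1)[of g r x] by auto
  next
    case (add a b)
    then show ?case using H Q.smult_l_distr[of a b x] by (auto simp del: group_ring_simps)
  qed
  then show ?thesis using H by (auto simp: Q.submodule_iff simp del: group_ring_simps)
qed

lemma scalar_submodule:
  assumes "submodule H gr Q" shows "submodule H K (scalar_module K G Q)"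
proof -
  interpret S: left_module K "scalar_module K G Q" by (rule left_module_scalar)
  show ?thesis using assms gd_closed
    by (auto simp: S.submodule_iff Q.submodule_iff scalar_smult simp del: group_ring_simps)
qed

text \<open>As for submodules, linearity over the group ring reduces along point masses to
  \<open>K\<close>-linearity and equivariance under \<open>G\<close>.\<close>

lemma gr_lin_homsI:
  assumes Q': "left_module gr Q'"
    and h: "h \<in> lin_homs K (scalar_module K G Q) (scalar_module K G Q')"
    and eq: "\<And>g x. g \<in> carrier G \<Longrightarrow> x \<in> carrier Q \<Longrightarrow> h (gd g \<one>\<^bsub>K\<^esub> \<odot>\<^bsub>Q\<^esub> x) = gd g \<one>\<^bsub>K\<^esub> \<odot>\<^bsub>Q'\<^esub> h x"
  shows "h \<in> lin_homs gr Q Q'"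
proof (rule lin_homsI)
  interpret Q': left_module gr Q' by fact
  show cl: "h x \<in> carrier Q'" if "x \<in> carrier Q" for x
    using lin_homs_closed[OF h, of x] that by (simp add: scalar_smult)
  show ad: "h (x \<oplus>\<^bsub>Q\<^esub> y) = h x \<oplus>\<^bsub>Q'\<^esub> h y" if "x \<in> carrier Q" "y \<in> carrier Q" for x y
    using lin_homs_add[OF h, of x y] that by (simp add: scalar_smult)
  fix a x assume "a \<in> carrier gr" and x: "x \<in> carrier Q"
  then show "h (a \<odot>\<^bsub>Q\<^esub> x) = a \<odot>\<^bsub>Q'\<^esub> h x"
  proof (induction rule: gr_induct)
    case zero
    then show ?case
      using Q.smult_zero_left[OF x] Q'.smult_zero_left[OF cl[OF x]] ad[of "\<zero>\<^bsub>Q\<^esub>" "\<zero>\<^bsub>Q\<^esub>"] cl[of "\<zero>\<^bsub>Q\<^esub>"]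
        Q'.M.add.r_cancel_one'[of "h \<zero>\<^bsub>Q\<^esub>" "h \<zero>\<^bsub>Q\<^esub>"] by (simp del: group_ring_simps)
  next
    case (delta g r)
    have "h (gd g r \<odot>\<^bsub>Q\<^esub> x) = r \<odot>\<^bsub>scalar_module K G Q'\<^esub> h (gd g \<one>\<^bsub>K\<^esub> \<odot>\<^bsub>Q\<^esub> x)"
      using delta lin_homs_smult[OF h, of r "gd g \<one>\<^bsub>K\<^esub> \<odot>\<^bsub>Q\<^esub> x"] gd_smult(1)[of g r x] x
        Q.smult_closed[OF gd_closed[of g "\<one>\<^bsub>K\<^esub>"] x] by (simp add: scalar_smult)
    also have "\<dots> = gd g r \<odot>\<^bsub>Q'\<^esub> h x"
    proof -
      have "gd \<one>\<^bsub>G\<^esub> r \<otimes>\<^bsub>gr\<^esub> gd g \<one>\<^bsub>K\<^esub> = gd g r" using delta by (simp add: gr_delta_mult)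
      then show ?thesis
        using delta x Q'.smult_assoc1[OF gd_closed[of "\<one>\<^bsub>G\<^esub>" r] gd_closed[of g "\<one>\<^bsub>K\<^esub>"] cl[OF x]]
        by (simp add: eq scalar_smult)
    qed
    finally show ?case .
  next
    case (add a b)
    then show ?case
      by (simp only: Q.smult_l_distr[OF _ _ x] Q'.smult_l_distr[OF _ _ cl[OF x]] ad Q.smult_closed x)
  qed
qed

lemma scalar_lin_homs:
  assumes h: "h \<in> lin_homs gr Q Q'"
  shows "h \<in> lin_homs K (scalar_module K G Q) (scalar_module K G Q')"
  using lin_homs_closed[OF h] lin_homs_add[OF h] lin_homs_smult[OF h] gd_closed[OF G.one_closed]
  by (intro lin_homsI) (simp_all add: scalar_smult del: group_ring_simps)

end

context
  fixes N :: "('k, 'u) module" and \<alpha> :: "'g \<Rightarrow> 'u \<Rightarrow> 'u"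
  assumes N: "left_module K N"
    and lin: "\<And>g. g \<in> carrier G \<Longrightarrow> \<alpha> g \<in> lin_homs K N N"
    and one: "\<And>x. x \<in> carrier N \<Longrightarrow> \<alpha> \<one>\<^bsub>G\<^esub> x = x"
    and mult: "\<And>g h x. g \<in> carrier G \<Longrightarrow> h \<in> carrier G \<Longrightarrow> x \<in> carrier N \<Longrightarrow>
      \<alpha> (g \<otimes>\<^bsub>G\<^esub> h) x = \<alpha> g (\<alpha> h x)"
begin

interpretation N: left_module K N by (rule N)

abbreviation (input) "am \<equiv> action_module K G N \<alpha>"

lemma action_map_closed: "g \<in> carrier G \<Longrightarrow> x \<in> carrier N \<Longrightarrow> \<alpha> g x \<in> carrier N"
  by (rule lin_homs_closed[OF lin])

lemma action_module_lift: "x \<in> carrier N \<Longrightarrow> (\<lambda>a. a \<odot>\<^bsub>am\<^esub> x) \<in> lin_homs K (span_module K (carrier G)) N"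
  using span_lift_lin[OF K.ring_axioms N, of "carrier G" "\<lambda>g. \<alpha> g x"] action_map_closed
  by (simp add: action_module_def)

lemma action_module_closed: "a \<in> carrier gr \<Longrightarrow> x \<in> carrier N \<Longrightarrow> a \<odot>\<^bsub>am\<^esub> x \<in> carrier N"
  using lin_homs_closed[OF action_module_lift] by simp

lemma action_module_l_distr: "a \<in> carrier gr \<Longrightarrow> b \<in> carrier gr \<Longrightarrow> x \<in> carrier N \<Longrightarrow>
    (a \<oplus>\<^bsub>gr\<^esub> b) \<odot>\<^bsub>am\<^esub> x = a \<odot>\<^bsub>am\<^esub> x \<oplus>\<^bsub>N\<^esub> b \<odot>\<^bsub>am\<^esub> x"
  using lin_homs_add[OF action_module_lift, of x a b] by simp

lemma action_module_zero: "x \<in> carrier N \<Longrightarrow> \<zero>\<^bsub>gr\<^esub> \<odot>\<^bsub>am\<^esub> x = \<zero>\<^bsub>N\<^esub>"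
  using lin_homs_zero[OF left_module_gr_span N action_module_lift, of x] by simp

lemma action_module_delta: "g \<in> carrier G \<Longrightarrow> r \<in> carrier K \<Longrightarrow> x \<in> carrier N \<Longrightarrow> gd g r \<odot>\<^bsub>am\<^esub> x = r \<odot>\<^bsub>N\<^esub> \<alpha> g x"
  using span_lift_delta[OF K.ring_axioms N, of "carrier G" "\<lambda>g. \<alpha> g x" g r] action_map_closed
  by (simp add: action_module_def)

lemma action_module_r_distr:
  assumes "a \<in> carrier gr" "x \<in> carrier N" "y \<in> carrier N"
  shows "a \<odot>\<^bsub>am\<^esub> (x \<oplus>\<^bsub>N\<^esub> y) = a \<odot>\<^bsub>am\<^esub> x \<oplus>\<^bsub>N\<^esub> a \<odot>\<^bsub>am\<^esub> y"
  using assms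
proof (induction rule: gr_induct)
  case zero
  then show ?case by (simp only: action_module_zero N.M.a_closed) simp
next
  case (delta g r)
  then show ?case by (simp add: action_module_delta lin_homs_add[OF lin] N.smult_r_distr action_map_closed)
next
  case (add a b)
  then show ?case by (simp only: action_module_l_distr action_module_closed N.M.a_closed N.M.a_ac)
qed

text \<open>Associativity is extended additively in the right factor first, with a point mass on the
  left; the general left factor follows in \<open>action_module_assoc\<close>.\<close>

lemma action_module_assoc1:
  assumes "b \<in> carrier gr" "g \<in> carrier G" "r \<in> carrier K" "x \<in> carrier N"
  shows "(gd g r \<otimes>\<^bsub>gr\<^esub> b) \<odot>\<^bsub>am\<^esub> x = gd g r \<odot>\<^bsub>am\<^esub> (b \<odot>\<^bsub>am\<^esub> x)"
  using assms
proof (induction rule: gr_induct)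
  case zero
  interpret gr: ring gr by (rule ring_group_ring)
  show ?case using zero lin_homs_zero[OF N N lin]
    by (simp only: gr.r_null gd_closed action_module_zero action_module_delta N.M.zero_closed N.smult_zero_right)
next
  case (delta h s)
  then show ?case
    by (simp add: gr_delta_mult action_module_delta mult lin_homs_smult[OF lin] action_map_closed N.smult_closed N.smult_assoc1)
next
  case (add a b)
  then show ?case
    by (simp only: gr_r_distr action_module_l_distr action_module_closed gr_mult_closed gd_closed action_module_r_distr)
qed

lemma action_module_assoc:
  assumes "a \<in> carrier gr" "b \<in> carrier gr" "x \<in> carrier N"
  shows "(a \<otimes>\<^bsub>gr\<^esub> b) \<odot>\<^bsub>am\<^esub> x = a \<odot>\<^bsub>am\<^esub> (b \<odot>\<^bsub>am\<^esub> x)"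
  using assms
proof (induction rule: gr_induct)
  case zero
  interpret gr: ring gr by (rule ring_group_ring)
  show ?case using zero by (simp only: gr.l_null action_module_zero action_module_closed)
next
  case (delta h s)
  then show ?case by (simp only: action_module_assoc1)
next
  case (add a b)
  then show ?case
    by (simp only: gr_l_distr action_module_l_distr action_module_closed gr_mult_closed)
qed

lemma action_module_simps: "carrier am = carrier N" "\<zero>\<^bsub>am\<^esub> = \<zero>\<^bsub>N\<^esub>" "x \<oplus>\<^bsub>am\<^esub> y = x \<oplus>\<^bsub>N\<^esub> y"
  by (simp_all add: action_module_def)

lemma left_module_action: "left_module gr am"
proof (rule left_moduleI; (unfold action_module_simps)?)
  show "\<one>\<^bsub>gr\<^esub> \<odot>\<^bsub>am\<^esub> x = x" if "x \<in> carrier N" for x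
    using that by (simp add: action_module_delta one N.smult_one)
qed (use N.M.add.l_inv_ex in \<open>auto simp: action_module_closed action_module_l_distr action_module_r_distr action_module_assoc ring_group_ring N.M.a_ac
  simp del: group_ring_simps\<close>)

end

end

section \<open>Epimorphisms and projective covers of left modules\<close>

definition mod_arrow ::
  "('r, 'u) module \<Rightarrow> ('r, 'u) module \<Rightarrow> ('u \<Rightarrow> 'u) \<Rightarrow> (('r, 'u) module, 'u \<Rightarrow> 'u) arrow" where
  "mod_arrow M N f = \<lparr>src = M, tgt = N, fn = restrict f (carrier M)\<rparr>"

lemma Mod_cat_simps [simp]:
  "Obj (Mod_cat R) = {N. left_module R N}"
  "Dom (Mod_cat R) = src" "Cod (Mod_cat R) = tgt"
  "g \<diamondop>\<^bsub>Mod_cat R\<^esub> f = \<lparr>src = src f, tgt = tgt g, fn = compose (carrier (src f)) (fn g) (fn f)\<rparr>"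
  by (simp_all add: Mod_cat_def)

lemma Mod_cat_Mor: "f \<in> Mor (Mod_cat R) \<longleftrightarrow> left_module R (src f) \<and> left_module R (tgt f) \<and>
    fn f \<in> lin_homs R (src f) (tgt f) \<and> fn f \<in> extensional (carrier (src f))"
  by (simp add: Mod_cat_def)

lemma mod_arrow_Mor:
  assumes "left_module R M" "left_module R N" "f \<in> lin_homs R M N"
  shows "mod_arrow M N f \<in> Mor (Mod_cat R)"
  using assms lin_homs_cong[OF assms(1), of "restrict f (carrier M)" f N]
  by (simp add: Mod_cat_Mor mod_arrow_def)

lemma mod_arrow_simps [simp]:
  "src (mod_arrow M N f) = M" "tgt (mod_arrow M N f) = N"
  "x \<in> carrier M \<Longrightarrow> fn (mod_arrow M N f) x = f x"
  by (simp_all add: mod_arrow_def)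

lemma epic_cancel:
  assumes "epic C f" "g \<diamondop>\<^bsub>C\<^esub> f = h \<diamondop>\<^bsub>C\<^esub> f" "g \<in> homs C (Cod C f) b" "h \<in> homs C (Cod C f) b" "b \<in> Obj C"
  shows "g = h"
  using assms by (auto simp: epic_def)

text \<open>An epimorphism cannot distinguish the projection to its cokernel from the zero map, so
  the cokernel vanishes. The cokernel must be an object of the same category, hence of the same
  type, which is why \<open>rep_quotient\<close> is used.\<close>

lemma epic_Mod_cat_iff:
  "epic (Mod_cat R) p \<longleftrightarrow> p \<in> Mor (Mod_cat R) \<and> fn p ` carrier (src p) = carrier (tgt p)"
proof (intro iffI conjI)
  assume ep: "epic (Mod_cat R) p"
  then show p: "p \<in> Mor (Mod_cat R)" by (simp add: epic_def)
  let ?N = "tgt p" and ?H = "fn p ` carrier (src p)"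
  have M: "left_module R (src p)" and N: "left_module R ?N" and f: "fn p \<in> lin_homs R (src p) ?N"
    using p by (auto simp: Mod_cat_Mor)
  have H: "submodule ?H R ?N"
    by (rule submodule_image[OF M N f left_module.submodule_carrier[OF M]])
  let ?Q = "rep_quotient ?N ?H" and ?r = "coset_rep ?N ?H"
  interpret N: left_module R ?N by (rule N)
  have Q: "left_module R ?Q" by (rule left_module_rep_quotient[OF N H])
  interpret Q: left_module R ?Q by (rule Q)
  let ?g = "mod_arrow ?N ?Q ?r" and ?h = "mod_arrow ?N ?Q (\<lambda>x. \<zero>\<^bsub>?Q\<^esub>)"
  have gm: "?g \<in> Mor (Mod_cat R)"
    by (rule mod_arrow_Mor[OF N Q coset_rep_lin[OF N H]])
  have hm: "?h \<in> Mor (Mod_cat R)"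
    using Q.M.l_zero Q.smult_zero_right Q.M.zero_closed
    by (intro mod_arrow_Mor[OF N Q] lin_homsI) (simp_all del: rep_quotient_simps)
  have "?r (fn p x) = ?r \<zero>\<^bsub>?N\<^esub>" if "x \<in> carrier (src p)" for x
    using coset_rep_eq_zero_iff[OF N H] that lin_homs_closed[OF f] by blast
  then have "?g \<diamondop>\<^bsub>Mod_cat R\<^esub> p = ?h \<diamondop>\<^bsub>Mod_cat R\<^esub> p"
    using lin_homs_closed[OF f] by (auto simp: compose_def fun_eq_iff)
  then have gh: "?g = ?h"
    by (rule epic_cancel[OF ep]) (use gm hm Q in \<open>auto simp: homs_def simp del: rep_quotient_simps\<close>)
  have gh': "fn ?g x = fn ?h x" for x by (simp only: gh)
  have "?r x = ?r \<zero>\<^bsub>?N\<^esub>" if "x \<in> carrier ?N" for x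
    using gh'[of x] that by simp
  then have "x \<in> ?H" if "x \<in> carrier ?N" for x
    by (metis coset_rep_eq_zero_iff[OF N H that] that)
  moreover have "?H \<subseteq> carrier ?N"
    using lin_homs_closed[OF f] by auto
  ultimately show "?H = carrier ?N" by blast
next
  assume p: "p \<in> Mor (Mod_cat R) \<and> fn p ` carrier (src p) = carrier (tgt p)"
  have "g = h" if "g \<in> Mor (Mod_cat R)" "h \<in> Mor (Mod_cat R)" "src g = tgt p" "src h = tgt p"
    and eq: "g \<diamondop>\<^bsub>Mod_cat R\<^esub> p = h \<diamondop>\<^bsub>Mod_cat R\<^esub> p" for g h
  proof -
    have "fn g (fn p x) = fn h (fn p x)" if "x \<in> carrier (src p)" for x
    proof -
      have "compose (carrier (src p)) (fn g) (fn p) x = compose (carrier (src p)) (fn h) (fn p) x"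
        using eq by simp
      then show ?thesis using that by (simp add: compose_def)
    qed
    moreover have im: "carrier (tgt p) = fn p ` carrier (src p)" using p by simp
    ultimately have "fn g y = fn h y" if "y \<in> carrier (tgt p)" for y
      using that unfolding im by auto
    then have "fn g = fn h"
      using that by (intro extensionalityI[of _ "carrier (tgt p)"]) (auto simp: Mod_cat_Mor)
    then show ?thesis using eq that by (cases g, cases h) simp
  qed
  then show "epic (Mod_cat R) p"
    using p by (auto simp: epic_def homs_def)
qed

text \<open>Superfluity is tested on the inclusion of \<open>H\<close>: its composite with
  \<open>p\<close> is onto, so the inclusion itself is onto.\<close>

lemma superfluous_Mod_cat_submodule:
  assumes p: "superfluous (Mod_cat R) p" and H: "submodule H R (src p)"
    and im: "fn p ` H = carrier (tgt p)"
  shows "H = carrier (src p)"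
proof -
  have pm: "p \<in> Mor (Mod_cat R)" using p by (auto simp: superfluous_def epic_def)
  then have M: "left_module R (src p)" and N: "left_module R (tgt p)"
    and f: "fn p \<in> lin_homs R (src p) (tgt p)"
    by (auto simp: Mod_cat_Mor)
  interpret M: left_module R "src p" by (rule M)
  let ?L = "(src p)\<lparr>carrier := H\<rparr>"
  have L: "left_module R ?L" by (rule M.left_module_submodule[OF H])
  have HM: "H \<subseteq> carrier (src p)" using H by (simp add: M.submodule_iff)
  let ?i = "mod_arrow ?L (src p) (\<lambda>x. x)"
  have i: "?i \<in> Mor (Mod_cat R)"
    using HM by (intro mod_arrow_Mor[OF L M] lin_homsI) auto
  interpret cat: category "Mod_cat R" by (rule category_Mod_cat)
  have "p \<diamondop>\<^bsub>Mod_cat R\<^esub> ?i \<in> Mor (Mod_cat R)"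
    using cat.Comp_closed[of ?i ?L "src p" p "tgt p"] i pm by (simp add: homs_def)
  moreover have "fn p ` H = (\<lambda>x\<in>H. fn p (fn ?i x)) ` H" by (auto simp: mod_arrow_def)
  ultimately have "epic (Mod_cat R) (p \<diamondop>\<^bsub>Mod_cat R\<^esub> ?i)"
    using im by (simp add: epic_Mod_cat_iff compose_def)
  then have "epic (Mod_cat R) ?i"
    using p i by (simp add: superfluous_def)
  then show ?thesis by (auto simp: epic_Mod_cat_iff mod_arrow_def)
qed

text \<open>The identity of \<open>Q\<close> is lifted along the epimorphism given by
  \<open>\<tau>\<close>.\<close>

lemma projective_section:
  fixes Q L :: "('r, 'u) module"
  assumes Q: "projective (Mod_cat R) Q" and L: "left_module R L" and \<tau>: "\<tau> \<in> lin_homs R L Q"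
    and surj: "\<tau> ` carrier L = carrier Q"
  obtains \<sigma> where "\<sigma> \<in> lin_homs R Q L" "\<And>x. x \<in> carrier Q \<Longrightarrow> \<tau> (\<sigma> x) = x"
proof -
  have Q': "left_module R Q" using Q by (simp add: projective_def)
  let ?t = "mod_arrow L Q \<tau>" and ?i = "mod_arrow Q Q (\<lambda>x. x)"
  have "epic (Mod_cat R) ?t"
    using mod_arrow_Mor[OF L Q' \<tau>] surj by (auto simp: epic_Mod_cat_iff mod_arrow_def)
  moreover have "?i \<in> homs (Mod_cat R) Q (Cod (Mod_cat R) ?t)"
    using mod_arrow_Mor[OF Q' Q', of "\<lambda>x. x"] by (simp add: homs_def lin_homs_def)
  ultimately obtain g where g: "g \<in> homs (Mod_cat R) Q L" "?t \<diamondop>\<^bsub>Mod_cat R\<^esub> g = ?i"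
    using Q unfolding projective_def by (force simp del: Mod_cat_simps(4))
  show thesis
  proof
    have sg: "src g = Q" and gl: "fn g \<in> lin_homs R Q L" using g by (auto simp: homs_def Mod_cat_Mor)
    show "fn g \<in> lin_homs R Q L" by (rule gl)
    fix x assume x: "x \<in> carrier Q"
    have "fn (?t \<diamondop>\<^bsub>Mod_cat R\<^esub> g) x = fn ?i x" by (simp only: g)
    then show "\<tau> (fn g x) = x"
      using x sg lin_homs_closed[OF gl x] by (simp add: compose_def)
  qed
qed


section \<open>EI categories\<close>

locale EI = category +
  assumes endo_iso: "c \<in> Obj C \<Longrightarrow> u \<in> homs C c c \<Longrightarrow> iso_mor C u"

lemma EI_iff: "EI C \<longleftrightarrow> EI_category C"
  by (auto simp: EI_def EI_axioms_def EI_category_def)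

context category
begin

lemma homs_Obj: "u \<in> homs C a b \<Longrightarrow> a \<in> Obj C \<and> b \<in> Obj C"
  using Dom_closed Cod_closed by (auto simp: homs_def)

lemma Comp_nonempty: "homs C a b \<noteq> {} \<Longrightarrow> homs C b c \<noteq> {} \<Longrightarrow> homs C a c \<noteq> {}"
  using Comp_closed by blast

lemma Id_nonempty: "a \<in> Obj C \<Longrightarrow> homs C a a \<noteq> {}"
  using Id_closed by blast

end

context EI
begin

text \<open>With a morphism back, both round trips are endomorphisms and hence invertible, which
  gives \<open>u\<close> a left and a right inverse. Non-isomorphisms are from here on recognized by
  an empty hom-set in the opposite direction.\<close>

lemma iso_mor_iff:
  assumes u: "u \<in> homs C a b"
  shows "iso_mor C u \<longleftrightarrow> homs C b a \<noteq> {}"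
proof
  show "iso_mor C u \<Longrightarrow> homs C b a \<noteq> {}"
    using u by (auto simp: iso_mor_def homs_def)
  assume "homs C b a \<noteq> {}"
  then obtain w where w: "w \<in> homs C b a" by auto
  have ab: "a \<in> Obj C" "b \<in> Obj C" using homs_Obj[OF u] by auto
  obtain i where i: "i \<in> homs C a a" "i \<diamondop> (w \<diamondop> u) = Id C a"
    using endo_iso[OF ab(1) Comp_closed[OF u w]] Comp_closed[OF u w] by (auto simp: iso_mor_def homs_def)
  obtain j where j: "j \<in> homs C b b" "(u \<diamondop> w) \<diamondop> j = Id C b"
    using endo_iso[OF ab(2) Comp_closed[OF w u]] Comp_closed[OF w u] by (auto simp: iso_mor_def homs_def)
  let ?l = "i \<diamondop> w" and ?r = "w \<diamondop> j"
  have l: "?l \<in> homs C b a" "?l \<diamondop> u = Id C a"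
    using Comp_closed[OF w i(1)] Comp_assoc[OF u w i(1)] i(2) by auto
  have r: "?r \<in> homs C b a" "u \<diamondop> ?r = Id C b"
    using Comp_closed[OF j(1) w] Comp_assoc[OF j(1) w u] j(2) by auto
  have "?l = ?r"
    using Comp_assoc[OF r(1) u l(1)] l r Comp_Id_left[OF r(1)] Comp_Id_right[OF l(1)] by simp
  with l r u show "iso_mor C u" by (auto simp: iso_mor_def homs_def)
qed

lemma iso_inverse:
  assumes u: "u \<in> homs C a b" and "homs C b a \<noteq> {}"
  obtains v where "v \<in> homs C b a" "v \<diamondop> u = Id C a" "u \<diamondop> v = Id C b"
  using iso_mor_iff[OF u] assms by (auto simp: iso_mor_def homs_def)

lemma cl_iff: "c \<in> Obj C \<Longrightarrow> d \<in> cl C c \<longleftrightarrow> d \<in> Obj C \<and> homs C c d \<noteq> {} \<and> homs C d c \<noteq> {}"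
  using iso_mor_iff by (fastforce simp: cl_def)

lemma cl_eq_iff:
  assumes "c \<in> Obj C" "d \<in> Obj C"
  shows "cl C c = cl C d \<longleftrightarrow> homs C c d \<noteq> {} \<and> homs C d c \<noteq> {}"
proof
  assume "cl C c = cl C d"
  then show "homs C c d \<noteq> {} \<and> homs C d c \<noteq> {}"
    using cl_iff[OF assms(1), of d] cl_iff[OF assms(2), of d] Id_nonempty assms by auto
next
  assume h: "homs C c d \<noteq> {} \<and> homs C d c \<noteq> {}"
  show "cl C c = cl C d"
  proof (rule Set.set_eqI)
    show "e \<in> cl C c \<longleftrightarrow> e \<in> cl C d" for e
      using h cl_iff[OF assms(1), of e] cl_iff[OF assms(2), of e] Comp_nonempty[of c d e]
        Comp_nonempty[of d c e] Comp_nonempty[of e c d] Comp_nonempty[of e d c] by satx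
  qed
qed

text \<open>The order on classes asks for some representatives; composing with isomorphisms moves a
  witness to the given ones.\<close>

lemma cl_le_iff:
  assumes "c \<in> Obj C" "d \<in> Obj C"
  shows "cl_le C (cl C c) (cl C d) \<longleftrightarrow> homs C c d \<noteq> {}"
proof
  assume "cl_le C (cl C c) (cl C d)"
  then obtain a b where "a \<in> Obj C" "b \<in> Obj C" "cl C c = cl C a" "cl C d = cl C b" "homs C a b \<noteq> {}"
    by (auto simp: cl_le_def)
  then show "homs C c d \<noteq> {}"
    using cl_eq_iff[OF assms(1) \<open>a \<in> Obj C\<close>] cl_eq_iff[OF assms(2) \<open>b \<in> Obj C\<close>]
      Comp_nonempty[of c a b] Comp_nonempty[of c b d] by satx
qed (use assms in \<open>auto simp: cl_le_def\<close>)

section \<open>Upper sets, well-founded descent and representatives of isomorphism classes\<close>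

lemma upper_set_mono:
  assumes "upper_set C A" "cl C b \<in> A" "homs C b c \<noteq> {}"
  shows "cl C c \<in> A"
  using assms cl_le_iff[of b c] homs_Obj unfolding upper_set_def by blast

text \<open>\<open>hull\<close> is an intersection. The set of all classes is itself an upper set
  containing \<open>S\<close>, so the intersection consists of classes of objects, and being upward
  closed passes to intersections.\<close>

lemma upper_closure_upper_set:
  assumes "S \<subseteq> cl C ` Obj C" shows "upper_set C (upper_closure C S)"
proof -
  have all: "upper_set C (cl C ` Obj C)" by (auto simp: upper_set_def)
  have mono: "b \<in> T" if "upper_set C T" "a \<in> T" "b \<in> cl C ` Obj C" "cl_le C a b" for T a b
    using that unfolding upper_set_def by blast
  show ?thesis
    unfolding upper_set_def[of C "upper_closure C S"]
  proof (intro conjI ballI impI)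
    show "upper_closure C S \<subseteq> cl C ` Obj C"
      unfolding upper_closure_def by (rule hull_minimal) (use assms all in auto)
    fix a b assume ab: "a \<in> upper_closure C S" "b \<in> cl C ` Obj C" "cl_le C a b"
    show "b \<in> upper_closure C S"
      unfolding upper_closure_def hull_def
    proof (intro InterI, safe)
      fix T assume T: "upper_set C T" "S \<subseteq> T"
      have "a \<in> T" using ab(1) T unfolding upper_closure_def hull_def by auto
      then show "b \<in> T" using mono T ab by blast
    qed
  qed
qed

definition below :: "'a set set \<Rightarrow> 'a rel" where
  "below A = {(b, c). cl C b \<in> A \<and> cl C c \<in> A \<and> homs C b c \<noteq> {} \<and> homs C c b = {}}"

text \<open>An infinite descent among objects yields a descending chain of classes. It stabilizes,
  so two consecutive objects are isomorphic, against the missing morphism back.\<close>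

lemma wf_below:
  assumes "artinian C A" shows "wf (below A)"
  unfolding wf_iff_no_infinite_down_chain
proof
  assume "\<exists>f. \<forall>i. (f (Suc i), f i) \<in> below A"
  then obtain f where f: "\<And>i. (f (Suc i), f i) \<in> below A" by auto
  then have ob: "f i \<in> Obj C" for i
    using homs_Obj by (fastforce simp: below_def)
  have "cl_le C (cl C (f (Suc i))) (cl C (f i))" "cl C (f i) \<in> A" for i
    using f[of i] ob by (auto simp: below_def cl_le_iff)
  then obtain N where "\<forall>n \<ge> N. cl C (f n) = cl C (f N)"
    using assms[unfolded artinian_def, rule_format, of "\<lambda>n. cl C (f n)"] by auto
  then have "cl C (f (Suc N)) = cl C (f N)" by (meson le_SucI order_refl)
  then have "homs C (f N) (f (Suc N)) \<noteq> {}" using cl_eq_iff ob by metis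
  then show False using f[of N] by (auto simp: below_def)
qed

text \<open>The choice is made from the set \<open>cl C c\<close>, so isomorphic objects get the
  same \<open>crep\<close>. The condition \<open>crep c = c\<close> thus singles out one object in
  each class.\<close>

definition crep :: "'a \<Rightarrow> 'a" where
  "crep c = (SOME d. d \<in> cl C c)"

lemma crep_cl: "c \<in> Obj C \<Longrightarrow> crep c \<in> cl C c"
  unfolding crep_def by (rule someI[of _ c]) (simp add: cl_iff Id_nonempty)

lemma crep:
  assumes "c \<in> Obj C"
  shows "crep c \<in> Obj C" "homs C c (crep c) \<noteq> {}" "homs C (crep c) c \<noteq> {}" "crep (crep c) = crep c"
proof -
  show *: "crep c \<in> Obj C" "homs C c (crep c) \<noteq> {}" "homs C (crep c) c \<noteq> {}"
    using crep_cl[OF assms] cl_iff[OF assms] by auto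
  then have "cl C (crep c) = cl C c" using assms by (simp add: cl_eq_iff)
  then show "crep (crep c) = crep c" by (simp add: crep_def)
qed

lemma crep_eqI:
  assumes "c \<in> Obj C" "d \<in> Obj C" "crep c = c" "crep d = d" "homs C c d \<noteq> {}" "homs C d c \<noteq> {}"
  shows "c = d"
proof -
  have "cl C c = cl C d" using assms by (simp add: cl_eq_iff)
  then show ?thesis using assms by (metis crep_def)
qed

text \<open>The group of units of an endomorphism monoid is the whole monoid, by the EI
  property.\<close>

lemma aut_group_simps:
  assumes "c \<in> Obj C"
  shows "carrier (aut_group C c) = homs C c c" "\<one>\<^bsub>aut_group C c\<^esub> = Id C c"
    "x \<otimes>\<^bsub>aut_group C c\<^esub> y = x \<diamondop> y"
  using assms endo_iso aut_group_carrier[OF category_axioms assms]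
  by (auto simp: aut_group_def units_of_def)

lemma monoid_aut_group: "c \<in> Obj C \<Longrightarrow> monoid (aut_group C c)"
  by (rule monoidI) (auto simp: aut_group_simps Comp_closed Id_closed Comp_assoc
      Comp_Id_left Comp_Id_right)

end

section \<open>Modules over an EI category\<close>

text \<open>Natural transformations without the extensionality built into \<open>nat_trans\<close>:
  composites and lambda terms qualify directly, and restriction to carriers is postponed until an
  arrow of the category is formed.\<close>

definition kc_hom ::
  "'k ring \<Rightarrow> ('o, 'm) category \<Rightarrow> ('o, 'm, 'k, 'a) kc_module \<Rightarrow> ('o, 'm, 'k, 'b) kc_module \<Rightarrow>
    ('o \<Rightarrow> 'a \<Rightarrow> 'b) \<Rightarrow> bool" where
  "kc_hom K C M N f \<longleftrightarrow> (\<forall>c \<in> Obj C. f c \<in> lin_homs K (val M c) (val N c)) \<and>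
    (\<forall>a b. \<forall>u \<in> homs C a b. \<forall>x \<in> carrier (val M a). f b (act M u x) = act N u (f a x))"

definition kc_arrow ::
  "('o, 'm) category \<Rightarrow> ('o, 'm, 'k, 'u) kc_module \<Rightarrow> ('o, 'm, 'k, 'u) kc_module \<Rightarrow>
    ('o \<Rightarrow> 'u \<Rightarrow> 'u) \<Rightarrow> ('o, 'm, 'k, 'u) kc_arrow" where
  "kc_arrow C M N f = \<lparr>src = M, tgt = N, fn = \<lambda>c\<in>Obj C. restrict (f c) (carrier (val M c))\<rparr>"

lemma kC_cat_simps [simp]:
  "Obj (kC_cat K C) = {M. is_kc_module K C M}"
  "Dom (kC_cat K C) = src" "Cod (kC_cat K C) = tgt"
  "g \<diamondop>\<^bsub>kC_cat K C\<^esub> f = \<lparr>src = src f, tgt = tgt g,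
      fn = (\<lambda>c \<in> Obj C. compose (carrier (val (src f) c)) (fn g c) (fn f c))\<rparr>"
  by (simp_all add: kC_cat_def)

lemma kC_cat_Mor: "f \<in> Mor (kC_cat K C) \<longleftrightarrow> is_kc_module K C (src f) \<and> is_kc_module K C (tgt f) \<and>
    fn f \<in> nat_trans K C (src f) (tgt f)"
  by (simp add: kC_cat_def)

lemma kc_arrow_simps [simp]:
  "src (kc_arrow C M N f) = M" "tgt (kc_arrow C M N f) = N"
  "c \<in> Obj C \<Longrightarrow> x \<in> carrier (val M c) \<Longrightarrow> fn (kc_arrow C M N f) c x = f c x"
  by (simp_all add: kc_arrow_def)

lemma kc_hom_lin: "kc_hom K C M N f \<Longrightarrow> c \<in> Obj C \<Longrightarrow> f c \<in> lin_homs K (val M c) (val N c)"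
  by (simp add: kc_hom_def)

lemma kc_hom_closed: "kc_hom K C M N f \<Longrightarrow> c \<in> Obj C \<Longrightarrow> x \<in> carrier (val M c) \<Longrightarrow> f c x \<in> carrier (val N c)"
  using lin_homs_closed kc_hom_lin by metis

lemma kc_hom_nat: "kc_hom K C M N f \<Longrightarrow> u \<in> homs C a b \<Longrightarrow> x \<in> carrier (val M a) \<Longrightarrow>
    f b (act M u x) = act N u (f a x)"
  by (simp add: kc_hom_def)

lemma nat_trans_extensional:
  "f \<in> nat_trans K C M N \<Longrightarrow> f \<in> extensional (Obj C)"
  "f \<in> nat_trans K C M N \<Longrightarrow> c \<in> Obj C \<Longrightarrow> f c \<in> extensional (carrier (val M c))"
  by (auto simp: nat_trans_def PiE_iff)

locale kc_setting = EI C for C :: "('o, 'm) category" (structure) +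
  fixes K :: "'k ring"
  assumes cring_K: "cring K"
begin

interpretation K: cring K by (rule cring_K)

abbreviation "kcm \<equiv> is_kc_module K C"
abbreviation "R c \<equiv> group_ring K (aut_group C c)"
abbreviation "gdl c \<equiv> delta K (carrier (aut_group C c))"

text \<open>Over the commutative ring \<open>K\<close>, \<open>module\<close> and
  \<open>left_module\<close> coincide. This form lets the values of a functor and modules over group
  rings share one set of lemmas.\<close>

lemma kcm_iff:
  "kcm M \<longleftrightarrow> (\<forall>c \<in> Obj C. left_module K (val M c)) \<and>
    (\<forall>a b. \<forall>u \<in> homs C a b. act M u \<in> lin_homs K (val M a) (val M b)) \<and>
    (\<forall>c \<in> Obj C. \<forall>x \<in> carrier (val M c). act M (Id C c) x = x) \<and>
    (\<forall>a b c. \<forall>u \<in> homs C a b. \<forall>v \<in> homs C b c. \<forall>x \<in> carrier (val M a).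
      act M (v \<diamondop> u) x = act M v (act M u x))"
  by (auto simp: is_kc_module_def left_module_iff_module[OF cring_K] homs_def)

lemma kcm_val: "kcm M \<Longrightarrow> c \<in> Obj C \<Longrightarrow> left_module K (val M c)"
  and kcm_act: "kcm M \<Longrightarrow> u \<in> homs C a b \<Longrightarrow> act M u \<in> lin_homs K (val M a) (val M b)"
  and kcm_id: "kcm M \<Longrightarrow> c \<in> Obj C \<Longrightarrow> x \<in> carrier (val M c) \<Longrightarrow> act M (Id C c) x = x"
  and kcm_comp: "kcm M \<Longrightarrow> u \<in> homs C a b \<Longrightarrow> v \<in> homs C b c \<Longrightarrow> x \<in> carrier (val M a) \<Longrightarrow>
      act M (v \<diamondop> u) x = act M v (act M u x)"
  unfolding kcm_iff by blast+

lemma kcm_act_closed: "kcm M \<Longrightarrow> u \<in> homs C a b \<Longrightarrow> x \<in> carrier (val M a) \<Longrightarrow> act M u x \<in> carrier (val M b)"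
  by (rule lin_homs_closed[OF kcm_act])

lemma kcm_act_zero:
  assumes M: "kcm M" and u: "u \<in> homs C a b"
  shows "act M u \<zero>\<^bsub>val M a\<^esub> = \<zero>\<^bsub>val M b\<^esub>"
  using homs_Obj[OF u] by (intro lin_homs_zero[OF kcm_val[OF M] kcm_val[OF M] kcm_act[OF M u]]) auto

lemma nat_trans_kc_hom: "f \<in> nat_trans K C M N \<Longrightarrow> kc_hom K C M N f"
  by (auto simp: nat_trans_def kc_hom_def homs_def)

lemma kc_hom_cong:
  assumes M: "kcm M" and "\<And>c x. c \<in> Obj C \<Longrightarrow> x \<in> carrier (val M c) \<Longrightarrow> f c x = g c x"
    and f: "kc_hom K C M N f"
  shows "kc_hom K C M N g"
  unfolding kc_hom_def
proof (intro conjI ballI allI)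
  show "g c \<in> lin_homs K (val M c) (val N c)" if c: "c \<in> Obj C" for c
    using lin_homs_cong[OF kcm_val[OF M c], of "f c" "g c" "val N c"] assms(2)[OF c] kc_hom_lin[OF f c] by auto
  fix a b u x assume *: "u \<in> homs C a b" "x \<in> carrier (val M a)"
  then have "a \<in> Obj C" "b \<in> Obj C" using homs_Obj by auto
  with * show "g b (act M u x) = act N u (g a x)"
    using kc_hom_nat[OF f *] assms(2)[of b "act M u x"] assms(2)[of a x] kcm_act_closed[OF M *] by simp
qed

lemma kc_hom_nat_trans:
  assumes M: "kcm M" and f: "kc_hom K C M N f"
  shows "(\<lambda>c\<in>Obj C. restrict (f c) (carrier (val M c))) \<in> nat_trans K C M N"
proof -
  let ?g = "\<lambda>c\<in>Obj C. restrict (f c) (carrier (val M c))"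
  have g: "kc_hom K C M N ?g"
    by (rule kc_hom_cong[OF M _ f]) simp
  have "?g (Cod C u) (act M u x) = act N u (?g (Dom C u) x)"
    if "u \<in> Mor C" "x \<in> carrier (val M (Dom C u))" for u x
    by (rule kc_hom_nat[OF g]) (use that in \<open>auto simp: homs_def\<close>)
  then show ?thesis
    using kc_hom_lin[OF g] by (simp add: nat_trans_def)
qed

lemma kc_arrow_Mor:
  assumes "kcm M" "kcm N" "kc_hom K C M N f"
  shows "kc_arrow C M N f \<in> Mor (kC_cat K C)"
  using assms kc_hom_nat_trans[OF assms(1,3)] by (simp add: kC_cat_Mor kc_arrow_def)

lemma Mor_kc_hom: "p \<in> Mor (kC_cat K C) \<Longrightarrow> kc_hom K C (src p) (tgt p) (fn p)"
  by (simp add: kC_cat_Mor nat_trans_kc_hom)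

lemma kc_hom_compose:
  assumes f: "kc_hom K C L M f" and g: "kc_hom K C M N g"
  shows "kc_hom K C L N (\<lambda>c x. g c (f c x))"
  unfolding kc_hom_def
proof (intro conjI ballI allI)
  show "(\<lambda>x. g c (f c x)) \<in> lin_homs K (val L c) (val N c)" if "c \<in> Obj C" for c
    by (rule lin_homs_compose[OF kc_hom_lin[OF f that] kc_hom_lin[OF g that]])
  fix a b u x assume *: "u \<in> homs C a b" "x \<in> carrier (val L a)"
  then show "g b (f b (act L u x)) = act N u (g a (f a x))"
    using kc_hom_nat[OF f *] kc_hom_nat[OF g *(1), of "f a x"] kc_hom_closed[OF f, of a x] homs_Obj[OF *(1)]
    by simp
qed

text \<open>The functorial counterpart of \<open>left_module_surj_image\<close>: \<open>N\<close> is
  a bare record, and both module axioms and functoriality are pushed along the objectwise surjection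
  \<open>f\<close>. It serves for cokernels and for copies of free modules.\<close>

lemma kcm_surj_image:
  assumes M: "kcm M"
    and surj: "\<And>c. c \<in> Obj C \<Longrightarrow> f c ` carrier (val M c) = carrier (val N c)"
    and add: "\<And>c x y. c \<in> Obj C \<Longrightarrow> x \<in> carrier (val M c) \<Longrightarrow> y \<in> carrier (val M c) \<Longrightarrow>
      f c (x \<oplus>\<^bsub>val M c\<^esub> y) = f c x \<oplus>\<^bsub>val N c\<^esub> f c y"
    and smult: "\<And>c r x. c \<in> Obj C \<Longrightarrow> r \<in> carrier K \<Longrightarrow> x \<in> carrier (val M c) \<Longrightarrow>
      f c (r \<odot>\<^bsub>val M c\<^esub> x) = r \<odot>\<^bsub>val N c\<^esub> f c x"
    and zero: "\<And>c. c \<in> Obj C \<Longrightarrow> f c \<zero>\<^bsub>val M c\<^esub> = \<zero>\<^bsub>val N c\<^esub>"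
    and nat: "\<And>a b u x. u \<in> homs C a b \<Longrightarrow> x \<in> carrier (val M a) \<Longrightarrow>
      act N u (f a x) = f b (act M u x)"
  shows "kcm N" and "kc_hom K C M N f"
proof -
  have val: "left_module K (val N c)" if "c \<in> Obj C" for c
    by (rule left_module_surj_image[OF kcm_val[OF M that], of "f c"])
      (use that surj add smult zero in auto)
  have cl: "f c x \<in> carrier (val N c)" if "c \<in> Obj C" "x \<in> carrier (val M c)" for c x
    using surj that by blast
  show f: "kc_hom K C M N f"
    unfolding kc_hom_def by (auto intro!: lin_homsI simp: cl add smult nat)
  show "kcm N"
    unfolding kcm_iff
  proof (intro conjI ballI allI)
    show "left_module K (val N c)" if "c \<in> Obj C" for c by (rule val[OF that])
    show "act N (Id C c) y = y" if c: "c \<in> Obj C" and y: "y \<in> carrier (val N c)" for c y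
      using y nat[OF Id_closed[OF c]] kcm_id[OF M c] unfolding surj[OF c, symmetric] by auto
    fix a b u assume u: "u \<in> homs C a b"
    have ab: "a \<in> Obj C" "b \<in> Obj C" using homs_Obj[OF u] by auto
    show "act N u \<in> lin_homs K (val N a) (val N b)"
    proof (rule lin_homsI)
      show "act N u y \<in> carrier (val N b)" if "y \<in> carrier (val N a)" for y
        using that unfolding surj[OF ab(1), symmetric]
        by (auto simp: nat[OF u] intro!: cl[OF ab(2)] kcm_act_closed[OF M u])
      show "act N u (y \<oplus>\<^bsub>val N a\<^esub> z) = act N u y \<oplus>\<^bsub>val N b\<^esub> act N u z"
        if "y \<in> carrier (val N a)" "z \<in> carrier (val N a)" for y z
        using that left_module.axioms(2)[OF kcm_val[OF M ab(1)]] unfolding surj[OF ab(1), symmetric]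
        by (auto simp: nat[OF u] add[OF ab(1), symmetric] abelian_group_def abelian_monoid.a_closed
            lin_homs_add[OF kcm_act[OF M u]] add[OF ab(2)] kcm_act_closed[OF M u])
      show "act N u (r \<odot>\<^bsub>val N a\<^esub> y) = r \<odot>\<^bsub>val N b\<^esub> act N u y"
        if "r \<in> carrier K" "y \<in> carrier (val N a)" for r y
        using that left_module.smult_closed[OF kcm_val[OF M ab(1)]] unfolding surj[OF ab(1), symmetric]
        by (auto simp: nat[OF u] smult[OF ab(1), symmetric]
            lin_homs_smult[OF kcm_act[OF M u]] smult[OF ab(2)] kcm_act_closed[OF M u])
    qed
    fix c v y assume v: "v \<in> homs C b c" and y: "y \<in> carrier (val N a)"
    show "act N (v \<diamondop> u) y = act N v (act N u y)"
      using y unfolding surj[OF ab(1), symmetric]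
      by (auto simp: nat[OF u] nat[OF v] nat[OF Comp_closed[OF u v]] kcm_comp[OF M u v]
          kcm_act_closed[OF M u])
  qed
qed

lemma kc_submodule_iff:
  "kc_submodule K C M L \<longleftrightarrow> (\<forall>c \<in> Obj C. submodule (L c) K (val M c)) \<and>
    (\<forall>a b. \<forall>u \<in> homs C a b. act M u ` L a \<subseteq> L b)"
  by (auto simp: kc_submodule_def homs_def)

lemma kc_submoduleD:
  assumes "kcm M" "kc_submodule K C M L" "c \<in> Obj C"
  shows "L c \<subseteq> carrier (val M c)" "\<zero>\<^bsub>val M c\<^esub> \<in> L c" "\<And>x y. x \<in> L c \<Longrightarrow> y \<in> L c \<Longrightarrow> x \<oplus>\<^bsub>val M c\<^esub> y \<in> L c"
proof -
  have "submodule (L c) K (val M c)" using assms(2,3) by (simp add: kc_submodule_iff)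
  then show "L c \<subseteq> carrier (val M c)" "\<zero>\<^bsub>val M c\<^esub> \<in> L c"
    "\<And>x y. x \<in> L c \<Longrightarrow> y \<in> L c \<Longrightarrow> x \<oplus>\<^bsub>val M c\<^esub> y \<in> L c"
    unfolding left_module.submodule_iff[OF kcm_val[OF assms(1,3)]] by simp_all
qed

lemma restrict_kc_simps [simp]:
  "val (restrict_kc M L) c = (val M c)\<lparr>carrier := L c\<rparr>" "act (restrict_kc M L) = act M"
  by (simp_all add: restrict_kc_def)

lemma kcm_restrict:
  assumes M: "kcm M" and L: "kc_submodule K C M L"
  shows "kcm (restrict_kc M L)"
  unfolding kcm_iff
proof (intro conjI ballI allI)
  show "left_module K (val (restrict_kc M L) c)" if c: "c \<in> Obj C" for c
    using left_module.left_module_submodule[OF kcm_val[OF M c]] L c by (simp add: kc_submodule_iff)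
  have sub: "L c \<subseteq> carrier (val M c)" if "c \<in> Obj C" for c
    by (rule kc_submoduleD[OF M L that])
  show "act (restrict_kc M L) (Id C c) x = x" if "c \<in> Obj C" "x \<in> carrier (val (restrict_kc M L) c)" for c x
    using that kcm_id[OF M] sub by auto
  fix a b u assume u: "u \<in> homs C a b"
  have ab: "a \<in> Obj C" "b \<in> Obj C" using homs_Obj[OF u] by auto
  have "act M u ` L a \<subseteq> L b" using L u by (simp add: kc_submodule_iff)
  then show "act (restrict_kc M L) u \<in> lin_homs K (val (restrict_kc M L) a) (val (restrict_kc M L) b)"
    using lin_homs_submodule[OF kcm_act[OF M u] sub[OF ab(1)]] by simp
  show "act (restrict_kc M L) (v \<diamondop> u) x = act (restrict_kc M L) v (act (restrict_kc M L) u x)"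
    if "v \<in> homs C b c" "x \<in> carrier (val (restrict_kc M L) a)" for c v x
    using kcm_comp[OF M u that(1)] that(2) sub[OF ab(1)] by auto
qed

lemma kc_hom_inclusion:
  assumes M: "kcm M" and L: "kc_submodule K C M L"
  shows "kc_hom K C (restrict_kc M L) M (\<lambda>c x. x)"
  using subsetD[OF kc_submoduleD(1)[OF M L]] unfolding kc_hom_def
  by (auto intro!: lin_homsI)

lemma kc_submodule_image:
  assumes M: "kcm M" and N: "kcm N" and f: "kc_hom K C M N f" and L: "kc_submodule K C M L"
  shows "kc_submodule K C N (\<lambda>c. f c ` L c)"
  unfolding kc_submodule_iff
proof (intro conjI ballI allI)
  show "submodule (f c ` L c) K (val N c)" if "c \<in> Obj C" for c
    using submodule_image[OF kcm_val[OF M that] kcm_val[OF N that] kc_hom_lin[OF f that]] L that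
    by (simp add: kc_submodule_iff)
  fix a b u assume u: "u \<in> homs C a b"
  have a: "a \<in> Obj C" using homs_Obj[OF u] by auto
  have "act M u ` L a \<subseteq> L b" using L u by (simp add: kc_submodule_iff)
  moreover have "act N u (f a x) = f b (act M u x)" if "x \<in> L a" for x
    using kc_hom_nat[OF f u, of x] subsetD[OF kc_submoduleD(1)[OF M L a] that] by simp
  ultimately show "act N u ` f a ` L a \<subseteq> f b ` L b" by auto
qed

lemma kc_submodule_carrier: "kcm M \<Longrightarrow> kc_submodule K C M (\<lambda>c. carrier (val M c))"
  by (auto simp: kc_submodule_iff left_module.submodule_carrier[OF kcm_val] kcm_act_closed)

lemma kc_submodule_kernel:
  assumes p: "p \<in> Mor (kC_cat K C)"
  shows "kc_submodule K C (src p) (arrow_kernel p)"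
  unfolding kc_submodule_iff
proof (intro conjI ballI allI)
  have M: "kcm (src p)" and N: "kcm (tgt p)" using p by (auto simp: kC_cat_Mor)
  note f = Mor_kc_hom[OF p]
  show "submodule (arrow_kernel p c) K (val (src p) c)" if c: "c \<in> Obj C" for c
    using submodule_vimage[OF kcm_val[OF M c] kcm_val[OF N c] kc_hom_lin[OF f c]
        left_module.submodule_zero[OF kcm_val[OF N c]]]
    by (simp add: arrow_kernel_def)
  fix a b u assume u: "u \<in> homs C a b"
  show "act (src p) u ` arrow_kernel p a \<subseteq> arrow_kernel p b"
    using kcm_act_closed[OF M u] kcm_act_zero[OF N u] by (auto simp: arrow_kernel_def kc_hom_nat[OF f u])
qed

text \<open>As for modules over a ring, the projection to the cokernel is compared with the zero
  map. The cokernel functor \<open>Q\<close> is formed objectwise on coset representatives of the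
  image \<open>H\<close>.\<close>

lemma epic_kC_iff:
  "epic (kC_cat K C) p \<longleftrightarrow> p \<in> Mor (kC_cat K C) \<and>
    (\<forall>c \<in> Obj C. fn p c ` carrier (val (src p) c) = carrier (val (tgt p) c))"
proof (intro iffI conjI ballI)
  assume ep: "epic (kC_cat K C) p"
  then show p: "p \<in> Mor (kC_cat K C)" by (simp add: epic_def)
  have M: "kcm (src p)" and N: "kcm (tgt p)" using p by (auto simp: kC_cat_Mor)
  note f = Mor_kc_hom[OF p]
  define N' where "N' = tgt p"
  define H where "H = (\<lambda>c. fn p c ` carrier (val (src p) c))"
  define r where "r = (\<lambda>c. coset_rep (val N' c) (H c))"
  have N': "kcm N'" using N by (simp add: N'_def)
  have H: "kc_submodule K C N' H"
    unfolding H_def N'_def by (rule kc_submodule_image[OF M N f kc_submodule_carrier[OF M]])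
  then have Hc: "submodule (H c) K (val N' c)" if "c \<in> Obj C" for c
    using that by (simp add: kc_submodule_iff)
  define Q where "Q = \<lparr>val = \<lambda>c. rep_quotient (val N' c) (H c), act = \<lambda>u x. r (Cod C u) (act N' u x)\<rparr>"
  have rz: "r c x = r c \<zero>\<^bsub>val N' c\<^esub> \<longleftrightarrow> x \<in> H c" if "c \<in> Obj C" "x \<in> carrier (val N' c)" for c x
    unfolding r_def by (rule coset_rep_eq_zero_iff[OF kcm_val[OF N' that(1)] Hc[OF that(1)] that(2)])
  \<comment> \<open>The action descends to the quotient: \<open>x\<close> and its representative
    differ by an element of \<open>H a\<close>, which the action of \<open>u\<close> sends into
    \<open>H b\<close>.\<close>
  have nat: "act Q u (r a x) = r b (act N' u x)" if u: "u \<in> homs C a b" and x: "x \<in> carrier (val N' a)" for a b u x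
  proof -
    have ab: "a \<in> Obj C" "b \<in> Obj C" using homs_Obj[OF u] by auto
    have cr: "r a x \<in> carrier (val N' a)" "x \<ominus>\<^bsub>val N' a\<^esub> r a x \<in> H a"
      unfolding r_def by (rule coset_rep[OF kcm_val[OF N' ab(1)] Hc[OF ab(1)] x])+
    have "act N' u (x \<ominus>\<^bsub>val N' a\<^esub> r a x) \<in> H b"
      using cr(2) H u unfolding kc_submodule_iff by blast
    then have "act N' u x \<ominus>\<^bsub>val N' b\<^esub> act N' u (r a x) \<in> H b"
      by (simp only: lin_homs_minus[OF kcm_val[OF N' ab(1)] kcm_val[OF N' ab(2)] kcm_act[OF N' u] x cr(1)])
    then have "r b (act N' u x) = r b (act N' u (r a x))"
      using coset_rep_eq_iff[OF kcm_val[OF N' ab(2)] Hc[OF ab(2)] kcm_act_closed[OF N' u x]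
          kcm_act_closed[OF N' u cr(1)]] unfolding r_def by blast
    then show ?thesis using u by (simp add: Q_def homs_def)
  qed
  have q1: "r c ` carrier (val N' c) = carrier (val Q c)" and q4: "r c \<zero>\<^bsub>val N' c\<^esub> = \<zero>\<^bsub>val Q c\<^esub>" for c
    by (simp_all add: Q_def r_def)
  have q2: "r c (x \<oplus>\<^bsub>val N' c\<^esub> y) = r c x \<oplus>\<^bsub>val Q c\<^esub> r c y"
    if "c \<in> Obj C" "x \<in> carrier (val N' c)" "y \<in> carrier (val N' c)" for c x y
    using coset_rep_add[OF kcm_val[OF N'] Hc] that by (simp add: Q_def r_def)
  have q3: "r c (a \<odot>\<^bsub>val N' c\<^esub> x) = a \<odot>\<^bsub>val Q c\<^esub> r c x"
    if "c \<in> Obj C" "a \<in> carrier K" "x \<in> carrier (val N' c)" for c a x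
    using coset_rep_smult[OF kcm_val[OF N'] Hc] that by (simp add: Q_def r_def)
  note Q = kcm_surj_image(1)[OF N' q1 q2 q3 q4 nat] and rh = kcm_surj_image(2)[OF N' q1 q2 q3 q4 nat]
  have zh: "kc_hom K C N' Q (\<lambda>c x. \<zero>\<^bsub>val Q c\<^esub>)"
    unfolding kc_hom_def
  proof (intro conjI ballI allI)
    fix c assume c: "c \<in> Obj C"
    interpret Qc: left_module K "val Q c" by (rule kcm_val[OF Q c])
    show "(\<lambda>x. \<zero>\<^bsub>val Q c\<^esub>) \<in> lin_homs K (val N' c) (val Q c)"
      by (rule lin_homsI) simp_all
  qed (simp add: kcm_act_zero[OF Q])
  let ?g = "kc_arrow C N' Q r" and ?h = "kc_arrow C N' Q (\<lambda>c x. \<zero>\<^bsub>val Q c\<^esub>)"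
  have eq: "r c (fn p c x) = \<zero>\<^bsub>val Q c\<^esub>" if c: "c \<in> Obj C" and x: "x \<in> carrier (val (src p) c)" for c x
    using rz[OF c, of "fn p c x"] kc_hom_closed[OF f c x] x by (auto simp: H_def N'_def Q_def r_def)
  have "?g \<diamondop>\<^bsub>kC_cat K C\<^esub> p = ?h \<diamondop>\<^bsub>kC_cat K C\<^esub> p"
    using eq kc_hom_closed[OF f] by (auto simp: compose_def fun_eq_iff N'_def[symmetric])
  then have "?g = ?h"
    by (rule epic_cancel[OF ep])
      (use kc_arrow_Mor[OF N' Q rh] kc_arrow_Mor[OF N' Q zh] Q in \<open>auto simp: homs_def N'_def\<close>)
  then have gh: "fn ?g c x = fn ?h c x" for c x by (simp only:)
  fix c assume c: "c \<in> Obj C"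
  have "x \<in> H c" if x: "x \<in> carrier (val N' c)" for x
    using gh[of c x] rz[OF c x] c x by (simp add: Q_def r_def)
  then show "fn p c ` carrier (val (src p) c) = carrier (val (tgt p) c)"
    using kc_hom_closed[OF f c] by (auto simp: H_def N'_def)
next
  assume p: "p \<in> Mor (kC_cat K C) \<and>
    (\<forall>c \<in> Obj C. fn p c ` carrier (val (src p) c) = carrier (val (tgt p) c))"
  have "g = h" if g: "g \<in> Mor (kC_cat K C)" and h: "h \<in> Mor (kC_cat K C)" and s: "src g = tgt p" "src h = tgt p"
    and eq: "g \<diamondop>\<^bsub>kC_cat K C\<^esub> p = h \<diamondop>\<^bsub>kC_cat K C\<^esub> p" for g h
  proof -
    have e: "fn g c (fn p c x) = fn h c (fn p c x)" if "c \<in> Obj C" "x \<in> carrier (val (src p) c)" for c x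
    proof -
      have "fn (g \<diamondop>\<^bsub>kC_cat K C\<^esub> p) c x = fn (h \<diamondop>\<^bsub>kC_cat K C\<^esub> p) c x"
        by (simp only: eq)
      then show ?thesis using that by (simp add: compose_def)
    qed
    have "fn g c y = fn h c y" if c: "c \<in> Obj C" and y: "y \<in> carrier (val (tgt p) c)" for c y
    proof -
      have im: "carrier (val (tgt p) c) = fn p c ` carrier (val (src p) c)" using p c by simp
      show ?thesis using y e[OF c] unfolding im by auto
    qed
    then have "fn g c = fn h c" if c: "c \<in> Obj C" for c
      using nat_trans_extensional(2)[of "fn g" K C "tgt p" "tgt g" c] c
        nat_trans_extensional(2)[of "fn h" K C "tgt p" "tgt h" c] g h s
      by (intro extensionalityI[of _ "carrier (val (tgt p) c)"]) (auto simp: kC_cat_Mor)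
    then have "fn g = fn h"
      using nat_trans_extensional(1)[of "fn g"] nat_trans_extensional(1)[of "fn h"] g h
      by (intro extensionalityI[of _ "Obj C"]) (auto simp: kC_cat_Mor)
    then show ?thesis using eq s by (cases g, cases h) simp
  qed
  then show "epic (kC_cat K C) p"
    using p by (auto simp: epic_def homs_def)
qed

text \<open>A morphism into the source of \<open>p\<close> may be replaced by its image, so testing
  subfunctors suffices.\<close>

lemma superfluous_kCI:
  assumes p: "epic (kC_cat K C) p"
    and sub: "\<And>L. kc_submodule K C (src p) L \<Longrightarrow>
      (\<And>c. c \<in> Obj C \<Longrightarrow> fn p c ` L c = carrier (val (tgt p) c)) \<Longrightarrow>
      (\<And>c. c \<in> Obj C \<Longrightarrow> L c = carrier (val (src p) c))"
  shows "superfluous (kC_cat K C) p"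
proof -
  interpret cat: category "kC_cat K C" by (rule category_kC_cat[OF category_axioms])
  have pm: "p \<in> Mor (kC_cat K C)" using p by (simp add: epic_def)
  have "epic (kC_cat K C) g \<longleftrightarrow> epic (kC_cat K C) (p \<diamondop>\<^bsub>kC_cat K C\<^esub> g)"
    if g: "g \<in> Mor (kC_cat K C)" and s: "tgt g = src p" for g
  proof -
    have M: "kcm (src g)" "kcm (tgt g)" using g by (auto simp: kC_cat_Mor)
    have pg: "p \<diamondop>\<^bsub>kC_cat K C\<^esub> g \<in> Mor (kC_cat K C)"
      using cat.Comp_closed[of g "src g" "src p" p "tgt p"] g pm s by (simp add: homs_def)
    have im: "fn (p \<diamondop>\<^bsub>kC_cat K C\<^esub> g) c ` carrier (val (src g) c) =
        fn p c ` fn g c ` carrier (val (src g) c)" if "c \<in> Obj C" for c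
      using that by (auto simp: compose_def image_iff)
    have L: "kc_submodule K C (src p) (\<lambda>c. fn g c ` carrier (val (src g) c))"
      using kc_submodule_image[OF M Mor_kc_hom[OF g] kc_submodule_carrier[OF M(1)]] s by simp
    show ?thesis
    proof
      assume "epic (kC_cat K C) g"
      then show "epic (kC_cat K C) (p \<diamondop>\<^bsub>kC_cat K C\<^esub> g)"
        using p pg im s by (simp add: epic_kC_iff)
    next
      assume e: "epic (kC_cat K C) (p \<diamondop>\<^bsub>kC_cat K C\<^esub> g)"
      have "fn p c ` fn g c ` carrier (val (src g) c) = carrier (val (tgt p) c)" if "c \<in> Obj C" for c
        using e im[OF that] that by (simp add: epic_kC_iff)
      from sub[OF L this] show "epic (kC_cat K C) g"
        using g s by (auto simp: epic_kC_iff)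
    qed
  qed
  then show ?thesis using p by (simp add: superfluous_def)
qed

end

section \<open>Values as group ring modules, images of non-isomorphisms, the Nakayama lemma\<close>

definition loc_module ::
  "'k ring \<Rightarrow> ('o, 'm) category \<Rightarrow> ('o, 'm, 'k, 'u) kc_module \<Rightarrow> 'o \<Rightarrow> ('m \<Rightarrow> 'k, 'u) module" where
  "loc_module K C M c = action_module K (aut_group C c) (val M c) (act M)"

context kc_setting
begin

interpretation K: cring K by (rule cring_K)

abbreviation "non M c \<equiv> noniso_sum K C M c"
abbreviation "loc \<equiv> loc_module K C"

lemma submodule_non:
  assumes M: "kcm M" and c: "c \<in> Obj C"
  shows "submodule (non M c) K (val M c)"
proof -
  interpret left_module K "val M c" by (rule kcm_val[OF M c])
  show ?thesis
    unfolding noniso_sum_def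
  proof (rule submodule_hull, safe)
    fix u x assume "u \<in> Mor C" "x \<in> carrier (val M (Dom C u))" "c = Cod C u"
    then show "act M u x \<in> carrier (val M (Cod C u))"
      using kcm_act_closed[OF M, of u "Dom C u" "Cod C u"] by (simp add: homs_def)
  qed
qed

lemma act_in_non:
  assumes "u \<in> homs C b c" "homs C c b = {}" "x \<in> carrier (val M b)"
  shows "act M u x \<in> non M c"
proof -
  have "\<not> iso_mor C u" using iso_mor_iff[OF assms(1)] assms(2) by simp
  then have "act M u x \<in> (\<Union>u \<in> {u \<in> Mor C. Cod C u = c \<and> \<not> iso_mor C u}. act M u ` carrier (val M (Dom C u)))"
    using assms by (auto simp: homs_def)
  then show ?thesis unfolding noniso_sum_def by (rule hull_inc)
qed

lemma non_le_submodule: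
  assumes "submodule H K (val M c)"
    and "\<And>b u x. u \<in> homs C b c \<Longrightarrow> homs C c b = {} \<Longrightarrow> x \<in> carrier (val M b) \<Longrightarrow> act M u x \<in> H"
  shows "non M c \<subseteq> H"
  unfolding noniso_sum_def
proof (rule hull_minimal, safe)
  fix u x assume "u \<in> Mor C" "c = Cod C u" "\<not> iso_mor C u" "x \<in> carrier (val M (Dom C u))"
  then show "act M u x \<in> H"
    using assms(2)[of u "Dom C u" x] iso_mor_iff[of u "Dom C u" c] by (auto simp: homs_def)
qed (rule assms(1))

text \<open>The preimage of \<open>non N d\<close> is a submodule, so it suffices to look at the
  generators of \<open>non M c\<close>. The lemma covers both natural maps and the action of a
  morphism.\<close>

lemma non_map:
  assumes M: "kcm M" and N: "kcm N" and c: "c \<in> Obj C" and d: "d \<in> Obj C"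
    and h: "h \<in> lin_homs K (val M c) (val N d)"
    and act: "\<And>b u x. u \<in> homs C b c \<Longrightarrow> homs C c b = {} \<Longrightarrow> x \<in> carrier (val M b) \<Longrightarrow>
      h (act M u x) \<in> non N d"
    and x: "x \<in> non M c"
  shows "h x \<in> non N d"
proof -
  have "non M c \<subseteq> {x \<in> carrier (val M c). h x \<in> non N d}"
    by (rule non_le_submodule[OF submodule_vimage[OF kcm_val[OF M c] kcm_val[OF N d] h submodule_non[OF N d]]])
      (use act kcm_act_closed[OF M] in auto)
  then show ?thesis using x by auto
qed

lemma non_hom:
  assumes M: "kcm M" and N: "kcm N" and f: "kc_hom K C M N f" and c: "c \<in> Obj C" and x: "x \<in> non M c"
  shows "f c x \<in> non N c"
proof (rule non_map[OF M N c c kc_hom_lin[OF f c] _ x])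
  fix b u y assume *: "u \<in> homs C b c" "homs C c b = {}" "y \<in> carrier (val M b)"
  then show "f c (act M u y) \<in> non N c"
    using kc_hom_closed[OF f, of b y] homs_Obj[OF *(1)]
    by (simp add: kc_hom_nat[OF f *(1,3)] act_in_non)
qed

text \<open>Composition with \<open>v\<close> keeps a non-isomorphism \<open>b\<close> to
  \<open>c\<close> non-invertible: a morphism from \<open>d\<close> back to \<open>b\<close>,
  preceded by \<open>v\<close>, would lead from \<open>c\<close> to \<open>b\<close>.\<close>

lemma non_act:
  assumes M: "kcm M" and v: "v \<in> homs C c d" and x: "x \<in> non M c"
  shows "act M v x \<in> non M d"
proof -
  have cd: "c \<in> Obj C" "d \<in> Obj C" using homs_Obj[OF v] by auto
  show ?thesis
  proof (rule non_map[OF M M cd kcm_act[OF M v] _ x])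
    fix b u y assume *: "u \<in> homs C b c" "homs C c b = {}" "y \<in> carrier (val M b)"
    have "homs C d b = {}" using *(2) Comp_nonempty[of c d b] v by auto
    then show "act M v (act M u y) \<in> non M d"
      using act_in_non[OF Comp_closed[OF *(1) v] _ *(3)] by (simp add: kcm_comp[OF M *(1) v *(3)])
  qed
qed

lemma non_carrier: "kcm M \<Longrightarrow> c \<in> Obj C \<Longrightarrow> non M c \<subseteq> carrier (val M c)"
  using submodule_non[of M c] by (simp add: left_module.submodule_iff[OF kcm_val])

definition supp_in :: "'o set set \<Rightarrow> ('o, 'm, 'k, 'u) kc_module \<Rightarrow> bool" where
  "supp_in A M \<longleftrightarrow> (\<forall>c \<in> Obj C. carrier (val M c) \<noteq> {\<zero>\<^bsub>val M c\<^esub>} \<longrightarrow> cl C c \<in> A)"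

text \<open>Well-founded induction along the non-isomorphisms takes the place of the finite generation
  hypothesis of the usual Nakayama lemma.\<close>

lemma nakayama:
  assumes M: "kcm M" and L: "kc_submodule K C M L"
    and A: "artinian C A" "supp_in A M"
    and gen: "\<And>c x. c \<in> Obj C \<Longrightarrow> crep c = c \<Longrightarrow> x \<in> carrier (val M c) \<Longrightarrow>
      \<exists>y \<in> L c. x \<ominus>\<^bsub>val M c\<^esub> y \<in> non M c"
    and c: "c \<in> Obj C"
  shows "L c = carrier (val M c)"
  using wf_below[OF A(1)] c
proof (induction c rule: wf_induct_rule)
  case (less c)
  note c = \<open>c \<in> Obj C\<close>
  have Lc: "L c \<subseteq> carrier (val M c)" "\<zero>\<^bsub>val M c\<^esub> \<in> L c" by (rule kc_submoduleD[OF M L c])+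
  show ?case
  proof (cases "cl C c \<in> A")
    case False
    then have "carrier (val M c) = {\<zero>\<^bsub>val M c\<^esub>}" using A c by (auto simp: supp_in_def)
    then show ?thesis using Lc by auto
  next
    case True
    \<comment> \<open>Generation is assumed at chosen representatives only. The argument is made at
      \<open>r\<close> and carried back to \<open>c\<close> along an isomorphism.\<close>
    define r where "r = crep c"
    have r: "r \<in> Obj C" "homs C c r \<noteq> {}" "homs C r c \<noteq> {}" "crep r = r"
      unfolding r_def by (rule crep[OF c])+
    have Lr: "submodule (L r) K (val M r)" using L r by (simp add: kc_submodule_iff)
    \<comment> \<open>Each source \<open>b\<close> of a non-isomorphism into \<open>r\<close> lies
      strictly below \<open>c\<close>: either the induction hypothesis applies to it, or its class
      is outside \<open>A\<close> and \<open>M\<close> vanishes there.\<close>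
    have "non M r \<subseteq> L r"
    proof (rule non_le_submodule[OF Lr])
      fix b u x assume u: "u \<in> homs C b r" "homs C r b = {}" "x \<in> carrier (val M b)"
      have b: "b \<in> Obj C" using homs_Obj[OF u(1)] by auto
      have "x \<in> L b"
      proof (cases "cl C b \<in> A")
        case b': True
        have "homs C b c \<noteq> {}" "homs C c b = {}"
          using Comp_nonempty[of b r c] Comp_nonempty[of r c b] u r by auto
        then have "(b, c) \<in> below A" using b' True by (simp add: below_def)
        then show ?thesis using less.IH[of b] b u by simp
      next
        case False
        then have "carrier (val M b) = {\<zero>\<^bsub>val M b\<^esub>}" using A b by (auto simp: supp_in_def)
        then show ?thesis using kc_submoduleD(2)[OF M L b] u by auto
      qed
      then show "act M u x \<in> L r" using L u(1) unfolding kc_submodule_iff by blast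
    qed
    have Mr: "carrier (val M r) \<subseteq> L r"
    proof
      fix x assume x: "x \<in> carrier (val M r)"
      interpret left_module K "val M r" by (rule kcm_val[OF M r(1)])
      obtain y where y: "y \<in> L r" "x \<ominus>\<^bsub>val M r\<^esub> y \<in> non M r" using gen[OF r(1,4) x] by auto
      then have "(x \<ominus>\<^bsub>val M r\<^esub> y) \<oplus>\<^bsub>val M r\<^esub> y \<in> L r"
        using \<open>non M r \<subseteq> L r\<close> kc_submoduleD(3)[OF M L r(1)] by blast
      then show "x \<in> L r"
        using minus_add_cancel[OF x, of y] y kc_submoduleD(1)[OF M L r(1)] by auto
    qed
    obtain u where u: "u \<in> homs C r c" using r by auto
    obtain v where v: "v \<in> homs C c r" "u \<diamondop> v = Id C c" using iso_inverse[OF u] r by metis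
    have "x \<in> L c" if x: "x \<in> carrier (val M c)" for x
    proof -
      have "act M v x \<in> L r" using Mr kcm_act_closed[OF M v(1) x] by auto
      then have "act M u (act M v x) \<in> L c" using L u unfolding kc_submodule_iff by blast
      then show ?thesis using kcm_comp[OF M v(1) u x] kcm_id[OF M c x] v(2) by simp
    qed
    then show ?thesis using Lc by auto
  qed
qed

lemma aut_action:
  assumes M: "kcm M" and c: "c \<in> Obj C"
  shows "left_module K (val M c)"
    and "g \<in> carrier (aut_group C c) \<Longrightarrow> act M g \<in> lin_homs K (val M c) (val M c)"
    and "x \<in> carrier (val M c) \<Longrightarrow> act M \<one>\<^bsub>aut_group C c\<^esub> x = x"
    and "g \<in> carrier (aut_group C c) \<Longrightarrow> h \<in> carrier (aut_group C c) \<Longrightarrow> x \<in> carrier (val M c) \<Longrightarrow>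
      act M (g \<otimes>\<^bsub>aut_group C c\<^esub> h) x = act M g (act M h x)"
  using kcm_val[OF M c] kcm_act[OF M] kcm_id[OF M c] kcm_comp[OF M, of h c c g c x]
  by (simp_all add: aut_group_simps[OF c])

lemma loc_simps [simp]:
  "carrier (loc M c) = carrier (val M c)" "\<zero>\<^bsub>loc M c\<^esub> = \<zero>\<^bsub>val M c\<^esub>"
  "x \<oplus>\<^bsub>loc M c\<^esub> y = x \<oplus>\<^bsub>val M c\<^esub> y"
  by (simp_all add: loc_module_def action_module_def)

lemma loc_minus [simp]: "x \<ominus>\<^bsub>loc M c\<^esub> y = x \<ominus>\<^bsub>val M c\<^esub> y"
  by (simp add: a_minus_def a_inv_def m_inv_def)

lemma left_module_loc: "kcm M \<Longrightarrow> c \<in> Obj C \<Longrightarrow> left_module (R c) (loc M c)"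
  unfolding loc_module_def
  by (rule left_module_action[OF cring_K monoid_aut_group aut_action]) auto

lemma ring_R: "c \<in> Obj C \<Longrightarrow> ring (R c)"
  by (rule ring_group_ring[OF cring_K monoid_aut_group])

lemma loc_gd:
  assumes "kcm M" "c \<in> Obj C" "g \<in> homs C c c" "r \<in> carrier K" "x \<in> carrier (val M c)"
  shows "gdl c g r \<odot>\<^bsub>loc M c\<^esub> x = r \<odot>\<^bsub>val M c\<^esub> act M g x"
  unfolding loc_module_def
  by (rule action_module_delta[OF cring_K monoid_aut_group aut_action]) (use assms in \<open>auto simp: aut_group_simps\<close>)

lemma loc_gd1:
  assumes "kcm M" "c \<in> Obj C" "g \<in> homs C c c" "x \<in> carrier (val M c)"
  shows "gdl c g \<one>\<^bsub>K\<^esub> \<odot>\<^bsub>loc M c\<^esub> x = act M g x"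
proof -
  interpret left_module K "val M c" by (rule kcm_val[OF assms(1,2)])
  show ?thesis using assms by (simp add: loc_gd smult_one kcm_act_closed[OF assms(1,3)])
qed

lemma gdl_closed: "c \<in> Obj C \<Longrightarrow> g \<in> homs C c c \<Longrightarrow> r \<in> carrier K \<Longrightarrow> gdl c g r \<in> carrier (R c)"
  by (rule gd_closed[OF cring_K monoid_aut_group]) (auto simp: aut_group_simps)

text \<open>Restricting scalars returns the original \<open>K\<close>-structure because the identity
  morphism acts trivially.\<close>

lemma loc_scalar:
  assumes "kcm M" "c \<in> Obj C" "r \<in> carrier K" "x \<in> carrier (val M c)"
  shows "r \<odot>\<^bsub>scalar_module K (aut_group C c) (loc M c)\<^esub> x = r \<odot>\<^bsub>val M c\<^esub> x"
  using assms loc_gd[OF assms(1,2) Id_closed[OF assms(2)] assms(3,4)]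
  by (simp add: scalar_smult aut_group_simps kcm_id)

lemma loc_submoduleI:
  assumes M: "kcm M" and c: "c \<in> Obj C" and H: "submodule H K (val M c)"
    and stable: "\<And>g x. g \<in> homs C c c \<Longrightarrow> x \<in> H \<Longrightarrow> act M g x \<in> H"
  shows "submodule H (R c) (loc M c)"
proof (rule gr_submoduleI[OF cring_K monoid_aut_group[OF c] left_module_loc[OF M c]])
  interpret V: left_module K "val M c" by (rule kcm_val[OF M c])
  have HM: "H \<subseteq> carrier (val M c)" using H by (simp add: V.submodule_iff)
  interpret S: left_module K "scalar_module K (aut_group C c) (loc M c)"
    by (rule left_module_scalar[OF cring_K monoid_aut_group[OF c] left_module_loc[OF M c]])
  show "submodule H K (scalar_module K (aut_group C c) (loc M c))"
    using H by (auto simp: S.submodule_iff V.submodule_iff loc_scalar[OF M c] subset_iff)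
  show "gdl c g \<one>\<^bsub>K\<^esub> \<odot>\<^bsub>loc M c\<^esub> x \<in> H" if "g \<in> carrier (aut_group C c)" "x \<in> H" for g x
    using that stable HM loc_gd1[OF M c, of g x] by (auto simp: aut_group_simps[OF c] subset_iff)
qed

lemma loc_lin_homsI:
  assumes M: "kcm M" and c: "c \<in> Obj C" and Q: "left_module (R c) Q"
    and h: "h \<in> lin_homs K (val M c) (scalar_module K (aut_group C c) Q)"
    and eq: "\<And>g x. g \<in> homs C c c \<Longrightarrow> x \<in> carrier (val M c) \<Longrightarrow> h (act M g x) = gdl c g \<one>\<^bsub>K\<^esub> \<odot>\<^bsub>Q\<^esub> h x"
  shows "h \<in> lin_homs (R c) (loc M c) Q"
proof (rule gr_lin_homsI[OF cring_K monoid_aut_group[OF c] left_module_loc[OF M c] Q])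
  show "h \<in> lin_homs K (scalar_module K (aut_group C c) (loc M c)) (scalar_module K (aut_group C c) Q)"
    using lin_homs_closed[OF h] lin_homs_add[OF h] lin_homs_smult[OF h]
    by (intro lin_homsI) (simp_all add: loc_scalar[OF M c])
  show "h (gdl c g \<one>\<^bsub>K\<^esub> \<odot>\<^bsub>loc M c\<^esub> x) = gdl c g \<one>\<^bsub>K\<^esub> \<odot>\<^bsub>Q\<^esub> h x"
    if "g \<in> carrier (aut_group C c)" "x \<in> carrier (loc M c)" for g x
    using that eq loc_gd1[OF M c, of g x] by (simp add: aut_group_simps[OF c])
qed

lemma loc_hom:
  assumes M: "kcm M" and N: "kcm N" and f: "kc_hom K C M N f" and c: "c \<in> Obj C"
  shows "f c \<in> lin_homs (R c) (loc M c) (loc N c)"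
proof (rule loc_lin_homsI[OF M c left_module_loc[OF N c]])
  note fc = kc_hom_lin[OF f c]
  show "f c \<in> lin_homs K (val M c) (scalar_module K (aut_group C c) (loc N c))"
    using lin_homs_closed[OF fc] lin_homs_add[OF fc] lin_homs_smult[OF fc]
    by (intro lin_homsI) (simp_all add: loc_scalar[OF N c])
  show "f c (act M g x) = gdl c g \<one>\<^bsub>K\<^esub> \<odot>\<^bsub>loc N c\<^esub> f c x"
    if "g \<in> homs C c c" "x \<in> carrier (val M c)" for g x
    using that kc_hom_nat[OF f] kc_hom_closed[OF f c] by (simp add: loc_gd1[OF N c])
qed

lemma submodule_non_loc:
  assumes M: "kcm M" and c: "c \<in> Obj C"
  shows "submodule (non M c) (R c) (loc M c)"
  by (rule loc_submoduleI[OF M c submodule_non[OF M c]]) (rule non_act[OF M])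

text \<open>In contrast to \<^const>\<open>split_quotient\<close>, the split quotient \<open>spl\<close> carries the action of the group
  ring and lives in the universe.\<close>

abbreviation "spl M c \<equiv> rep_quotient (loc M c) (non M c)"
abbreviation "rho M c \<equiv> coset_rep (loc M c) (non M c)"

lemma left_module_spl: "kcm M \<Longrightarrow> c \<in> Obj C \<Longrightarrow> left_module (R c) (spl M c)"
  by (rule left_module_rep_quotient[OF left_module_loc submodule_non_loc])

lemma rho_lin: "kcm M \<Longrightarrow> c \<in> Obj C \<Longrightarrow> rho M c \<in> lin_homs (R c) (loc M c) (spl M c)"
  by (rule coset_rep_lin[OF left_module_loc submodule_non_loc])

lemma rho_eq_iff:
  "kcm M \<Longrightarrow> c \<in> Obj C \<Longrightarrow> x \<in> carrier (val M c) \<Longrightarrow> y \<in> carrier (val M c) \<Longrightarrow>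
    rho M c x = rho M c y \<longleftrightarrow> x \<ominus>\<^bsub>val M c\<^esub> y \<in> non M c"
  using coset_rep_eq_iff[OF left_module_loc submodule_non_loc, of M c x y] by simp

lemma rho_zero_iff:
  "kcm M \<Longrightarrow> c \<in> Obj C \<Longrightarrow> x \<in> carrier (val M c) \<Longrightarrow> rho M c x = \<zero>\<^bsub>spl M c\<^esub> \<longleftrightarrow> x \<in> non M c"
  using coset_rep_eq_zero_iff[OF left_module_loc submodule_non_loc, of M c x] by simp

text \<open>The link between the cosets in the definition of \<open>minsupp\<close> and the
  properness of \<open>non M c\<close>: an element outside \<open>non M c\<close> lies in its own
  coset, which therefore differs from the zero coset.\<close>

lemma minsuppI:
  assumes M: "kcm M" and c: "c \<in> Obj C" and ne: "non M c \<noteq> carrier (val M c)"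
  shows "cl C c \<in> minsupp K C M"
proof -
  obtain x where x: "x \<in> carrier (val M c)" "x \<notin> non M c" using non_carrier[OF M c] ne by auto
  interpret left_module K "val M c" by (rule kcm_val[OF M c])
  have "\<zero>\<^bsub>val M c\<^esub> \<in> non M c" using submodule_non[OF M c] by (simp add: submodule_iff)
  then have "x \<in> non M c +>\<^bsub>val M c\<^esub> x"
    using x by (auto simp: a_r_coset_def r_coset_def intro!: bexI[of _ "\<zero>\<^bsub>val M c\<^esub>"])
  then have "non M c +>\<^bsub>val M c\<^esub> x \<noteq> non M c" using x by auto
  moreover have "non M c +>\<^bsub>val M c\<^esub> x \<in> a_rcosets\<^bsub>val M c\<^esub> non M c"
    using x(1) by (auto simp: A_RCOSETS_def')
  ultimately have "carrier (split_quotient K C M c) \<noteq> {\<zero>\<^bsub>split_quotient K C M c\<^esub>}"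
    by (auto simp: split_quotient_def quotient_module_def)
  then show ?thesis using c by (auto simp: minsupp_def)
qed

end

section \<open>Cardinality of direct sums\<close>

lemma times_lepoll_infinite:
  assumes "infinite (UNIV :: 'u set)" "A \<lesssim> (UNIV :: 'u set)" "B \<lesssim> (UNIV :: 'u set)"
  shows "A \<times> B \<lesssim> (UNIV :: 'u set)"
proof -
  have "(UNIV :: 'u set) \<times> (UNIV :: 'u set) \<lesssim> (UNIV :: 'u set)"
    unfolding lepoll_def card_of_ordLeq
    using card_of_Times_same_infinite[OF assms(1)] ordIso_imp_ordLeq by blast
  then show ?thesis
    by (rule lepoll_trans[OF times_lepoll_mono[OF assms(2,3)]])
qed

text \<open>Lists of each fixed length embed by induction into the infinite type, and a countable
  union of such sets is no larger.\<close>

lemma lists_lepoll_infinite: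
  assumes inf: "infinite (UNIV :: 'u set)"
  shows "(UNIV :: 'u list set) \<lesssim> (UNIV :: 'u set)"
proof -
  have len: "{xs :: 'u list. length xs = n} \<lesssim> (UNIV :: 'u set)" for n
  proof (induction n)
    case 0
    then show ?case by (auto simp: lepoll_def)
  next
    case (Suc n)
    have "{xs :: 'u list. length xs = Suc n} \<lesssim> (UNIV :: 'u set) \<times> {xs :: 'u list. length xs = n}"
      by (rule subset_image_lepoll[of _ "\<lambda>(x, xs). x # xs"]) (force simp: length_Suc_conv)
    then show ?case
      by (rule lepoll_trans[OF _ times_lepoll_infinite[OF inf lepoll_refl Suc.IH]])
  qed
  have "(card_of (\<Union>n. {xs :: 'u list. length xs = n}), card_of (UNIV :: 'u set)) \<in> ordLeq"
  proof (rule card_of_UNION_ordLeq_infinite[OF inf])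
    show "(card_of (UNIV :: nat set), card_of (UNIV :: 'u set)) \<in> ordLeq" using inf by (simp add: infinite_iff_card_of_nat)
    show "\<forall>n\<in>UNIV. (card_of ({xs :: 'u list. length xs = n}), card_of (UNIV :: 'u set)) \<in> ordLeq"
      using len unfolding lepoll_def card_of_ordLeq by simp
  qed
  moreover have "(\<Union>n. {xs :: 'u list. length xs = n}) = UNIV" by auto
  ultimately show ?thesis unfolding lepoll_def card_of_ordLeq by simp
qed

text \<open>A finitely supported family is encoded by a list that enumerates its graph over the
  support; lists over an infinite type are no more numerous than the type.\<close>

lemma direct_sum_lepoll:
  assumes inf: "infinite (UNIV :: 'u set)" and I: "I \<lesssim> (UNIV :: 'u set)"
    and X: "\<And>i. i \<in> I \<Longrightarrow> carrier (X i) \<lesssim> (UNIV :: 'u set)"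
  shows "carrier (direct_sum I X) \<lesssim> (UNIV :: 'u set)"
proof -
  obtain \<phi> :: "_ \<Rightarrow> 'u" where \<phi>: "inj_on \<phi> I" using I by (auto simp: lepoll_def)
  have "\<exists>f :: _ \<Rightarrow> 'u. inj_on f (carrier (X i))" if "i \<in> I" for i
    using X[OF that] by (auto simp: lepoll_def)
  then obtain \<psi> :: "_ \<Rightarrow> _ \<Rightarrow> 'u" where \<psi>: "\<And>i. i \<in> I \<Longrightarrow> inj_on (\<psi> i) (carrier (X i))"
    by metis
  \<comment> \<open>The graph over the support, with indices and values both coded in
    \<open>'u\<close>. Coordinates missing from it are zero, so it determines the family.\<close>
  define S where "S = (\<lambda>x. (\<lambda>i. (\<phi> i, \<psi> i (x i))) ` {i \<in> I. x i \<noteq> \<zero>\<^bsub>X i\<^esub>})"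
  define L where "L = (\<lambda>x. SOME l. set l = S x)"
  have L: "set (L x) = S x" if "x \<in> carrier (direct_sum I X)" for x
  proof -
    have "finite (S x)" using that by (simp add: S_def)
    then show ?thesis unfolding L_def using finite_list someI_ex[of "\<lambda>l. set l = S x"] by blast
  qed
  have "inj_on L (carrier (direct_sum I X))"
  proof (rule inj_onI)
    fix x y assume x: "x \<in> carrier (direct_sum I X)" and y: "y \<in> carrier (direct_sum I X)" and "L x = L y"
    then have S: "S x = S y" using L by metis
    have *: "x i = y i" if "i \<in> I" "x i \<noteq> \<zero>\<^bsub>X i\<^esub>" "S x = S y"
      "x \<in> carrier (direct_sum I X)" "y \<in> carrier (direct_sum I X)" for x y i
    proof -
      have "(\<phi> i, \<psi> i (x i)) \<in> S x" using that(1,2) by (auto simp: S_def)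
      then have "(\<phi> i, \<psi> i (x i)) \<in> S y" by (simp only: that(3))
      then obtain j where j: "j \<in> I" "\<phi> i = \<phi> j" "\<psi> i (x i) = \<psi> j (y j)" by (auto simp: S_def)
      then have "i = j" using \<phi> that(1) by (auto dest: inj_onD)
      then show ?thesis using j \<psi>[OF that(1)] that by (auto dest!: inj_onD simp: PiE_iff)
    qed
    show "x = y"
    proof (rule extensionalityI)
      show "x \<in> extensional I" "y \<in> extensional I" using x y by (auto simp: PiE_iff)
      show "x i = y i" if "i \<in> I" for i
        using *[OF that _ S x y] *[OF that _ S[symmetric] y x] by metis
    qed
  qed
  then have "carrier (direct_sum I X) \<lesssim> (UNIV :: ('u \<times> 'u) list set)"
    by (auto simp: lepoll_def)
  also have "(UNIV :: ('u \<times> 'u) list set) \<lesssim> (UNIV :: 'u list set)"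
  proof -
    obtain f :: "'u \<times> 'u \<Rightarrow> 'u" where "inj f"
      using times_lepoll_infinite[OF inf lepoll_refl lepoll_refl] by (auto simp: lepoll_def)
    then have "inj (map f)" by simp
    then show ?thesis by (auto simp: lepoll_def)
  qed
  also have "\<dots> \<lesssim> (UNIV :: 'u set)" by (rule lists_lepoll_infinite[OF inf])
  finally show ?thesis .
qed

lemma span_module_lepoll:
  assumes "infinite (UNIV :: 'u set)" "S \<lesssim> (UNIV :: 'u set)" "carrier R \<lesssim> (UNIV :: 'u set)"
  shows "carrier (span_module R S) \<lesssim> (UNIV :: 'u set)"
  unfolding span_module_def
  by (rule direct_sum_lepoll) (use assms in \<open>auto simp: regular_module_def\<close>)


section \<open>Free modules\<close>

lemma ds_single_lin:
  assumes R: "ring R" and X: "\<And>i. i \<in> I \<Longrightarrow> left_module R (X i)" and i: "i \<in> I"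
  shows "ds_single X I i \<in> lin_homs R (X i) (direct_sum I X)"
proof (rule lin_homsI)
  show "ds_single X I i a \<in> carrier (direct_sum I X)" if "a \<in> carrier (X i)" for a
    by (rule ds_single_closed[OF R X]) (use i that in auto)
  show "ds_single X I i (a \<oplus>\<^bsub>X i\<^esub> b) = ds_single X I i a \<oplus>\<^bsub>direct_sum I X\<^esub> ds_single X I i b" for a b
    using summand_zero_add[OF R, of I X] summand_zero[OF R, of I X] X by (auto simp: ds_single_def fun_eq_iff)
  show "ds_single X I i (r \<odot>\<^bsub>X i\<^esub> a) = r \<odot>\<^bsub>direct_sum I X\<^esub> ds_single X I i a" if "r \<in> carrier R" for r a
    using summand_smult_zero[OF R, of I X] X that by (auto simp: ds_single_def fun_eq_iff)
qed

lemma span_submodule_eq: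
  assumes R: "ring R" and H: "submodule H R (span_module R S)"
    and "\<And>s. s \<in> S \<Longrightarrow> delta R S s \<one>\<^bsub>R\<^esub> \<in> H"
  shows "H = carrier (span_module R S)"
proof -
  interpret R: ring R by (rule R)
  interpret left_module R "span_module R S" by (rule left_module_span[OF R])
  note H' = H[unfolded submodule_iff]
  have "x \<in> H" if "x \<in> carrier (span_module R S)" for x
    using that
  proof (induction rule: span_induct[OF R, consumes 1, case_names zero delta add])
    case (delta s r)
    have "delta R S s r = r \<odot>\<^bsub>span_module R S\<^esub> delta R S s \<one>\<^bsub>R\<^esub>"
      using delta by (auto simp: delta_def fun_eq_iff)
    then show ?case using H' assms(3)[OF delta(1)] delta(2) by metis
  qed (use H' in blast)+
  then show ?thesis using H' by blast
qed

lemma span_hom_eqI: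
  assumes R: "ring R" and N: "left_module R N"
    and f: "f \<in> lin_homs R (span_module R S) N" and g: "g \<in> lin_homs R (span_module R S) N"
    and eq: "\<And>s. s \<in> S \<Longrightarrow> f (delta R S s \<one>\<^bsub>R\<^esub>) = g (delta R S s \<one>\<^bsub>R\<^esub>)"
    and x: "x \<in> carrier (span_module R S)"
  shows "f x = g x"
proof -
  interpret R: ring R by (rule R)
  have "{x \<in> carrier (span_module R S). f x = g x} = carrier (span_module R S)"
    by (rule span_submodule_eq[OF R submodule_equalizer[OF left_module_span[OF R] N f g]])
      (use eq delta_closed[OF R _ R.one_closed] in \<open>auto simp del: span_module_simps\<close>)
  then show ?thesis using x by blast
qed

lemma representable_simps:
  "val (representable K C c) d = span_module K (homs C c d)"
  "act (representable K C c) u x = (\<lambda>w \<in> homs C c (Cod C u).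
      \<Oplus>\<^bsub>K\<^esub>v \<in> {v \<in> homs C c (Dom C u). x v \<noteq> \<zero>\<^bsub>K\<^esub> \<and> u \<diamondop>\<^bsub>C\<^esub> v = w}. x v)"
  by (simp_all add: representable_def)

lemma finsum_span_apply:
  assumes R: "ring R" and "finite A" "f \<in> A \<rightarrow> carrier (span_module R S)" "s \<in> S"
  shows "finsum (span_module R S) f A s = (\<Oplus>\<^bsub>R\<^esub>a\<in>A. f a s)"
proof -
  interpret R: ring R by (rule R)
  interpret M: left_module R "span_module R S" by (rule left_module_span[OF R])
  show ?thesis using assms(2,3)
  proof (induction A rule: finite_induct)
    case empty
    then show ?case using \<open>s \<in> S\<close> by simp
  next
    case (insert a A)
    have f: "f \<in> A \<rightarrow> carrier (span_module R S)" "f a \<in> carrier (span_module R S)"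
      using insert by (auto simp: Pi_iff)
    have "finsum (span_module R S) f (insert a A) =
        f a \<oplus>\<^bsub>span_module R S\<^esub> finsum (span_module R S) f A"
      by (rule M.M.finsum_insert[OF insert(1,2) f])
    moreover have "(\<Oplus>\<^bsub>R\<^esub>a\<in>insert a A. f a s) = f a s \<oplus>\<^bsub>R\<^esub> (\<Oplus>\<^bsub>R\<^esub>a\<in>A. f a s)"
      using f \<open>s \<in> S\<close> insert by (intro R.finsum_insert) (auto simp: Pi_iff PiE_iff)
    ultimately show ?case using insert.IH[OF f(1)] \<open>s \<in> S\<close> by simp
  qed
qed

section \<open>Representable functors, direct sums, and bases of modules over a category\<close>

context kc_setting
begin

interpretation K: cring K by (rule cring_K)

abbreviation "rep \<equiv> representable K C"

text \<open>The definition sums coefficients over the fibres of composition with \<open>u\<close>.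
  This is the linear extension of \<open>v\<close> to the point mass at the composite, a form from
  which linearity and functoriality follow without computing sums.\<close>

lemma representable_act:
  assumes u: "u \<in> homs C a b" and x: "x \<in> carrier (span_module K (homs C c a))"
  shows "act (rep c) u x =
    span_lift K (homs C c a) (span_module K (homs C c b)) (\<lambda>v. delta K (homs C c b) (u \<diamondop> v) \<one>\<^bsub>K\<^esub>) x"
    (is "_ = span_lift K ?S ?N ?y x")
proof (rule extensionalityI[of _ "homs C c b"])
  interpret N: left_module K ?N by (rule left_module_span[OF K.ring_axioms])
  have y: "?y v \<in> carrier ?N" if "v \<in> ?S" for v
    using delta_closed[OF K.ring_axioms Comp_closed[OF that u] K.one_closed] .
  note l = span_lift_lin[OF K.ring_axioms N.left_module_axioms y, of ?S]
  show "span_lift K ?S ?N ?y x \<in> extensional (homs C c b)"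
    using lin_homs_closed[OF l x] by (auto simp: PiE_iff)
  show "act (rep c) u x \<in> extensional (homs C c b)"
    using u by (simp add: representable_simps homs_def)
  fix w assume w: "w \<in> homs C c b"
  let ?A = "{v \<in> ?S. x v \<noteq> \<zero>\<^bsub>K\<^esub>}"
  have fin: "finite ?A" using x by simp
  have xK: "x v \<in> carrier K" if "v \<in> ?S" for v using x that by auto
  have ty: "(\<lambda>v. x v \<odot>\<^bsub>?N\<^esub> ?y v) \<in> ?A \<rightarrow> carrier ?N"
    using y xK N.smult_closed by (auto simp del: span_module_simps)
  have "span_lift K ?S ?N ?y x w = finsum ?N (\<lambda>v. x v \<odot>\<^bsub>?N\<^esub> ?y v) ?A w"
    by (simp add: span_lift_def ds_lift_def regular_module_def)
  also have "\<dots> = (\<Oplus>\<^bsub>K\<^esub>v\<in>?A. (x v \<odot>\<^bsub>?N\<^esub> ?y v) w)"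
    by (rule finsum_span_apply[OF K.ring_axioms fin ty w])
  also have "\<dots> = (\<Oplus>\<^bsub>K\<^esub>v\<in>{v \<in> ?S. x v \<noteq> \<zero>\<^bsub>K\<^esub> \<and> u \<diamondop> v = w}. x v)"
    by (rule K.add.finprod_mono_neutral_cong_right[OF fin])
      (use w xK in \<open>auto simp: delta_def\<close>)
  also have "\<dots> = act (rep c) u x w"
    using u w by (auto simp: representable_simps homs_def)
  finally show "act (rep c) u x w = span_lift K ?S ?N ?y x w" by simp
qed

lemma representable_act_lin:
  assumes u: "u \<in> homs C a b"
  shows "act (rep c) u \<in> lin_homs K (span_module K (homs C c a)) (span_module K (homs C c b))"
proof -
  have y: "delta K (homs C c b) (u \<diamondop> v) \<one>\<^bsub>K\<^esub> \<in> carrier (span_module K (homs C c b))" if "v \<in> homs C c a" for v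
    using delta_closed[OF K.ring_axioms Comp_closed[OF that u] K.one_closed] .
  show ?thesis
    by (rule lin_homs_cong[THEN iffD2, OF left_module_span[OF K.ring_axioms] representable_act[OF u]
          span_lift_lin[OF K.ring_axioms left_module_span[OF K.ring_axioms] y]])
qed

lemma representable_act_delta:
  assumes u: "u \<in> homs C a b" and v: "v \<in> homs C c a"
  shows "act (rep c) u (delta K (homs C c a) v \<one>\<^bsub>K\<^esub>) = delta K (homs C c b) (u \<diamondop> v) \<one>\<^bsub>K\<^esub>"
proof -
  have y: "delta K (homs C c b) (u \<diamondop> v) \<one>\<^bsub>K\<^esub> \<in> carrier (span_module K (homs C c b))" if "v \<in> homs C c a" for v
    using delta_closed[OF K.ring_axioms Comp_closed[OF that u] K.one_closed] .
  interpret N: left_module K "span_module K (homs C c b)" by (rule left_module_span[OF K.ring_axioms])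
  show ?thesis
    using representable_act[OF u delta_closed[OF K.ring_axioms v K.one_closed]]
      span_lift_delta[OF K.ring_axioms N.left_module_axioms y v K.one_closed] N.smult_one[OF y[OF v]] by simp
qed

lemma kcm_representable: "kcm (rep c)"
  unfolding kcm_iff representable_simps(1)
proof (intro conjI ballI allI)
  note S = left_module_span[OF K.ring_axioms] and eqI = span_hom_eqI[OF K.ring_axioms left_module_span[OF K.ring_axioms]]
  show "left_module K (span_module K (homs C c d))" for d by (rule S)
  show "act (rep c) (Id C d) x = x" if d: "d \<in> Obj C" and x: "x \<in> carrier (span_module K (homs C c d))" for d x
    by (rule eqI[OF representable_act_lin[OF Id_closed[OF d]] _ _ x])
      (use d in \<open>auto simp: representable_act_delta[OF Id_closed[OF d]] Comp_Id_left lin_homs_def\<close>)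
  fix a b u assume u: "u \<in> homs C a b"
  show "act (rep c) u \<in> lin_homs K (span_module K (homs C c a)) (span_module K (homs C c b))"
    by (rule representable_act_lin[OF u])
  fix d v x assume v: "v \<in> homs C b d" and x: "x \<in> carrier (span_module K (homs C c a))"
  show "act (rep c) (v \<diamondop> u) x = act (rep c) v (act (rep c) u x)"
    by (rule eqI[OF representable_act_lin[OF Comp_closed[OF u v]]
          lin_homs_compose[OF representable_act_lin[OF u] representable_act_lin[OF v]] _ x])
      (simp add: representable_act_delta[OF u] representable_act_delta[OF v]
        representable_act_delta[OF Comp_closed[OF u v]] Comp_closed[OF _ u] Comp_assoc[OF _ u v])
qed

lemma kc_direct_sum_simps:
  "val (kc_direct_sum I X) d = direct_sum I (\<lambda>i. val (X i) d)"
  "act (kc_direct_sum I X) u x = (\<lambda>i\<in>I. act (X i) u (x i))"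
  by (simp_all add: kc_direct_sum_def)

lemma kcm_direct_sum:
  assumes X: "\<And>i. i \<in> I \<Longrightarrow> kcm (X i)"
  shows "kcm (kc_direct_sum I X)"
  unfolding kcm_iff kc_direct_sum_simps(1)
proof (intro conjI ballI allI)
  note V = kcm_val[OF X]
  show "left_module K (direct_sum I (\<lambda>i. val (X i) d))" if "d \<in> Obj C" for d
    by (rule left_module_direct_sum[OF K.ring_axioms V[OF _ that]])
  show "act (kc_direct_sum I X) (Id C d) x = x"
    if "d \<in> Obj C" "x \<in> carrier (direct_sum I (\<lambda>i. val (X i) d))" for d x
    using that kcm_id[OF X] by (auto simp: kc_direct_sum_simps(2) fun_eq_iff PiE_iff extensional_def)
  fix a b u assume u: "u \<in> homs C a b"
  have ab: "a \<in> Obj C" "b \<in> Obj C" using homs_Obj[OF u] by auto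
  note A = kcm_act[OF X u]
  show "act (kc_direct_sum I X) u \<in> lin_homs K (direct_sum I (\<lambda>i. val (X i) a)) (direct_sum I (\<lambda>i. val (X i) b))"
  proof (rule lin_homsI; (unfold kc_direct_sum_simps(2))?)
    fix x assume x: "x \<in> carrier (direct_sum I (\<lambda>i. val (X i) a))"
    have "{i \<in> I. act (X i) u (x i) \<noteq> \<zero>\<^bsub>val (X i) b\<^esub>} \<subseteq> {i \<in> I. x i \<noteq> \<zero>\<^bsub>val (X i) a\<^esub>}"
      using kcm_act_zero[OF X u] by auto
    then show "(\<lambda>i\<in>I. act (X i) u (x i)) \<in> carrier (direct_sum I (\<lambda>i. val (X i) b))"
      using x lin_homs_closed[OF A] by (auto simp: PiE_iff cong: conj_cong intro: finite_subset)
    show "(\<lambda>i\<in>I. act (X i) u ((r \<odot>\<^bsub>direct_sum I (\<lambda>i. val (X i) a)\<^esub> x) i)) =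
        r \<odot>\<^bsub>direct_sum I (\<lambda>i. val (X i) b)\<^esub> (\<lambda>i\<in>I. act (X i) u (x i))" if "r \<in> carrier K" for r
      using x that lin_homs_smult[OF A] by (auto simp: fun_eq_iff PiE_iff)
    fix y assume y: "y \<in> carrier (direct_sum I (\<lambda>i. val (X i) a))"
    show "(\<lambda>i\<in>I. act (X i) u ((x \<oplus>\<^bsub>direct_sum I (\<lambda>i. val (X i) a)\<^esub> y) i)) =
        (\<lambda>i\<in>I. act (X i) u (x i)) \<oplus>\<^bsub>direct_sum I (\<lambda>i. val (X i) b)\<^esub> (\<lambda>i\<in>I. act (X i) u (y i))"
      using x y lin_homs_add[OF A] by (auto simp: fun_eq_iff PiE_iff)
  qed
  show "act (kc_direct_sum I X) (v \<diamondop> u) x = act (kc_direct_sum I X) v (act (kc_direct_sum I X) u x)"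
    if "v \<in> homs C b c" "x \<in> carrier (direct_sum I (\<lambda>i. val (X i) a))" for c v x
    using that kcm_comp[OF X u] by (auto simp: kc_direct_sum_simps(2) fun_eq_iff PiE_iff)
qed

text \<open>The lifting property is restricted to modules in a type fixed by the first argument, because a
  definition in HOL cannot quantify over all types of coefficients.\<close>

definition kc_basis ::
  "'n itself \<Rightarrow> ('o, 'm, 'k, 'a) kc_module \<Rightarrow> 'i set \<Rightarrow> ('i \<Rightarrow> 'o) \<Rightarrow> ('i \<Rightarrow> 'a) \<Rightarrow> bool" where
  "kc_basis _ F I ob g \<longleftrightarrow> kcm F \<and>
    (\<forall>i \<in> I. ob i \<in> Obj C \<and> g i \<in> carrier (val F (ob i))) \<and>
    (\<forall>d \<in> Obj C. \<forall>H. submodule H K (val F d) \<and>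
      (\<forall>i \<in> I. \<forall>v \<in> homs C (ob i) d. act F v (g i) \<in> H) \<longrightarrow> H = carrier (val F d)) \<and>
    (\<forall>d \<in> Obj C. \<forall>(N :: ('k, 'n) module) y. left_module K N \<and>
      (\<forall>i \<in> I. \<forall>v \<in> homs C (ob i) d. y i v \<in> carrier N) \<longrightarrow>
      (\<exists>h \<in> lin_homs K (val F d) N. \<forall>i \<in> I. \<forall>v \<in> homs C (ob i) d. h (act F v (g i)) = y i v))"

lemma kc_basisD:
  fixes F :: "('o, 'm, 'k, 'a) kc_module"
  assumes "kc_basis TYPE('n) F I ob g"
  shows kc_basis_kcm: "kcm F"
    and kc_basis_ob: "i \<in> I \<Longrightarrow> ob i \<in> Obj C"
    and kc_basis_gen: "i \<in> I \<Longrightarrow> g i \<in> carrier (val F (ob i))"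
    and kc_basis_span: "d \<in> Obj C \<Longrightarrow> submodule H K (val F d) \<Longrightarrow>
      (\<And>i v. i \<in> I \<Longrightarrow> v \<in> homs C (ob i) d \<Longrightarrow> act F v (g i) \<in> H) \<Longrightarrow> H = carrier (val F d)"
    and kc_basis_lift: "d \<in> Obj C \<Longrightarrow> left_module K (N :: ('k, 'n) module) \<Longrightarrow>
      (\<And>i v. i \<in> I \<Longrightarrow> v \<in> homs C (ob i) d \<Longrightarrow> y i v \<in> carrier N) \<Longrightarrow>
      \<exists>h \<in> lin_homs K (val F d) N. \<forall>i \<in> I. \<forall>v \<in> homs C (ob i) d. h (act F v (g i)) = y i v"
  using assms unfolding kc_basis_def by simp_all

lemma kc_basis_hom_eqI:
  assumes F: "kc_basis TYPE('n) F I ob g" and d: "d \<in> Obj C" and N: "left_module K N"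
    and f: "f \<in> lin_homs K (val F d) N" and h: "h \<in> lin_homs K (val F d) N"
    and eq: "\<And>i v. i \<in> I \<Longrightarrow> v \<in> homs C (ob i) d \<Longrightarrow> f (act F v (g i)) = h (act F v (g i))"
    and x: "x \<in> carrier (val F d)"
  shows "f x = h x"
proof -
  note kcm = kc_basis_kcm[OF F]
  have "{x \<in> carrier (val F d). f x = h x} = carrier (val F d)"
    by (rule kc_basis_span[OF F d submodule_equalizer[OF kcm_val[OF kcm d] N f h]])
      (use eq kcm_act_closed[OF kcm] kc_basis_gen[OF F] in auto)
  then show ?thesis using x by blast
qed

text \<open>At each object \<open>d\<close> the elements \<open>act F v (g i)\<close> form a
  \<open>K\<close>-basis, so \<open>f d\<close> can be chosen separately for each \<open>d\<close>
  by linear extension. Naturality is then an equality of two \<open>K\<close>-linear maps on that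
  basis.\<close>

lemma kc_basis_universal:
  fixes N :: "('o, 'm, 'k, 'n) kc_module"
  assumes F: "kc_basis TYPE('n) F I ob g" and N: "kcm N" and y: "\<And>i. i \<in> I \<Longrightarrow> y i \<in> carrier (val N (ob i))"
  obtains f where "kc_hom K C F N f"
    "\<And>i d v. i \<in> I \<Longrightarrow> v \<in> homs C (ob i) d \<Longrightarrow> f d (act F v (g i)) = act N v (y i)"
    "\<And>i. i \<in> I \<Longrightarrow> f (ob i) (g i) = y i"
proof -
  note kF = kc_basis_kcm[OF F]
  have "\<exists>h \<in> lin_homs K (val F d) (val N d). \<forall>i \<in> I. \<forall>v \<in> homs C (ob i) d.
      h (act F v (g i)) = act N v (y i)" if d: "d \<in> Obj C" for d
    by (rule kc_basis_lift[OF F d kcm_val[OF N d]]) (rule kcm_act_closed[OF N _ y])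
  then have "\<forall>d. \<exists>h. d \<in> Obj C \<longrightarrow> h \<in> lin_homs K (val F d) (val N d) \<and> (\<forall>i \<in> I. \<forall>v \<in> homs C (ob i) d.
      h (act F v (g i)) = act N v (y i))" by blast
  from choice[OF this] obtain f where lin: "\<And>d. d \<in> Obj C \<Longrightarrow> f d \<in> lin_homs K (val F d) (val N d)"
    and fv: "\<And>d i v. d \<in> Obj C \<Longrightarrow> i \<in> I \<Longrightarrow> v \<in> homs C (ob i) d \<Longrightarrow> f d (act F v (g i)) = act N v (y i)"
    by blast
  have fv': "f d (act F v (g i)) = act N v (y i)" if "i \<in> I" "v \<in> homs C (ob i) d" for i d v
    using fv that homs_Obj by blast
  have nat: "f b (act F u x) = act N u (f a x)" if u: "u \<in> homs C a b" and x: "x \<in> carrier (val F a)" for a b u x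
  proof -
    have ab: "a \<in> Obj C" "b \<in> Obj C" using homs_Obj[OF u] by auto
    show ?thesis
    proof (rule kc_basis_hom_eqI[OF F ab(1) kcm_val[OF N ab(2)] lin_homs_compose[OF kcm_act[OF kF u] lin[OF ab(2)]]
          lin_homs_compose[OF lin[OF ab(1)] kcm_act[OF N u]] _ x])
      fix i v assume *: "i \<in> I" "v \<in> homs C (ob i) a"
      have "f b (act F u (act F v (g i))) = f b (act F (u \<diamondop> v) (g i))"
        using kcm_comp[OF kF *(2) u kc_basis_gen[OF F *(1)]] by simp
      also have "\<dots> = act N (u \<diamondop> v) (y i)" by (rule fv'[OF *(1) Comp_closed[OF *(2) u]])
      also have "\<dots> = act N u (act N v (y i))" by (rule kcm_comp[OF N *(2) u y[OF *(1)]])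
      finally show "f b (act F u (act F v (g i))) = act N u (f a (act F v (g i)))"
        by (simp add: fv'[OF *])
    qed
  qed
  show thesis
  proof
    show "kc_hom K C F N f" unfolding kc_hom_def using lin nat by blast
    show "f d (act F v (g i)) = act N v (y i)" if "i \<in> I" "v \<in> homs C (ob i) d" for i d v
      by (rule fv'[OF that])
    show "f (ob i) (g i) = y i" if "i \<in> I" for i
      using fv'[OF that Id_closed[OF kc_basis_ob[OF F that]]] kcm_id[OF kF kc_basis_ob[OF F that] kc_basis_gen[OF F that]]
        kcm_id[OF N kc_basis_ob[OF F that] y[OF that]] by simp
  qed
qed

text \<open>The Yoneda generator: the identity of the object \<open>fst i\<close>, placed in the
  summand with index \<open>i\<close>.\<close>

definition free_gen :: "('o \<Rightarrow> 'b set) \<Rightarrow> 'o \<times> 'b \<Rightarrow> 'o \<times> 'b \<Rightarrow> 'm \<Rightarrow> 'k" where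
  "free_gen B i = ds_single (\<lambda>j. span_module K (homs C (fst j) (fst i))) (Sigma (Obj C) B) i
     (delta K (homs C (fst i) (fst i)) (Id C (fst i)) \<one>\<^bsub>K\<^esub>)"

lemma free_on_simps:
  "free_on K C B = kc_direct_sum (Sigma (Obj C) B) (\<lambda>i. rep (fst i))"
  by (simp add: free_on_def case_prod_unfold)

text \<open>At \<open>d\<close> the free module is a direct sum of spans of hom-sets, and the images
  of the Yoneda generators are exactly the point masses of these spans. Spanning and lifting are
  thus those of direct sums and spans.\<close>

lemma free_on_basis: "kc_basis TYPE('n) (free_on K C B) (Sigma (Obj C) B) fst (free_gen B)"
proof -
  let ?I = "Sigma (Obj C) B" and ?F = "free_on K C B"
  let ?X = "\<lambda>d j. span_module K (homs C (fst j) d)"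
  have kF: "kcm ?F" unfolding free_on_simps by (rule kcm_direct_sum[OF kcm_representable])
  have val: "val ?F d = direct_sum ?I (?X d)" for d
    by (simp add: free_on_simps kc_direct_sum_simps representable_simps)
  have X: "left_module K (?X d j)" for d j by (rule left_module_span[OF K.ring_axioms])
  have dl: "delta K (homs C c d) v \<one>\<^bsub>K\<^esub> \<in> carrier (span_module K (homs C c d))" if "v \<in> homs C c d" for c d v
    by (rule delta_closed[OF K.ring_axioms that K.one_closed])
  have gen: "free_gen B i \<in> carrier (val ?F (fst i))" if "i \<in> ?I" for i
    unfolding val free_gen_def
    by (rule ds_single_closed[OF K.ring_axioms X that dl[OF Id_closed]]) (use that in auto)
  \<comment> \<open>Pushing the identity along \<open>v\<close> produces \<open>v\<close>; in the
    other summands zero goes to zero.\<close>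
  have act: "act ?F v (free_gen B i) = ds_single (?X d) ?I i (delta K (homs C (fst i) d) v \<one>\<^bsub>K\<^esub>)"
    if i: "i \<in> ?I" and v: "v \<in> homs C (fst i) d" for i v d
  proof -
    have "fst i \<in> Obj C" using i by auto
    have "act (rep (fst j)) v (ds_single (?X (fst i)) ?I i (delta K (homs C (fst i) (fst i)) (Id C (fst i)) \<one>\<^bsub>K\<^esub>) j) =
      ds_single (?X d) ?I i (delta K (homs C (fst i) d) v \<one>\<^bsub>K\<^esub>) j" if "j \<in> ?I" for j
    proof (cases "j = i")
      case True
      then show ?thesis
        using that representable_act_delta[OF v Id_closed[OF \<open>fst i \<in> Obj C\<close>]] Comp_Id_right[OF v]
        by (simp add: ds_single_def)
    next
      case False
      then show ?thesis
        using that kcm_act_zero[OF kcm_representable[of "fst j"] v] unfolding representable_simps(1)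
        by (simp add: ds_single_def)
    qed
    note eq = this
    show ?thesis
      unfolding free_on_simps kc_direct_sum_simps free_gen_def
    proof (rule extensionalityI)
      show "ds_single (?X d) ?I i (delta K (homs C (fst i) d) v \<one>\<^bsub>K\<^esub>) \<in> extensional ?I"
        by (simp add: ds_single_def)
    qed (simp_all only: restrict_extensional restrict_apply' eq)
  qed
  show ?thesis
    unfolding kc_basis_def
  proof (intro conjI ballI allI impI; (elim conjE)?)
    fix d H assume d: "d \<in> Obj C" and H: "submodule H K (val ?F d)"
      and gens: "\<forall>i\<in>?I. \<forall>v\<in>homs C (fst i) d. act ?F v (free_gen B i) \<in> H"
    interpret V: left_module K "val ?F d" by (rule kcm_val[OF kF d])
    have single: "ds_single (?X d) ?I i a \<in> H" if i: "i \<in> ?I" and a: "a \<in> carrier (?X d i)" for i a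
    proof -
      have "{a \<in> carrier (?X d i). ds_single (?X d) ?I i a \<in> H} = carrier (?X d i)"
      proof (rule span_submodule_eq[OF K.ring_axioms])
        show "submodule {a \<in> carrier (?X d i). ds_single (?X d) ?I i a \<in> H} K (?X d i)"
          by (rule submodule_vimage[OF X left_module_direct_sum[OF K.ring_axioms X]
                ds_single_lin[OF K.ring_axioms X i] H[unfolded val]])
        fix v assume v: "v \<in> homs C (fst i) d"
        then show "delta K (homs C (fst i) d) v \<one>\<^bsub>K\<^esub> \<in> {a \<in> carrier (?X d i). ds_single (?X d) ?I i a \<in> H}"
        proof -
          have "act ?F v (free_gen B i) \<in> H" using gens i v by blast
          then show ?thesis unfolding act[OF i v] using dl[OF v] by blast
        qed
      qed
      then show ?thesis using a by blast
    qed
    have "x \<in> H" if "x \<in> carrier (direct_sum ?I (?X d))" for x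
      using that
    proof (induction rule: direct_sum_induct[OF K.ring_axioms X, consumes 1, case_names zero single add])
      case (single i a) then show ?case by (rule \<open>\<And>a i. i \<in> ?I \<Longrightarrow> a \<in> carrier (?X d i) \<Longrightarrow> ds_single (?X d) ?I i a \<in> H\<close>)
    qed (use H[unfolded V.submodule_iff] in \<open>auto simp: val simp del: direct_sum_simps\<close>)
    then show "H = carrier (val ?F d)"
      using H[unfolded V.submodule_iff] unfolding val by blast
  next
    fix d and N :: "('k, 'n) module" and y
    assume d: "d \<in> Obj C" and N: "left_module K N"
      and y: "\<forall>i \<in> ?I. \<forall>v \<in> homs C (fst i) d. y i v \<in> carrier N"
    interpret N: left_module K N by (rule N)
    let ?l = "\<lambda>i. span_lift K (homs C (fst i) d) N (y i)"
    have l: "?l i \<in> lin_homs K (?X d i) N" if "i \<in> ?I" for i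
      by (rule span_lift_lin[OF K.ring_axioms N]) (use y that in blast)
    show "\<exists>h \<in> lin_homs K (val ?F d) N. \<forall>i \<in> ?I. \<forall>v \<in> homs C (fst i) d. h (act ?F v (free_gen B i)) = y i v"
    proof (intro bexI ballI)
      show "ds_lift (?X d) ?I N ?l \<in> lin_homs K (val ?F d) N"
        unfolding val by (rule ds_lift_lin[OF K.ring_axioms X N l])
      fix i v assume i: "i \<in> ?I" and v: "v \<in> homs C (fst i) d"
      have "ds_lift (?X d) ?I N ?l (act ?F v (free_gen B i)) = ?l i (delta K (homs C (fst i) d) v \<one>\<^bsub>K\<^esub>)"
        unfolding act[OF i v] by (rule ds_lift_single[OF K.ring_axioms X N]) (rule l i dl[OF v]; assumption?)+
      also have "\<dots> = \<one>\<^bsub>K\<^esub> \<odot>\<^bsub>N\<^esub> y i v"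
        by (rule span_lift_delta[OF K.ring_axioms N _ v K.one_closed]) (use y i in blast)
      also have "\<dots> = y i v" using y i v N.smult_one by blast
      finally show "ds_lift (?X d) ?I N ?l (act ?F v (free_gen B i)) = y i v" .
    qed
  qed (use kF gen in auto)
qed

text \<open>Identities embed the objects into the morphisms, so a bound on morphisms also bounds the
  index set of a free module.\<close>

lemma Obj_lepoll:
  assumes "Mor C \<lesssim> A" shows "Obj C \<lesssim> A"
proof -
  have "inj_on (Id C) (Obj C)"
  proof (rule inj_onI)
    fix a b assume "a \<in> Obj C" "b \<in> Obj C" "Id C a = Id C b"
    then show "a = b" using Id_closed[of a] Id_closed[of b] by (simp add: homs_def)
  qed
  moreover have "Id C ` Obj C \<subseteq> Mor C" using Id_closed by (auto simp: homs_def)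
  ultimately have "Obj C \<lesssim> Mor C" by (auto simp: lepoll_def)
  then show ?thesis by (rule lepoll_trans[OF _ assms])
qed

lemma free_on_lepoll:
  fixes B :: "'o \<Rightarrow> 'u set"
  assumes inf: "infinite (UNIV :: 'u set)" and "carrier K \<lesssim> (UNIV :: 'u set)" and Mor: "Mor C \<lesssim> (UNIV :: 'u set)"
  shows "carrier (val (free_on K C B) d) \<lesssim> (UNIV :: 'u set)"
proof -
  have "homs C c d \<lesssim> (UNIV :: 'u set)" for c
    by (rule lepoll_trans[OF subset_imp_lepoll Mor]) (auto simp: homs_def)
  moreover have "Sigma (Obj C) B \<lesssim> (UNIV :: 'u set)"
  proof -
    have "Sigma (Obj C) B \<lesssim> Obj C \<times> (UNIV :: 'u set)" by (rule subset_imp_lepoll) auto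
    then show ?thesis
      by (rule lepoll_trans[OF _ times_lepoll_infinite[OF inf Obj_lepoll[OF Mor] lepoll_refl]])
  qed
  ultimately show ?thesis
    unfolding free_on_simps kc_direct_sum_simps representable_simps
    using assms by (intro direct_sum_lepoll span_module_lepoll)
qed

text \<open>A copy of the free module with carriers in \<open>'u\<close>. The isomorphism
  \<open>\<phi>\<close> is kept, because \<open>free_kc_module\<close> asks for a bijection from
  \<open>free_on\<close> itself.\<close>

lemma free_in_universe:
  fixes B :: "'o \<Rightarrow> 'u set"
  assumes inf: "infinite (UNIV :: 'u set)" and "carrier K \<lesssim> (UNIV :: 'u set)" and "Mor C \<lesssim> (UNIV :: 'u set)"
  obtains F :: "('o, 'm, 'k, 'u) kc_module" and \<phi> and g
  where "kc_basis TYPE('u) F (Sigma (Obj C) B) fst g"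
    "kc_hom K C (free_on K C B) F \<phi>"
    "\<And>d. d \<in> Obj C \<Longrightarrow> bij_betw (\<phi> d) (carrier (val (free_on K C B) d)) (carrier (val F d))"
proof -
  let ?F = "free_on K C B" and ?I = "Sigma (Obj C) B"
  note base = free_on_basis[of B, where 'n = 'u]
  note kF = kc_basis_kcm[OF base]
  have "\<exists>f. inj_on f (carrier (val ?F d)) \<and> range f \<subseteq> (UNIV :: 'u set)" for d
    using free_on_lepoll[OF assms, of B d] by (auto simp: lepoll_def)
  then obtain \<phi> :: "'o \<Rightarrow> _ \<Rightarrow> 'u" where inj: "\<And>d. inj_on (\<phi> d) (carrier (val ?F d))"
    by metis
  define F where "F = \<lparr>val = \<lambda>d. transport_module (\<phi> d) (val ?F d),
    act = \<lambda>u x. \<phi> (Cod C u) (act ?F u (inv_into (carrier (val ?F (Dom C u))) (\<phi> (Dom C u)) x))\<rparr>"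
  have lin: "\<phi> d \<in> lin_homs K (val ?F d) (val F d)" if "d \<in> Obj C" for d
    using transport_lin[OF kcm_val[OF kF that] inj] by (simp add: F_def)
  have surj: "\<phi> d ` carrier (val ?F d) = carrier (val F d)" for d
    by (simp add: F_def transport_module_def)
  have nat: "act F u (\<phi> a x) = \<phi> b (act ?F u x)" if "u \<in> homs C a b" "x \<in> carrier (val ?F a)" for a b u x
    using that inj by (auto simp: F_def homs_def)
  have zero: "\<phi> d \<zero>\<^bsub>val ?F d\<^esub> = \<zero>\<^bsub>val F d\<^esub>" for d by (simp add: F_def transport_module_def)
  have F: "kcm F" "kc_hom K C ?F F \<phi>"
    using kcm_surj_image[OF kF, of \<phi> F] surj zero nat lin_homs_add[OF lin] lin_homs_smult[OF lin] by auto
  let ?g = "\<lambda>i. \<phi> (fst i) (free_gen B i)"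
  have gact: "act F v (?g i) = \<phi> d (act ?F v (free_gen B i))" if "i \<in> ?I" "v \<in> homs C (fst i) d" for i v d
    by (rule nat[OF that(2) kc_basis_gen[OF base that(1)]])
  have "kc_basis TYPE('u) F ?I fst ?g"
    unfolding kc_basis_def
  proof (intro conjI ballI allI impI; (elim conjE)?)
    show "?g i \<in> carrier (val F (fst i))" if "i \<in> ?I" for i
      using kc_basis_gen[OF base that] surj by blast
    fix d assume d: "d \<in> Obj C"
    note l = kcm_val[OF kF d] kcm_val[OF F(1) d] lin[OF d]
    fix H assume H: "submodule H K (val F d)" "\<forall>i\<in>?I. \<forall>v\<in>homs C (fst i) d. act F v (?g i) \<in> H"
    have "{x \<in> carrier (val ?F d). \<phi> d x \<in> H} = carrier (val ?F d)"
    proof (rule kc_basis_span[OF base d submodule_vimage[OF l H(1)]])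
      fix i v assume iv: "i \<in> ?I" "v \<in> homs C (fst i) d"
      show "act ?F v (free_gen B i) \<in> {x \<in> carrier (val ?F d). \<phi> d x \<in> H}"
      proof -
        have "act F v (?g i) \<in> H" using H(2) iv by blast
        then show ?thesis
          unfolding gact[OF iv] using kcm_act_closed[OF kF iv(2) kc_basis_gen[OF base iv(1)]] by blast
      qed
    qed
    then have "carrier (val F d) \<subseteq> H" unfolding surj[symmetric] by blast
    moreover have "H \<subseteq> carrier (val F d)" using H(1) by (simp add: left_module.submodule_iff[OF l(2)])
    ultimately show "H = carrier (val F d)" by blast
  next
    fix d and N :: "('k, 'u) module" and y
    assume d: "d \<in> Obj C" and N: "left_module K N" and y: "\<forall>i \<in> ?I. \<forall>v \<in> homs C (fst i) d. y i v \<in> carrier N"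
    obtain h where h: "h \<in> lin_homs K (val ?F d) N"
      "\<forall>i \<in> ?I. \<forall>v \<in> homs C (fst i) d. h (act ?F v (free_gen B i)) = y i v"
      using kc_basis_lift[OF base d N, of y] y by blast
    let ?i = "inv_into (carrier (val ?F d)) (\<phi> d)"
    have i: "?i \<in> lin_homs K (val F d) (val ?F d)"
      using transport_inv_lin[OF kcm_val[OF kF d] inj] by (simp add: F_def)
    show "\<exists>h \<in> lin_homs K (val F d) N. \<forall>i \<in> ?I. \<forall>v \<in> homs C (fst i) d. h (act F v (?g i)) = y i v"
    proof (intro bexI ballI)
      show "(\<lambda>x. h (?i x)) \<in> lin_homs K (val F d) N" by (rule lin_homs_compose[OF i h(1)])
      fix i v assume iv: "i \<in> ?I" "v \<in> homs C (fst i) d"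
      show "h (?i (act F v (?g i))) = y i v"
        using h(2) iv kcm_act_closed[OF kF iv(2) kc_basis_gen[OF base iv(1)]]
        by (simp only: gact[OF iv] inv_into_f_f[OF inj])
    qed
  qed (use F in auto)
  then show thesis
    using that F(2) inj surj unfolding bij_betw_def by blast
qed

end

lemma lin_homs_diff:
  assumes M: "left_module R M" and N: "left_module R N" and f: "f \<in> lin_homs R M N" and g: "g \<in> lin_homs R M N"
  shows "(\<lambda>x. f x \<ominus>\<^bsub>N\<^esub> g x) \<in> lin_homs R M N"
proof (rule lin_homsI)
  interpret N: left_module R N by (rule N)
  fix x assume x: "x \<in> carrier M"
  have cl: "f x \<in> carrier N" "g x \<in> carrier N" if "x \<in> carrier M" for x
    using that lin_homs_closed[OF f] lin_homs_closed[OF g] by auto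
  show "f x \<ominus>\<^bsub>N\<^esub> g x \<in> carrier N" using cl[OF x] by simp
  show "f (x \<oplus>\<^bsub>M\<^esub> y) \<ominus>\<^bsub>N\<^esub> g (x \<oplus>\<^bsub>M\<^esub> y) = (f x \<ominus>\<^bsub>N\<^esub> g x) \<oplus>\<^bsub>N\<^esub> (f y \<ominus>\<^bsub>N\<^esub> g y)" if y: "y \<in> carrier M" for y
    using cl[OF x] cl[OF y]
    by (simp add: lin_homs_add[OF f x y] lin_homs_add[OF g x y] a_minus_def N.M.minus_add N.M.a_ac)
  show "f (r \<odot>\<^bsub>M\<^esub> x) \<ominus>\<^bsub>N\<^esub> g (r \<odot>\<^bsub>M\<^esub> x) = r \<odot>\<^bsub>N\<^esub> (f x \<ominus>\<^bsub>N\<^esub> g x)" if r: "r \<in> carrier R" for r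
    using cl[OF x] r N.smult_assoc1[of r "\<ominus>\<^bsub>R\<^esub> \<one>\<^bsub>R\<^esub>" "g x"] N.smult_assoc1[of "\<ominus>\<^bsub>R\<^esub> \<one>\<^bsub>R\<^esub>" r "g x"]
    by (simp add: lin_homs_smult[OF f r x] lin_homs_smult[OF g r x] a_minus_def N.smult_r_distr
        N.smult_closed N.R.l_minus N.R.r_minus flip: N.smult_minus_one)
qed

section \<open>Projective covers\<close>

context kc_setting
begin

interpretation K: cring K by (rule cring_K)

lemma kc_submodule_trans:
  assumes F: "kcm F" and E: "kc_submodule K C F E" and L: "kc_submodule K C (restrict_kc F E) L"
  shows "kc_submodule K C F L"
  unfolding kc_submodule_iff
proof (intro conjI ballI allI)
  fix c assume c: "c \<in> Obj C"
  have *: "submodule (L c) K (val (restrict_kc F E) c)" using L c by (simp add: kc_submodule_iff)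
  show "submodule (L c) K (val F c)"
    using *[unfolded left_module.submodule_iff[OF kcm_val[OF kcm_restrict[OF F E] c]]]
      kc_submoduleD(1)[OF F E c]
    by (auto simp: left_module.submodule_iff[OF kcm_val[OF F c]])
next
  show "act F u ` L a \<subseteq> L b" if "u \<in> homs C a b" for a b u
    using L that by (simp add: kc_submodule_iff)
qed

lemma scalar_of_loc:
  assumes M: "kcm M" and c: "c \<in> Obj C" and h: "h \<in> lin_homs (R c) (loc M c) N"
  shows "h \<in> lin_homs K (val M c) (scalar_module K (aut_group C c) N)"
proof -
  note m = monoid_aut_group[OF c]
  note s = scalar_lin_homs[OF cring_K m left_module_loc[OF M c] h]
  show ?thesis
    using lin_homs_closed[OF s] lin_homs_add[OF s] lin_homs_smult[OF s]
    by (intro lin_homsI) (simp_all add: loc_scalar[OF M c, symmetric])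
qed

text \<open>The elements \<open>act F v (g i)\<close> generate already over \<open>K\<close>, so
  after restriction of scalars group ring linear maps are compared on them.\<close>

lemma loc_basis_eqI:
  fixes N :: "('m \<Rightarrow> 'k, 'n) module"
  assumes F: "kc_basis TYPE('b) F I ob g" and c: "c \<in> Obj C" and N: "left_module (R c) N"
    and f: "f \<in> lin_homs (R c) (loc F c) N" and h: "h \<in> lin_homs (R c) (loc F c) N"
    and eq: "\<And>i v. i \<in> I \<Longrightarrow> v \<in> homs C (ob i) c \<Longrightarrow> f (act F v (g i)) = h (act F v (g i))"
    and x: "x \<in> carrier (val F c)"
  shows "f x = h x"
proof -
  note kF = kc_basis_kcm[OF F]
  note s = left_module_scalar[OF cring_K monoid_aut_group[OF c] N]
  show ?thesis
    by (rule kc_basis_hom_eqI[OF F c s scalar_of_loc[OF kF c f] scalar_of_loc[OF kF c h] eq x])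
qed

lemma gd_smult_lin:
  assumes c: "c \<in> Obj C" and Q: "left_module (R c) Q" and v: "v \<in> homs C c c"
  shows "(\<lambda>x. gdl c v \<one>\<^bsub>K\<^esub> \<odot>\<^bsub>Q\<^esub> x) \<in> lin_homs K (scalar_module K (aut_group C c) Q) (scalar_module K (aut_group C c) Q)"
proof (rule lin_homsI)
  interpret Q: left_module "R c" Q by (rule Q)
  note g = gdl_closed[OF c v K.one_closed]
  have v': "v \<in> carrier (aut_group C c)" using v by (simp add: aut_group_simps[OF c])
  note gs = gd_smult[OF cring_K monoid_aut_group[OF c] Q v']
  fix x assume x: "x \<in> carrier (scalar_module K (aut_group C c) Q)"
  show "gdl c v \<one>\<^bsub>K\<^esub> \<odot>\<^bsub>Q\<^esub> x \<in> carrier (scalar_module K (aut_group C c) Q)"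
    using x Q.smult_closed[OF g] by simp
  show "gdl c v \<one>\<^bsub>K\<^esub> \<odot>\<^bsub>Q\<^esub> (r \<odot>\<^bsub>scalar_module K (aut_group C c) Q\<^esub> x) =
      r \<odot>\<^bsub>scalar_module K (aut_group C c) Q\<^esub> (gdl c v \<one>\<^bsub>K\<^esub> \<odot>\<^bsub>Q\<^esub> x)" if "r \<in> carrier K" for r
    using gs[OF that] x by simp
  show "gdl c v \<one>\<^bsub>K\<^esub> \<odot>\<^bsub>Q\<^esub> (x \<oplus>\<^bsub>scalar_module K (aut_group C c) Q\<^esub> y) =
      gdl c v \<one>\<^bsub>K\<^esub> \<odot>\<^bsub>Q\<^esub> x \<oplus>\<^bsub>scalar_module K (aut_group C c) Q\<^esub> gdl c v \<one>\<^bsub>K\<^esub> \<odot>\<^bsub>Q\<^esub> y"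
    if "y \<in> carrier (scalar_module K (aut_group C c) Q)" for y
    using Q.smult_r_distr[OF g] x that by simp
qed

end

text \<open>Of the family \<open>q\<close> only generation of the covers \<open>src (p c)\<close> is
  demanded. This lets three choices share the construction: all elements for perfect rings, finitely
  many for semi-perfect rings, a basis in the free case. \<open>D\<close> holds one object for each
  class with nonzero split quotient.\<close>

locale cover_data = kc_setting C K for C :: "('o, 'm) category" (structure) and K :: "'k ring" +
  fixes M F :: "('o, 'm, 'k, 'u) kc_module" and A :: "'o set set" and D :: "'o set"
    and B :: "'o \<Rightarrow> 'b set" and q :: "'o \<Rightarrow> 'b \<Rightarrow> 'u" and g :: "'o \<times> 'b \<Rightarrow> 'u"
    and p :: "'o \<Rightarrow> (('m \<Rightarrow> 'k, 'u) module, 'u \<Rightarrow> 'u) arrow"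
  assumes kM: "kcm M" and A: "artinian C A" "upper_set C A" "supp_in A M"
    and D: "D = {c \<in> Obj C. crep c = c \<and> non M c \<noteq> carrier (val M c)}"
    and B_empty: "c \<in> Obj C \<Longrightarrow> c \<notin> D \<Longrightarrow> B c = {}"
    and cover: "c \<in> D \<Longrightarrow> projective_cover (Mod_cat (R c)) (p c) (spl M c)"
    and q_closed: "c \<in> D \<Longrightarrow> b \<in> B c \<Longrightarrow> q c b \<in> carrier (src (p c))"
    and q_span: "c \<in> D \<Longrightarrow> submodule H (R c) (src (p c)) \<Longrightarrow> (\<And>b. b \<in> B c \<Longrightarrow> q c b \<in> H) \<Longrightarrow>
      H = carrier (src (p c))"
    and basis: "kc_basis TYPE('u) F (Sigma (Obj C) B) fst g"
begin

interpretation K: cring K by (rule cring_K)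

abbreviation "I \<equiv> Sigma (Obj C) B"
abbreviation "Q c \<equiv> src (p c)"
abbreviation "pc c \<equiv> fn (p c)"

lemma kF: "kcm F" by (rule kc_basis_kcm[OF basis])

lemma D_Obj: "c \<in> D \<Longrightarrow> c \<in> Obj C" using D by auto

lemma I_D: "i \<in> I \<Longrightarrow> fst i \<in> D" using B_empty by fastforce

lemma gen_closed: "i \<in> I \<Longrightarrow> g i \<in> carrier (val F (fst i))"
  by (rule kc_basis_gen[OF basis])

lemma act_gen_closed: "i \<in> I \<Longrightarrow> v \<in> homs C (fst i) d \<Longrightarrow> act F v (g i) \<in> carrier (val F d)"
  by (rule kcm_act_closed[OF kF _ gen_closed])

text \<open>Two fixed points of \<open>crep\<close> with morphisms in both directions coincide.
  Hence a generator placed at another object reaches \<open>c\<close> through non-isomorphisms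
  only.\<close>

lemma rep_noniso:
  assumes "i \<in> I" "c \<in> Obj C" "crep c = c" "fst i \<noteq> c" "v \<in> homs C (fst i) c"
  shows "homs C c (fst i) = {}"
  using crep_eqI[of "fst i" c] I_D[OF assms(1)] D assms by auto

lemma p_facts:
  assumes c: "c \<in> D"
  shows Q_module: "left_module (R c) (Q c)"
    and pc_lin: "pc c \<in> lin_homs (R c) (Q c) (spl M c)"
    and pc_surj: "pc c ` carrier (Q c) = carrier (spl M c)"
    and Q_projective: "projective (Mod_cat (R c)) (Q c)"
    and pc_superfluous: "submodule H (R c) (Q c) \<Longrightarrow> pc c ` H = carrier (spl M c) \<Longrightarrow> H = carrier (Q c)"
proof -
  note pc = cover[OF c, unfolded projective_cover_def]
  have t: "tgt (p c) = spl M c" using pc by simp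
  have "p c \<in> Mor (Mod_cat (R c))" using pc by simp
  then show "left_module (R c) (Q c)" "pc c \<in> lin_homs (R c) (Q c) (spl M c)"
    by (auto simp: Mod_cat_Mor t)
  show "projective (Mod_cat (R c)) (Q c)" using pc by simp
  have sup: "superfluous (Mod_cat (R c)) (p c)" using pc by simp
  then show "pc c ` carrier (Q c) = carrier (spl M c)"
    by (simp only: superfluous_def epic_Mod_cat_iff t)
  show "submodule H (R c) (Q c) \<Longrightarrow> pc c ` H = carrier (spl M c) \<Longrightarrow> H = carrier (Q c)"
    using superfluous_Mod_cat_submodule[OF sup] by (simp only: t)
qed

text \<open>The split quotient is carried by elements of \<open>val M c\<close>, so the image of a
  generator under the cover is its own lift to \<open>M\<close>.\<close>

definition y :: "'o \<times> 'b \<Rightarrow> 'u" where "y i = pc (fst i) (q (fst i) (snd i))"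

lemma y_facts:
  assumes i: "i \<in> I"
  shows y_closed: "y i \<in> carrier (val M (fst i))"
    and rho_y: "rho M (fst i) (y i) = y i"
proof -
  note c = I_D[OF i]
  have s: "y i \<in> carrier (spl M (fst i))"
    unfolding y_def using lin_homs_closed[OF pc_lin[OF c]] q_closed[OF c, of "snd i"] i by auto
  then obtain x where x: "x \<in> carrier (val M (fst i))" "y i = rho M (fst i) x" by auto
  note cr = coset_rep_closed[OF left_module_loc[OF kM D_Obj[OF c]] submodule_non_loc[OF kM D_Obj[OF c]], of x]
    and ci = coset_rep_idem[OF left_module_loc[OF kM D_Obj[OF c]] submodule_non_loc[OF kM D_Obj[OF c]], of x]
  show "y i \<in> carrier (val M (fst i))" "rho M (fst i) (y i) = y i" using x cr ci by auto
qed

definition f :: "'o \<Rightarrow> 'u \<Rightarrow> 'u" where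
  "f = (SOME f. kc_hom K C F M f \<and> (\<forall>i \<in> I. \<forall>d. \<forall>v \<in> homs C (fst i) d. f d (act F v (g i)) = act M v (y i)))"

lemma f_facts: "kc_hom K C F M f" "i \<in> I \<Longrightarrow> v \<in> homs C (fst i) d \<Longrightarrow> f d (act F v (g i)) = act M v (y i)"
proof -
  have "\<exists>f. kc_hom K C F M f \<and> (\<forall>i \<in> I. \<forall>d. \<forall>v \<in> homs C (fst i) d. f d (act F v (g i)) = act M v (y i))"
  proof (rule kc_basis_universal[OF basis kM y_closed])
    fix f' assume "kc_hom K C F M f'"
      and "\<And>i d v. i \<in> I \<Longrightarrow> v \<in> homs C (fst i) d \<Longrightarrow> f' d (act F v (g i)) = act M v (y i)"
    then show ?thesis by (intro exI[of _ f']) simp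
  qed
  from someI_ex[OF this] show "kc_hom K C F M f"
    "i \<in> I \<Longrightarrow> v \<in> homs C (fst i) d \<Longrightarrow> f d (act F v (g i)) = act M v (y i)"
    unfolding f_def[symmetric] by blast+
qed

text \<open>\<^term>\<open>tau c\<close> is the projection of \<^term>\<open>F\<close> at \<^term>\<open>c\<close> to the summand of automorphisms, followed by
  the map to \<^term>\<open>Q c\<close> given by the generators; \<^term>\<open>iota c\<close> is that projection, as an endomorphism.\<close>

definition tau :: "'o \<Rightarrow> 'u \<Rightarrow> 'u" where
  "tau c = (SOME h. h \<in> lin_homs K (val F c) (scalar_module K (aut_group C c) (Q c)) \<and>
     (\<forall>i \<in> I. \<forall>v \<in> homs C (fst i) c. h (act F v (g i)) =
       (if fst i = c then gdl c v \<one>\<^bsub>K\<^esub> \<odot>\<^bsub>Q c\<^esub> q c (snd i) else \<zero>\<^bsub>Q c\<^esub>)))"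

definition iota :: "'o \<Rightarrow> 'u \<Rightarrow> 'u" where
  "iota c = (SOME h. h \<in> lin_homs K (val F c) (val F c) \<and>
     (\<forall>i \<in> I. \<forall>v \<in> homs C (fst i) c. h (act F v (g i)) =
       (if fst i = c then act F v (g i) else \<zero>\<^bsub>val F c\<^esub>)))"

lemma tau_facts:
  assumes c: "c \<in> D"
  shows tau_K: "tau c \<in> lin_homs K (val F c) (scalar_module K (aut_group C c) (Q c))"
    and tau_gen: "i \<in> I \<Longrightarrow> v \<in> homs C (fst i) c \<Longrightarrow> tau c (act F v (g i)) =
       (if fst i = c then gdl c v \<one>\<^bsub>K\<^esub> \<odot>\<^bsub>Q c\<^esub> q c (snd i) else \<zero>\<^bsub>Q c\<^esub>)"
proof -
  interpret Q: left_module "R c" "Q c" by (rule Q_module[OF c])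
  let ?y = "\<lambda>i v. if fst i = c then gdl c v \<one>\<^bsub>K\<^esub> \<odot>\<^bsub>Q c\<^esub> q c (snd i) else \<zero>\<^bsub>Q c\<^esub>"
  have "?y i v \<in> carrier (scalar_module K (aut_group C c) (Q c))" if "i \<in> I" "v \<in> homs C (fst i) c" for i v
    using that Q.smult_closed[OF gdl_closed[OF D_Obj[OF c] _ K.one_closed] q_closed[OF c]] by auto
  then have "\<exists>h \<in> lin_homs K (val F c) (scalar_module K (aut_group C c) (Q c)).
      \<forall>i \<in> I. \<forall>v \<in> homs C (fst i) c. h (act F v (g i)) = ?y i v"
    by (rule kc_basis_lift[OF basis D_Obj[OF c] left_module_scalar[OF cring_K monoid_aut_group[OF D_Obj[OF c]] Q_module[OF c]]])
  then have "\<exists>h. h \<in> lin_homs K (val F c) (scalar_module K (aut_group C c) (Q c)) \<and>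
     (\<forall>i \<in> I. \<forall>v \<in> homs C (fst i) c. h (act F v (g i)) = ?y i v)" by blast
  from someI_ex[OF this] show "tau c \<in> lin_homs K (val F c) (scalar_module K (aut_group C c) (Q c))"
    "i \<in> I \<Longrightarrow> v \<in> homs C (fst i) c \<Longrightarrow> tau c (act F v (g i)) = ?y i v"
    unfolding tau_def[symmetric] by blast+
qed

lemma iota_facts:
  assumes c: "c \<in> Obj C"
  shows iota_K: "iota c \<in> lin_homs K (val F c) (val F c)"
    and iota_gen: "i \<in> I \<Longrightarrow> v \<in> homs C (fst i) c \<Longrightarrow> iota c (act F v (g i)) =
       (if fst i = c then act F v (g i) else \<zero>\<^bsub>val F c\<^esub>)"
proof -
  interpret V: left_module K "val F c" by (rule kcm_val[OF kF c])
  let ?y = "\<lambda>i v. if fst i = c then act F v (g i) else \<zero>\<^bsub>val F c\<^esub>"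
  have "?y i v \<in> carrier (val F c)" if "i \<in> I" "v \<in> homs C (fst i) c" for i v
    using act_gen_closed[OF that] by simp
  then have "\<exists>h \<in> lin_homs K (val F c) (val F c).
      \<forall>i \<in> I. \<forall>v \<in> homs C (fst i) c. h (act F v (g i)) = ?y i v"
    by (rule kc_basis_lift[OF basis c V.left_module_axioms])
  then have "\<exists>h. h \<in> lin_homs K (val F c) (val F c) \<and>
     (\<forall>i \<in> I. \<forall>v \<in> homs C (fst i) c. h (act F v (g i)) = ?y i v)" by blast
  from someI_ex[OF this] show "iota c \<in> lin_homs K (val F c) (val F c)"
    "i \<in> I \<Longrightarrow> v \<in> homs C (fst i) c \<Longrightarrow> iota c (act F v (g i)) = ?y i v"
    unfolding iota_def[symmetric] by blast+
qed

lemma act_act_gen: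
  "i \<in> I \<Longrightarrow> v \<in> homs C (fst i) c \<Longrightarrow> w \<in> homs C c d \<Longrightarrow> act F w (act F v (g i)) = act F (w \<diamondop> v) (g i)"
  using kcm_comp[OF kF _ _ gen_closed] by simp

text \<open>The lifting property provides \<open>tau\<close> as a \<open>K\<close>-linear map only.
  Equivariance is checked on basis elements: an automorphism of \<open>c\<close> composes with
  \<open>v\<close> and leaves the index \<open>i\<close>, hence the case distinction,
  unchanged.\<close>

lemma tau_lin:
  assumes c: "c \<in> D" shows "tau c \<in> lin_homs (R c) (loc F c) (Q c)"
proof (rule loc_lin_homsI[OF kF D_Obj[OF c] Q_module[OF c] tau_K[OF c]])
  note cO = D_Obj[OF c]
  interpret Q: left_module "R c" "Q c" by (rule Q_module[OF c])
  fix h x assume h: "h \<in> homs C c c" and x: "x \<in> carrier (val F c)"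
  note gl = gdl_closed[OF cO _ K.one_closed]
  show "tau c (act F h x) = gdl c h \<one>\<^bsub>K\<^esub> \<odot>\<^bsub>Q c\<^esub> tau c x"
  proof (rule kc_basis_hom_eqI[OF basis cO left_module_scalar[OF cring_K monoid_aut_group[OF cO] Q_module[OF c]]
        lin_homs_compose[OF kcm_act[OF kF h] tau_K[OF c]]
        lin_homs_compose[OF tau_K[OF c] gd_smult_lin[OF cO Q_module[OF c] h]] _ x])
    fix i v assume i: "i \<in> I" and v: "v \<in> homs C (fst i) c"
    have hv: "h \<diamondop> v \<in> homs C (fst i) c" by (rule Comp_closed[OF v h])
    show "tau c (act F h (act F v (g i))) = gdl c h \<one>\<^bsub>K\<^esub> \<odot>\<^bsub>Q c\<^esub> tau c (act F v (g i))"
    proof (cases "fst i = c")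
      case True
      have v': "v \<in> homs C c c" using v True by simp
      have qi: "q c (snd i) \<in> carrier (Q c)" using q_closed[OF c, of "snd i"] i True by auto
      have "gdl c h \<one>\<^bsub>K\<^esub> \<otimes>\<^bsub>R c\<^esub> gdl c v \<one>\<^bsub>K\<^esub> = gdl c (h \<diamondop> v) \<one>\<^bsub>K\<^esub>"
        using gr_delta_mult[OF cring_K monoid_aut_group[OF cO], of h v "\<one>\<^bsub>K\<^esub>" "\<one>\<^bsub>K\<^esub>"] h v'
        by (simp add: aut_group_simps[OF cO])
      then show ?thesis
        using True Q.smult_assoc1[OF gl[OF h] gl[OF v'] qi]
        by (simp only: act_act_gen[OF i v h] tau_gen[OF c i hv] tau_gen[OF c i v]) simp
    next
      case False
      then show ?thesis
        using Q.smult_zero_right[OF gl[OF h]]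
        by (simp only: act_act_gen[OF i v h] tau_gen[OF c i hv] tau_gen[OF c i v]) simp
    qed
  qed
qed

lemma iota_lin:
  assumes c: "c \<in> Obj C" shows "iota c \<in> lin_homs (R c) (loc F c) (loc F c)"
proof (rule loc_lin_homsI[OF kF c left_module_loc[OF kF c]])
  note k = iota_K[OF c]
  show "iota c \<in> lin_homs K (val F c) (scalar_module K (aut_group C c) (loc F c))"
    using lin_homs_closed[OF k] lin_homs_add[OF k] lin_homs_smult[OF k]
    by (intro lin_homsI) (simp_all add: loc_scalar[OF kF c])
  fix h x assume h: "h \<in> homs C c c" and x: "x \<in> carrier (val F c)"
  have "iota c (act F h x) = act F h (iota c x)"
  proof (rule kc_basis_hom_eqI[OF basis c kcm_val[OF kF c] lin_homs_compose[OF kcm_act[OF kF h] k]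
        lin_homs_compose[OF k kcm_act[OF kF h]] _ x])
    fix i v assume i: "i \<in> I" and v: "v \<in> homs C (fst i) c"
    show "iota c (act F h (act F v (g i))) = act F h (iota c (act F v (g i)))"
      by (simp add: act_act_gen[OF i v h] iota_gen[OF c i v] iota_gen[OF c i Comp_closed[OF v h]]
          kcm_act_zero[OF kF h])
  qed
  then show "iota c (act F h x) = gdl c h \<one>\<^bsub>K\<^esub> \<odot>\<^bsub>loc F c\<^esub> iota c x"
    using loc_gd1[OF kF c h] lin_homs_closed[OF k x] by simp
qed

lemma iota_idem:
  assumes c: "c \<in> Obj C" and x: "x \<in> carrier (val F c)" shows "iota c (iota c x) = iota c x"
proof (rule kc_basis_hom_eqI[OF basis c kcm_val[OF kF c] lin_homs_compose[OF iota_K[OF c] iota_K[OF c]] iota_K[OF c] _ x])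
  fix i v assume iv: "i \<in> I" "v \<in> homs C (fst i) c"
  show "iota c (iota c (act F v (g i))) = iota c (act F v (g i))"
    using lin_homs_zero[OF kcm_val[OF kF c] kcm_val[OF kF c] iota_K[OF c]] iota_gen[OF c iv]
    by (cases "fst i = c") simp_all
qed

lemma tau_iota:
  assumes c: "c \<in> D" and x: "x \<in> carrier (val F c)" shows "tau c (iota c x) = tau c x"
proof (rule loc_basis_eqI[OF basis D_Obj[OF c] Q_module[OF c] lin_homs_compose[OF iota_lin[OF D_Obj[OF c]] tau_lin[OF c]] tau_lin[OF c] _ x])
  fix i v assume iv: "i \<in> I" "v \<in> homs C (fst i) c"
  show "tau c (iota c (act F v (g i))) = tau c (act F v (g i))"
    using lin_homs_zero[OF left_module_loc[OF kF D_Obj[OF c]] Q_module[OF c] tau_lin[OF c]]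
      iota_gen[OF D_Obj[OF c] iv] tau_gen[OF c iv]
    by (cases "fst i = c") simp_all
qed

text \<open>On a basis element the difference is zero if the generator sits at \<open>c\<close>;
  otherwise it is the element itself, which comes from a non-isomorphism. So \<open>iota c\<close>
  is the identity modulo \<open>non F c\<close>.\<close>

lemma iota_diff:
  assumes c: "c \<in> Obj C" "crep c = c" and x: "x \<in> carrier (val F c)"
  shows "x \<ominus>\<^bsub>val F c\<^esub> iota c x \<in> non F c"
proof -
  interpret V: left_module K "val F c" by (rule kcm_val[OF kF c(1)])
  note n = submodule_non[OF kF c(1)]
  have id: "(\<lambda>x. x) \<in> lin_homs K (val F c) (val F c)" by (simp add: lin_homs_def)
  have "{x \<in> carrier (val F c). x \<ominus>\<^bsub>val F c\<^esub> iota c x \<in> non F c} = carrier (val F c)"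
  proof (rule kc_basis_span[OF basis c(1) submodule_vimage[OF V.left_module_axioms V.left_module_axioms
        lin_homs_diff[OF V.left_module_axioms V.left_module_axioms id iota_K[OF c(1)]] n]])
    fix i v assume i: "i \<in> I" and v: "v \<in> homs C (fst i) c"
    have "act F v (g i) \<ominus>\<^bsub>val F c\<^esub> iota c (act F v (g i)) \<in> non F c"
    proof (cases "fst i = c")
      case True
      then show ?thesis
        using n act_gen_closed[OF i v]
        by (simp add: iota_gen[OF c(1) i v] V.minus_eq_zero_iff[THEN iffD2] V.submodule_iff)
    next
      case False
      have "act F v (g i) \<in> non F c"
        by (rule act_in_non[OF v rep_noniso[OF i c False v] gen_closed[OF i]])
      then show ?thesis
        using False V.submodule_minus[OF n, of "act F v (g i)" "\<zero>\<^bsub>val F c\<^esub>"] n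
        by (simp add: iota_gen[OF c(1) i v] V.submodule_iff)
    qed
    then show "act F v (g i) \<in> {x \<in> carrier (val F c). x \<ominus>\<^bsub>val F c\<^esub> iota c x \<in> non F c}"
      using act_gen_closed[OF i v] by blast
  qed
  then show ?thesis using x by blast
qed

text \<open>The two routes from \<open>F\<close> at \<open>c\<close> to the split quotient of
  \<open>M\<close>, through \<open>Q c\<close> and through \<open>M\<close>, agree. For generators
  at \<open>c\<close> this is the choice of \<open>y\<close>; the others give zero through
  \<open>Q c\<close>, and images of non-isomorphisms through \<open>M\<close>.\<close>

lemma pc_tau:
  assumes c: "c \<in> D" and x: "x \<in> carrier (val F c)"
  shows "pc c (tau c x) = rho M c (f c x)"
proof (rule loc_basis_eqI[OF basis D_Obj[OF c] left_module_spl[OF kM D_Obj[OF c]]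
      lin_homs_compose[OF tau_lin[OF c] pc_lin[OF c]]
      lin_homs_compose[OF loc_hom[OF kF kM f_facts(1) D_Obj[OF c]] rho_lin[OF kM D_Obj[OF c]]] _ x])
  note cO = D_Obj[OF c]
  fix i v assume i: "i \<in> I" and v: "v \<in> homs C (fst i) c"
  show "pc c (tau c (act F v (g i))) = rho M c (f c (act F v (g i)))"
  proof (cases "fst i = c")
    case True
    have v': "v \<in> homs C c c" using v True by simp
    have qi: "q c (snd i) \<in> carrier (Q c)" using q_closed[OF c, of "snd i"] i True by auto
    have yi: "y i = pc c (q c (snd i))" "y i \<in> carrier (val M c)" "rho M c (y i) = y i"
      using y_closed[OF i] rho_y[OF i] True by (auto simp: y_def)
    have "pc c (gdl c v \<one>\<^bsub>K\<^esub> \<odot>\<^bsub>Q c\<^esub> q c (snd i)) = gdl c v \<one>\<^bsub>K\<^esub> \<odot>\<^bsub>spl M c\<^esub> y i"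
      unfolding yi(1) by (rule lin_homs_smult[OF pc_lin[OF c] gdl_closed[OF cO v' K.one_closed] qi])
    also have "\<dots> = rho M c (act M v (y i))"
      by (simp add: loc_gd1[OF kM cO v' yi(2)])
    finally show ?thesis
      using True by (simp only: tau_gen[OF c i v] f_facts(2)[OF i v] if_True simp_thms)
  next
    case False
    have "act M v (y i) \<in> non M c"
      by (rule act_in_non[OF v rep_noniso[OF i cO _ False v] y_closed[OF i]]) (use c D in auto)
    then have "rho M c (act M v (y i)) = \<zero>\<^bsub>spl M c\<^esub>"
      using rho_zero_iff[OF kM cO] kcm_act_closed[OF kM v y_closed[OF i]] by blast
    then show ?thesis
      using False lin_homs_zero[OF Q_module[OF c] left_module_spl[OF kM cO] pc_lin[OF c]]
      by (simp only: tau_gen[OF c i v] f_facts(2)[OF i v] if_False simp_thms)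
  qed
qed

text \<open>The identity of \<open>c\<close> is among the morphisms \<open>v\<close>, so every
  \<open>q c b\<close> is attained, and these generate.\<close>

lemma tau_surj:
  assumes c: "c \<in> D" shows "tau c ` carrier (loc F c) = carrier (Q c)"
proof (rule q_span[OF c])
  note cO = D_Obj[OF c]
  show "submodule (tau c ` carrier (loc F c)) (R c) (Q c)"
    by (rule submodule_image[OF left_module_loc[OF kF cO] Q_module[OF c] tau_lin[OF c]
          left_module.submodule_carrier[OF left_module_loc[OF kF cO]]])
  interpret Q: left_module "R c" "Q c" by (rule Q_module[OF c])
  fix b assume b: "b \<in> B c"
  have i: "(c, b) \<in> I" "Id C c \<in> homs C (fst (c, b)) c" using b cO Id_closed by auto
  have "tau c (act F (Id C c) (g (c, b))) = gdl c (Id C c) \<one>\<^bsub>K\<^esub> \<odot>\<^bsub>Q c\<^esub> q c b"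
    using tau_gen[OF c i] by simp
  also have "\<dots> = q c b"
    using Q.smult_one[OF q_closed[OF c b]] by (simp add: aut_group_simps[OF cO])
  finally show "q c b \<in> tau c ` carrier (loc F c)"
    using act_gen_closed[OF i] by force
qed

section \<open>The section, the idempotent of the free module, and its image\<close>

definition sigma :: "'o \<Rightarrow> 'u \<Rightarrow> 'u" where
  "sigma c = (SOME s. s \<in> lin_homs (R c) (Q c) (loc F c) \<and> (\<forall>x \<in> carrier (Q c). tau c (s x) = x \<and> iota c (s x) = s x))"

lemma sigma_facts:
  assumes c: "c \<in> D"
  shows sigma_lin: "sigma c \<in> lin_homs (R c) (Q c) (loc F c)"
    and tau_sigma: "x \<in> carrier (Q c) \<Longrightarrow> tau c (sigma c x) = x"
    and iota_sigma: "x \<in> carrier (Q c) \<Longrightarrow> iota c (sigma c x) = sigma c x"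
proof -
  note cO = D_Obj[OF c]
  have "\<exists>s. s \<in> lin_homs (R c) (Q c) (loc F c) \<and> (\<forall>x \<in> carrier (Q c). tau c (s x) = x)"
  proof (rule projective_section[OF Q_projective[OF c] left_module_loc[OF kF cO] tau_lin[OF c] tau_surj[OF c]])
    fix s assume "s \<in> lin_homs (R c) (Q c) (loc F c)" "\<And>x. x \<in> carrier (Q c) \<Longrightarrow> tau c (s x) = x"
    then show ?thesis by (intro exI[of _ s]) simp
  qed
  then obtain s where s: "s \<in> lin_homs (R c) (Q c) (loc F c)" "\<And>x. x \<in> carrier (Q c) \<Longrightarrow> tau c (s x) = x"
    by auto
  have cl: "s x \<in> carrier (val F c)" if "x \<in> carrier (Q c)" for x
    using lin_homs_closed[OF s(1) that] by simp
  \<comment> \<open>Any section may be followed by \<open>iota c\<close>: it remains a section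
    because \<open>tau c\<close> absorbs \<open>iota c\<close>, and its values become fixed by the
    idempotent \<open>iota c\<close>.\<close>
  have "\<exists>s. s \<in> lin_homs (R c) (Q c) (loc F c) \<and> (\<forall>x \<in> carrier (Q c). tau c (s x) = x \<and> iota c (s x) = s x)"
    by (intro exI[of _ "\<lambda>x. iota c (s x)"] conjI ballI lin_homs_compose[OF s(1) iota_lin[OF cO]])
      (simp_all add: tau_iota[OF c] iota_idem[OF cO] cl s(2))
  from someI_ex[OF this] show "sigma c \<in> lin_homs (R c) (Q c) (loc F c)"
    "x \<in> carrier (Q c) \<Longrightarrow> tau c (sigma c x) = x" "x \<in> carrier (Q c) \<Longrightarrow> iota c (sigma c x) = sigma c x"
    unfolding sigma_def[symmetric] by blast+
qed

lemma sigma_closed: "c \<in> D \<Longrightarrow> x \<in> carrier (Q c) \<Longrightarrow> sigma c x \<in> carrier (val F c)"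
  using lin_homs_closed[OF sigma_lin] by simp

definition s :: "'o \<times> 'b \<Rightarrow> 'u" where "s i = sigma (fst i) (q (fst i) (snd i))"

lemma qi_closed: "i \<in> I \<Longrightarrow> q (fst i) (snd i) \<in> carrier (Q (fst i))"
  using q_closed[OF I_D] by auto

lemma s_closed: "i \<in> I \<Longrightarrow> s i \<in> carrier (val F (fst i))"
  unfolding s_def by (rule sigma_closed[OF I_D qi_closed])

definition e :: "'o \<Rightarrow> 'u \<Rightarrow> 'u" where
  "e = (SOME e. kc_hom K C F F e \<and> (\<forall>i \<in> I. \<forall>d. \<forall>v \<in> homs C (fst i) d. e d (act F v (g i)) = act F v (s i)))"

lemma e_facts: "kc_hom K C F F e" "i \<in> I \<Longrightarrow> v \<in> homs C (fst i) d \<Longrightarrow> e d (act F v (g i)) = act F v (s i)"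
proof -
  have "\<exists>e. kc_hom K C F F e \<and> (\<forall>i \<in> I. \<forall>d. \<forall>v \<in> homs C (fst i) d. e d (act F v (g i)) = act F v (s i))"
  proof (rule kc_basis_universal[OF basis kF s_closed])
    fix e' assume "kc_hom K C F F e'"
      and "\<And>i d v. i \<in> I \<Longrightarrow> v \<in> homs C (fst i) d \<Longrightarrow> e' d (act F v (g i)) = act F v (s i)"
    then show ?thesis by (intro exI[of _ e']) simp
  qed
  from someI_ex[OF this] show "kc_hom K C F F e"
    "i \<in> I \<Longrightarrow> v \<in> homs C (fst i) d \<Longrightarrow> e d (act F v (g i)) = act F v (s i)"
    unfolding e_def[symmetric] by blast+
qed

text \<open>On the summand of automorphisms \<open>e\<close> is the idempotent
  \<open>sigma c\<close> after \<open>tau c\<close>. Elsewhere \<open>e\<close> is governed by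
  naturality, so this local identity is what controls it at \<open>c\<close>.\<close>

lemma e_iota:
  assumes c: "c \<in> D" and x: "x \<in> carrier (val F c)"
  shows "e c (iota c x) = sigma c (tau c x)"
proof (rule loc_basis_eqI[OF basis D_Obj[OF c] left_module_loc[OF kF D_Obj[OF c]]
      lin_homs_compose[OF iota_lin[OF D_Obj[OF c]] loc_hom[OF kF kF e_facts(1) D_Obj[OF c]]]
      lin_homs_compose[OF tau_lin[OF c] sigma_lin[OF c]] _ x])
  note cO = D_Obj[OF c]
  fix i v assume i: "i \<in> I" and v: "v \<in> homs C (fst i) c"
  show "e c (iota c (act F v (g i))) = sigma c (tau c (act F v (g i)))"
  proof (cases "fst i = c")
    case True
    have v': "v \<in> homs C c c" using v True by simp
    have qi: "q c (snd i) \<in> carrier (Q c)" using qi_closed[OF i] True by simp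
    have "sigma c (gdl c v \<one>\<^bsub>K\<^esub> \<odot>\<^bsub>Q c\<^esub> q c (snd i)) = gdl c v \<one>\<^bsub>K\<^esub> \<odot>\<^bsub>loc F c\<^esub> sigma c (q c (snd i))"
      by (rule lin_homs_smult[OF sigma_lin[OF c] gdl_closed[OF cO v' K.one_closed] qi])
    also have "\<dots> = act F v (s i)"
      using loc_gd1[OF kF cO v' sigma_closed[OF c qi]] True by (simp add: s_def)
    finally show ?thesis
      using True by (simp only: tau_gen[OF c i v] iota_gen[OF cO i v] e_facts(2)[OF i v] if_True simp_thms)
  next
    case False
    then show ?thesis
      using lin_homs_zero[OF Q_module[OF c] left_module_loc[OF kF cO] sigma_lin[OF c]]
        lin_homs_zero[OF kcm_val[OF kF cO] kcm_val[OF kF cO] kc_hom_lin[OF e_facts(1) cO]]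
      by (simp add: tau_gen[OF c i v] iota_gen[OF cO i v])
  qed
qed

text \<open>Values of \<open>sigma c\<close> lie in the summand of automorphisms, where
  \<open>e\<close> is known by \<open>e_iota\<close>, and \<open>tau c\<close> undoes
  \<open>sigma c\<close>.\<close>

lemma e_sigma:
  assumes c: "c \<in> D" and x: "x \<in> carrier (Q c)" shows "e c (sigma c x) = sigma c x"
  using e_iota[OF c sigma_closed[OF c x]] by (simp add: iota_sigma[OF c x] tau_sigma[OF c x])

lemma e_closed: "d \<in> Obj C \<Longrightarrow> x \<in> carrier (val F d) \<Longrightarrow> e d x \<in> carrier (val F d)"
  by (rule kc_hom_closed[OF e_facts(1)])

text \<open>The images \<open>s i\<close> of the generators are fixed by \<open>e\<close>;
  naturality carries this to all basis elements.\<close>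

lemma e_idem:
  assumes d: "d \<in> Obj C" and x: "x \<in> carrier (val F d)" shows "e d (e d x) = e d x"
proof (rule kc_basis_hom_eqI[OF basis d kcm_val[OF kF d]
      lin_homs_compose[OF kc_hom_lin[OF e_facts(1) d] kc_hom_lin[OF e_facts(1) d]] kc_hom_lin[OF e_facts(1) d] _ x])
  fix i v assume i: "i \<in> I" and v: "v \<in> homs C (fst i) d"
  have "e (fst i) (s i) = s i" unfolding s_def by (rule e_sigma[OF I_D[OF i] qi_closed[OF i]])
  then show "e d (e d (act F v (g i))) = e d (act F v (g i))"
    by (simp add: e_facts(2)[OF i v] kc_hom_nat[OF e_facts(1) v s_closed[OF i]])
qed

definition E :: "'o \<Rightarrow> 'u set" where "E d = e d ` carrier (val F d)"

abbreviation "P \<equiv> restrict_kc F E"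

lemma E_sub: "kc_submodule K C F E"
  unfolding E_def by (rule kc_submodule_image[OF kF kF e_facts(1) kc_submodule_carrier[OF kF]])

lemma kP: "kcm P" by (rule kcm_restrict[OF kF E_sub])

text \<open>The image of an idempotent is its set of fixed points.\<close>

lemma E_iff: "d \<in> Obj C \<Longrightarrow> x \<in> E d \<longleftrightarrow> x \<in> carrier (val F d) \<and> e d x = x"
  using e_idem e_closed by (force simp: E_def)

lemma e_hom: "kc_hom K C F P e"
  using e_facts(1) unfolding kc_hom_def by (auto simp: lin_homs_def E_def)

lemma f_hom: "kc_hom K C P M f"
  using kc_hom_compose[OF kc_hom_inclusion[OF kF E_sub] f_facts(1)] by simp

text \<open>\<open>P\<close> is a retract of \<open>F\<close> through \<open>e\<close>. The map
  \<open>\<phi>\<close> after \<open>e\<close> is lifted from \<open>F\<close> along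
  \<open>\<epsilon>\<close> by lifting the values on generators, and the lift is restricted to
  \<open>P\<close>, where \<open>e\<close> is the identity.\<close>

lemma P_projective: "projective (kC_cat K C) P"
  unfolding projective_def
proof (intro conjI allI impI; (elim conjE)?)
  show "P \<in> Obj (kC_cat K C)" using kP by simp
  fix \<epsilon> \<phi> assume ep: "epic (kC_cat K C) \<epsilon>" and ph: "\<phi> \<in> homs (kC_cat K C) P (Cod (kC_cat K C) \<epsilon>)"
  have em: "\<epsilon> \<in> Mor (kC_cat K C)" and pm: "\<phi> \<in> Mor (kC_cat K C)" and sp: "src \<phi> = P" "tgt \<phi> = tgt \<epsilon>"
    using ep ph by (auto simp: epic_def homs_def)
  have kN: "kcm (src \<epsilon>)" "kcm (tgt \<epsilon>)" using em by (auto simp: kC_cat_Mor)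
  note eh = Mor_kc_hom[OF em] and phh = Mor_kc_hom[OF pm, unfolded sp]
  \<comment> \<open>Values of \<open>\<phi>\<close> after \<open>e\<close> on the generators; their
    preimages under \<open>\<epsilon>\<close> will determine the lift \<open>G\<close>.\<close>
  let ?w = "\<lambda>i. fn \<phi> (fst i) (e (fst i) (g i))"
  have w: "?w i \<in> carrier (val (tgt \<epsilon>) (fst i))" if "i \<in> I" for i
    by (rule kc_hom_closed[OF phh D_Obj[OF I_D[OF that]] kc_hom_closed[OF e_hom D_Obj[OF I_D[OF that]] gen_closed[OF that]]])
  have "\<forall>i. \<exists>z. i \<in> I \<longrightarrow> z \<in> carrier (val (src \<epsilon>) (fst i)) \<and> fn \<epsilon> (fst i) z = ?w i"
  proof
    fix i
    have "?w i \<in> fn \<epsilon> (fst i) ` carrier (val (src \<epsilon>) (fst i))" if i: "i \<in> I"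
      using ep w[OF i] D_Obj[OF I_D[OF i]] by (simp add: epic_kC_iff)
    then show "\<exists>z. i \<in> I \<longrightarrow> z \<in> carrier (val (src \<epsilon>) (fst i)) \<and> fn \<epsilon> (fst i) z = ?w i"
      unfolding image_iff by (metis (no_types))
  qed
  from choice[OF this] obtain z where
    z: "\<And>i. i \<in> I \<Longrightarrow> z i \<in> carrier (val (src \<epsilon>) (fst i))" "\<And>i. i \<in> I \<Longrightarrow> fn \<epsilon> (fst i) (z i) = ?w i"
    by blast
  have "\<exists>G. kc_hom K C F (src \<epsilon>) G \<and> (\<forall>i \<in> I. \<forall>d. \<forall>v \<in> homs C (fst i) d. G d (act F v (g i)) = act (src \<epsilon>) v (z i))"
  proof (rule kc_basis_universal[OF basis kN(1) z(1)])
    fix G assume "kc_hom K C F (src \<epsilon>) G"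
      and "\<And>i d v. i \<in> I \<Longrightarrow> v \<in> homs C (fst i) d \<Longrightarrow> G d (act F v (g i)) = act (src \<epsilon>) v (z i)"
    then show ?thesis by (intro exI[of _ G]) simp
  qed
  then obtain G where G: "kc_hom K C F (src \<epsilon>) G"
      "\<And>i d v. i \<in> I \<Longrightarrow> v \<in> homs C (fst i) d \<Longrightarrow> G d (act F v (g i)) = act (src \<epsilon>) v (z i)"
    by blast
  have eq: "fn \<epsilon> d (G d x) = fn \<phi> d (e d x)" if d: "d \<in> Obj C" and x: "x \<in> carrier (val F d)" for d x
  proof (rule kc_basis_hom_eqI[OF basis d kcm_val[OF kN(2) d]
        kc_hom_lin[OF kc_hom_compose[OF G(1) eh] d] kc_hom_lin[OF kc_hom_compose[OF e_hom phh] d] _ x])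
    fix i v assume i: "i \<in> I" and v: "v \<in> homs C (fst i) d"
    have "fn \<epsilon> d (G d (act F v (g i))) = act (tgt \<epsilon>) v (?w i)"
      using kc_hom_nat[OF eh v z(1)[OF i]] z(2)[OF i] G(2)[OF i v] by simp
    also have "\<dots> = fn \<phi> d (e d (act F v (g i)))"
      using kc_hom_nat[OF kc_hom_compose[OF e_hom phh] v gen_closed[OF i]] by simp
    finally show "fn \<epsilon> d (G d (act F v (g i))) = fn \<phi> d (e d (act F v (g i)))" .
  qed
  have GP: "kc_hom K C P (src \<epsilon>) G"
    using kc_hom_compose[OF kc_hom_inclusion[OF kF E_sub] G(1)] by simp
  let ?G = "kc_arrow C P (src \<epsilon>) G"
  have gm: "?G \<in> Mor (kC_cat K C)" by (rule kc_arrow_Mor[OF kP kN(1) GP])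
  have "fn (\<epsilon> \<diamondop>\<^bsub>kC_cat K C\<^esub> ?G) = fn \<phi>"
  proof (rule extensionalityI[of _ "Obj C"])
    have nt: "fn \<phi> \<in> nat_trans K C P (tgt \<epsilon>)" using pm sp by (simp add: kC_cat_Mor)
    show "fn \<phi> \<in> extensional (Obj C)" by (rule nat_trans_extensional(1)[OF nt])
    show "fn (\<epsilon> \<diamondop>\<^bsub>kC_cat K C\<^esub> ?G) \<in> extensional (Obj C)" by simp
    fix d assume d: "d \<in> Obj C"
    show "fn (\<epsilon> \<diamondop>\<^bsub>kC_cat K C\<^esub> ?G) d = fn \<phi> d"
    proof (rule extensionalityI[of _ "E d"])
      show "fn \<phi> d \<in> extensional (E d)" using nat_trans_extensional(2)[OF nt d] by simp
      show "fn (\<epsilon> \<diamondop>\<^bsub>kC_cat K C\<^esub> ?G) d \<in> extensional (E d)" using d by (simp add: compose_def)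
      show "fn (\<epsilon> \<diamondop>\<^bsub>kC_cat K C\<^esub> ?G) d x = fn \<phi> d x" if "x \<in> E d" for x
        using that d eq[OF d, of x] E_iff[OF d] by (simp add: compose_def)
    qed
  qed
  then have "\<epsilon> \<diamondop>\<^bsub>kC_cat K C\<^esub> ?G = \<phi>" using sp by (cases \<phi>) simp
  then show "\<exists>\<gamma>\<in>homs (kC_cat K C) P (Dom (kC_cat K C) \<epsilon>). \<epsilon> \<diamondop>\<^bsub>kC_cat K C\<^esub> \<gamma> = \<phi>"
    using gm by (intro bexI[of _ ?G]) (auto simp: homs_def simp del: kC_cat_simps(4))
qed

text \<open>By Nakayama it suffices to reach \<open>M\<close> modulo \<open>non M c\<close> at
  representatives. For \<open>c\<close> in \<open>D\<close>, a class in the split quotient is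
  \<open>pc c z\<close>, which by \<open>pc_tau\<close> is the class of
  \<open>f c (sigma c z)\<close>; outside \<open>D\<close> the split quotient is zero.\<close>

lemma P_surj:
  assumes d: "d \<in> Obj C" shows "f d ` E d = carrier (val M d)"
proof -
  have L: "kc_submodule K C M (\<lambda>d. f d ` E d)"
    by (rule kc_submodule_image[OF kF kM f_facts(1) E_sub])
  show ?thesis
  proof (rule nakayama[OF kM L A(1,3) _ d])
    fix c x assume c: "c \<in> Obj C" "crep c = c" and x: "x \<in> carrier (val M c)"
    show "\<exists>y \<in> f c ` E c. x \<ominus>\<^bsub>val M c\<^esub> y \<in> non M c"
    proof (cases "c \<in> D")
      case True
      have "rho M c x \<in> pc c ` carrier (Q c)" using pc_surj[OF True] x by auto
      then obtain z where z: "z \<in> carrier (Q c)" "rho M c x = pc c z" by auto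
      have sz: "sigma c z \<in> carrier (val F c)" by (rule sigma_closed[OF True z(1)])
      have "rho M c (f c (sigma c z)) = rho M c x"
        using pc_tau[OF True sz] tau_sigma[OF True z(1)] z(2) by simp
      then have "x \<ominus>\<^bsub>val M c\<^esub> f c (sigma c z) \<in> non M c"
        using rho_eq_iff[OF kM c(1) x kc_hom_closed[OF f_facts(1) c(1) sz]] by simp
      moreover have "sigma c z \<in> E c" using E_iff[OF c(1)] sz e_sigma[OF True z(1)] by simp
      ultimately show ?thesis by blast
    next
      case False
      then have n: "non M c = carrier (val M c)" using c D by auto
      interpret V: left_module K "val M c" by (rule kcm_val[OF kM c(1)])
      have "\<zero>\<^bsub>val M c\<^esub> \<in> f c ` E c" by (rule kc_submoduleD(2)[OF kM L c(1)])
      then show ?thesis using x n by (intro bexI[of _ "\<zero>\<^bsub>val M c\<^esub>"]) auto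
    qed
  qed
qed

lemma D_A: assumes c: "c \<in> D" shows "cl C c \<in> A"
proof -
  have "\<zero>\<^bsub>val M c\<^esub> \<in> non M c"
    using submodule_non[OF kM D_Obj[OF c]] left_module.submodule_iff[OF kcm_val[OF kM D_Obj[OF c]]] by blast
  then have "carrier (val M c) \<noteq> {\<zero>\<^bsub>val M c\<^esub>}"
    using non_carrier[OF kM D_Obj[OF c]] c D by auto
  then show ?thesis using A(3) D_Obj[OF c] by (auto simp: supp_in_def)
qed

text \<open>At an object that no generator reaches, \<open>F\<close> is zero, hence so is
  \<open>P\<close>. The bound is applied to \<open>A\<close>, where it provides the descent for
  Nakayama on \<open>P\<close>, and to \<open>U\<close>, where it feeds the next syzygy.\<close>

lemma P_supp:
  assumes U: "upper_set C U" "\<And>c. c \<in> D \<Longrightarrow> cl C c \<in> U"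
  shows "supp_in U P"
  unfolding supp_in_def
proof (intro ballI impI)
  fix d assume d: "d \<in> Obj C" and ne: "carrier (val P d) \<noteq> {\<zero>\<^bsub>val P d\<^esub>}"
  have "\<exists>i v. i \<in> I \<and> v \<in> homs C (fst i) d"
  proof (rule ccontr)
    assume no: "\<not> ?thesis"
    have "{\<zero>\<^bsub>val F d\<^esub>} = carrier (val F d)"
      by (rule kc_basis_span[OF basis d left_module.submodule_zero[OF kcm_val[OF kF d]]]) (use no in blast)
    then have "carrier (val F d) = {\<zero>\<^bsub>val F d\<^esub>}" by (rule sym)
    then have "E d = {\<zero>\<^bsub>val F d\<^esub>}"
      using kc_submoduleD(1,2)[OF kF E_sub d] by auto
    then show False using ne by simp
  qed
  then obtain i v where "i \<in> I" "v \<in> homs C (fst i) d" by auto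
  then show "cl C d \<in> U" using upper_set_mono[OF U(1) U(2)[OF I_D]] by blast
qed

lemma P_superfluous:
  assumes L: "kc_submodule K C P L" and im: "\<And>d. d \<in> Obj C \<Longrightarrow> f d ` L d = carrier (val M d)"
    and d: "d \<in> Obj C"
  shows "L d = E d"
proof -
  have LF: "kc_submodule K C F L" by (rule kc_submodule_trans[OF kF E_sub L])
  have "L d = carrier (val P d)"
  proof (rule nakayama[OF kP L A(1) P_supp[OF A(2) D_A] _ d])
    fix c x assume c: "c \<in> Obj C" "crep c = c" and x: "x \<in> carrier (val P c)"
    have xF: "x \<in> carrier (val F c)" "e c x = x" using x E_iff[OF c(1)] by auto
    interpret V: left_module K "val F c" by (rule kcm_val[OF kF c(1)])
    interpret VP: left_module K "val P c" by (rule kcm_val[OF kP c(1)])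
    have LE: "L c \<subseteq> E c" using kc_submoduleD(1)[OF kP L c(1)] by simp
    \<comment> \<open>Negatives in a restricted record are taken relative to the smaller carrier.
      Writing them as multiples by minus one shows that the two differences agree.\<close>
    have Pm: "a \<ominus>\<^bsub>val P c\<^esub> b = a \<ominus>\<^bsub>val F c\<^esub> b" if "a \<in> E c" "b \<in> E c" for a b
      using VP.smult_minus_one[of b] V.smult_minus_one[of b] that E_iff[OF c(1)] by (simp add: a_minus_def)
    show "\<exists>y \<in> L c. x \<ominus>\<^bsub>val P c\<^esub> y \<in> non P c"
    proof (cases "c \<in> D")
      case True
      have Lc: "submodule (L c) (R c) (loc F c)"
      proof (rule loc_submoduleI[OF kF c(1)])
        show "submodule (L c) K (val F c)" using LF c(1) by (simp add: kc_submodule_iff)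
        show "act F h z \<in> L c" if "h \<in> homs C c c" "z \<in> L c" for h z
          using LF that unfolding kc_submodule_iff by blast
      qed
      have "pc c ` tau c ` L c = carrier (spl M c)"
      proof -
        have "pc c ` tau c ` L c = (\<lambda>z. rho M c (f c z)) ` L c"
          unfolding image_image
          by (rule image_cong[OF refl pc_tau[OF True subsetD[OF kc_submoduleD(1)[OF kF LF c(1)]]]])
        also have "\<dots> = rho M c ` f c ` L c" by (simp only: image_image)
        finally show ?thesis using im[OF c(1)] by simp
      qed
      then have "tau c ` L c = carrier (Q c)"
        by (rule pc_superfluous[OF True submodule_image[OF left_module_loc[OF kF c(1)] Q_module[OF True] tau_lin[OF True] Lc]])
      moreover have "tau c x \<in> carrier (Q c)" using lin_homs_closed[OF tau_lin[OF True]] xF by simp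
      ultimately have "tau c x \<in> tau c ` L c" by (simp only:)
      then obtain z where z: "z \<in> L c" "tau c z = tau c x" by (auto simp del: loc_simps)
      have zE: "z \<in> E c" "z \<in> carrier (val F c)" using z LE E_iff[OF c(1)] by auto
      \<comment> \<open>This difference is fixed by \<open>e\<close> and killed by
        \<open>tau c\<close>.\<close>
      let ?w = "x \<ominus>\<^bsub>val F c\<^esub> z"
      have w: "?w \<in> carrier (val F c)" using xF zE by simp
      have ew: "e c ?w = ?w"
        using lin_homs_minus[OF V.left_module_axioms V.left_module_axioms kc_hom_lin[OF e_facts(1) c(1)] xF(1) zE(2)]
          xF zE E_iff[OF c(1)] by simp
      interpret SQ: left_module K "scalar_module K (aut_group C c) (Q c)"
        by (rule left_module_scalar[OF cring_K monoid_aut_group[OF c(1)] Q_module[OF True]])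
      have "tau c ?w = \<zero>\<^bsub>Q c\<^esub>"
        using lin_homs_minus[OF V.left_module_axioms SQ.left_module_axioms tau_K[OF True] xF(1) zE(2)] z(2)
          SQ.minus_eq_zero_iff[of "tau c x" "tau c x"] lin_homs_closed[OF tau_K[OF True] xF(1)] by simp
      \<comment> \<open>By \<open>e_iota\<close> the automorphism part of the difference dies under
        \<open>e\<close>. What remains is \<open>e\<close> applied to an element of
        \<open>non F c\<close>, and naturality places that in \<open>non P c\<close>.\<close>
      then have "e c (iota c ?w) = \<zero>\<^bsub>val F c\<^esub>"
        using e_iota[OF True w] lin_homs_zero[OF Q_module[OF True] left_module_loc[OF kF c(1)] sigma_lin[OF True]] by simp
      then have "e c (?w \<ominus>\<^bsub>val F c\<^esub> iota c ?w) = ?w"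
        using lin_homs_minus[OF V.left_module_axioms V.left_module_axioms kc_hom_lin[OF e_facts(1) c(1)] w
            lin_homs_closed[OF iota_K[OF c(1)] w]] ew w by (simp add: a_minus_def V.M.minus_equality[of "\<zero>\<^bsub>val F c\<^esub>" "\<zero>\<^bsub>val F c\<^esub>"])
      moreover have "e c (?w \<ominus>\<^bsub>val F c\<^esub> iota c ?w) \<in> non P c"
        by (rule non_hom[OF kF kP e_hom c(1) iota_diff[OF c w]])
      ultimately show ?thesis
        using z(1) Pm[OF _ zE(1)] x by (intro bexI[of _ z]) auto
    next
      case False
      \<comment> \<open>No generator sits at \<open>c\<close>, so every basis element comes from a
        non-isomorphism.\<close>
      have "non F c = carrier (val F c)"
      proof (rule kc_basis_span[OF basis c(1) submodule_non[OF kF c(1)]])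
        fix i v assume i: "i \<in> I" and v: "v \<in> homs C (fst i) c"
        have "fst i \<noteq> c" using I_D[OF i] False by auto
        then show "act F v (g i) \<in> non F c"
          by (rule act_in_non[OF v rep_noniso[OF i c _ v] gen_closed[OF i]])
      qed
      then have "x \<in> non P c" using non_hom[OF kF kP e_hom c(1), of x] xF by simp
      moreover have "\<zero>\<^bsub>val P c\<^esub> \<in> L c" by (rule kc_submoduleD(2)[OF kP L c(1)])
      moreover have "x \<ominus>\<^bsub>val P c\<^esub> \<zero>\<^bsub>val P c\<^esub> = x"
        using x VP.M.minus_equality[of "\<zero>\<^bsub>val P c\<^esub>" "\<zero>\<^bsub>val P c\<^esub>"] VP.M.r_zero[of x] VP.M.l_zero[of "\<zero>\<^bsub>val P c\<^esub>"]
        unfolding a_minus_def by (metis VP.M.zero_closed)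
      ultimately show ?thesis by (intro bexI[of _ "\<zero>\<^bsub>val P c\<^esub>"]) simp_all
    qed
  qed
  then show ?thesis by simp
qed

text \<open>The map \<open>e\<close> from \<open>F\<close> onto \<open>P\<close> sends generators to
  the \<open>s i\<close>; a submodule containing their images has full preimage.\<close>

lemma P_span:
  assumes d: "d \<in> Obj C" and H: "submodule H K (val P d)"
    and gens: "\<And>i v. i \<in> I \<Longrightarrow> v \<in> homs C (fst i) d \<Longrightarrow> act P v (s i) \<in> H"
  shows "H = carrier (val P d)"
proof -
  have "{x \<in> carrier (val F d). e d x \<in> H} = carrier (val F d)"
  proof (rule kc_basis_span[OF basis d submodule_vimage[OF kcm_val[OF kF d] kcm_val[OF kP d] kc_hom_lin[OF e_hom d] H]])
    show "act F v (g i) \<in> {x \<in> carrier (val F d). e d x \<in> H}" if "i \<in> I" "v \<in> homs C (fst i) d" for i v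
      using act_gen_closed[OF that] gens[OF that] e_facts(2)[OF that] by simp
  qed
  then have "E d \<subseteq> H" by (auto simp: E_def)
  moreover have "H \<subseteq> carrier (val P d)" by (rule H[unfolded left_module.submodule_iff[OF kcm_val[OF kP d]], THEN conjunct1])
  ultimately show ?thesis by auto
qed

lemma s_P: "i \<in> I \<Longrightarrow> s i \<in> carrier (val P (fst i))"
  using E_iff[OF D_Obj[OF I_D]] s_closed e_sigma[OF I_D qi_closed] by (simp add: s_def)

text \<open>If the \<open>q c b\<close> behave like a basis, \<open>\<psi>\<close> inverts
  \<open>tau c\<close> on the summand of automorphisms: \<open>iota c\<close> is
  \<open>\<psi>\<close> after \<open>tau c\<close>. This forces \<open>sigma c (q c b)\<close> to be
  the generator itself, so \<open>e\<close> fixes all generators and is the identity.\<close>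

lemma P_free:
  assumes "\<And>c. c \<in> D \<Longrightarrow> \<exists>\<psi> \<in> lin_homs (R c) (Q c) (loc F c). \<forall>b \<in> B c. \<psi> (q c b) = g (c, b)"
    and d: "d \<in> Obj C"
  shows "E d = carrier (val F d)"
proof -
  have sg: "s i = g i" if i: "i \<in> I" for i
  proof -
    obtain c b where cb: "i = (c, b)" "c \<in> Obj C" "b \<in> B c" using i by auto
    have c: "c \<in> D" using I_D[OF i] cb by simp
    obtain \<psi> where \<psi>: "\<psi> \<in> lin_homs (R c) (Q c) (loc F c)" "\<And>b. b \<in> B c \<Longrightarrow> \<psi> (q c b) = g (c, b)"
      using assms(1)[OF c] by blast
    have it: "iota c x = \<psi> (tau c x)" if x: "x \<in> carrier (val F c)" for x
    proof (rule loc_basis_eqI[OF basis cb(2) left_module_loc[OF kF cb(2)] iota_lin[OF cb(2)]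
          lin_homs_compose[OF tau_lin[OF c] \<psi>(1)] _ x])
      fix j v assume j: "j \<in> I" and v: "v \<in> homs C (fst j) c"
      show "iota c (act F v (g j)) = \<psi> (tau c (act F v (g j)))"
      proof (cases "fst j = c")
        case True
        have v': "v \<in> homs C c c" using v True by simp
        have qj: "q c (snd j) \<in> carrier (Q c)" using qi_closed[OF j] True by simp
        have gj: "\<psi> (q c (snd j)) = g j" "g j \<in> carrier (val F c)" using \<psi>(2)[of "snd j"] gen_closed[OF j] j True by auto
        have "\<psi> (gdl c v \<one>\<^bsub>K\<^esub> \<odot>\<^bsub>Q c\<^esub> q c (snd j)) = gdl c v \<one>\<^bsub>K\<^esub> \<odot>\<^bsub>loc F c\<^esub> g j"
          using lin_homs_smult[OF \<psi>(1) gdl_closed[OF cb(2) v' K.one_closed] qj] by (simp only: gj)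
        then show ?thesis
          using True loc_gd1[OF kF cb(2) v' gj(2)] by (simp only: tau_gen[OF c j v] iota_gen[OF cb(2) j v] if_True simp_thms)
      next
        case False
        then show ?thesis
          using lin_homs_zero[OF Q_module[OF c] left_module_loc[OF kF cb(2)] \<psi>(1)]
          by (simp add: tau_gen[OF c j v] iota_gen[OF cb(2) j v])
      qed
    qed
    have "s i = sigma c (q c b)" by (simp add: s_def cb)
    also have "\<dots> = \<psi> (q c b)"
      using it[OF sigma_closed[OF c q_closed[OF c cb(3)]]] iota_sigma[OF c q_closed[OF c cb(3)]] tau_sigma[OF c q_closed[OF c cb(3)]]
      by simp
    finally show ?thesis using \<psi>(2)[OF cb(3)] cb by simp
  qed
  have id: "(\<lambda>x. x) \<in> lin_homs K (val F d) (val F d)" by (simp add: lin_homs_def)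
  have "e d x = x" if x: "x \<in> carrier (val F d)" for x
    by (rule kc_basis_hom_eqI[OF basis d kcm_val[OF kF d] kc_hom_lin[OF e_facts(1) d] id _ x])
      (simp add: e_facts(2) sg)
  then show ?thesis using E_iff[OF d] by blast
qed

end

section \<open>Generating families from freeness and finite generation, and the notion of minimal
  cover\<close>

lemma bij_lin_homs_inv:
  assumes M: "left_module R M" and f: "f \<in> lin_homs R M N" and bij: "bij_betw f (carrier M) (carrier N)"
  shows "inv_into (carrier M) f \<in> lin_homs R N M"
proof (rule lin_homsI)
  interpret M: left_module R M by (rule M)
  have im: "carrier N = f ` carrier M" and inj: "inj_on f (carrier M)" using bij by (auto simp: bij_betw_def)
  show "inv_into (carrier M) f y \<in> carrier M" if "y \<in> carrier N" for y
    using that unfolding im by (rule inv_into_into)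
  show "inv_into (carrier M) f (y \<oplus>\<^bsub>N\<^esub> z) = inv_into (carrier M) f y \<oplus>\<^bsub>M\<^esub> inv_into (carrier M) f z"
    if "y \<in> carrier N" "z \<in> carrier N" for y z
    using that unfolding im by (auto simp: inj inv_into_f_f simp flip: lin_homs_add[OF f])
  show "inv_into (carrier M) f (r \<odot>\<^bsub>N\<^esub> y) = r \<odot>\<^bsub>M\<^esub> inv_into (carrier M) f y"
    if "r \<in> carrier R" "y \<in> carrier N" for r y
    using that unfolding im by (auto simp: inj inv_into_f_f M.smult_closed simp flip: lin_homs_smult[OF f])
qed

text \<open>The images of the point masses under the isomorphism from the span form a basis. It is
  recorded through generation and extension of maps, the two properties the construction of covers
  consumes.\<close>

lemma free_left_module_generators:
  fixes N :: "('r, 'u) module"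
  assumes R: "ring R" and N: "free_left_module R N"
  obtains B :: "'u set" and q where "\<And>b. b \<in> B \<Longrightarrow> q b \<in> carrier N"
    "\<And>H. submodule H R N \<Longrightarrow> (\<And>b. b \<in> B \<Longrightarrow> q b \<in> H) \<Longrightarrow> H = carrier N"
    "\<And>(L :: ('r, 'u) module) y. left_module R L \<Longrightarrow> (\<And>b. b \<in> B \<Longrightarrow> y b \<in> carrier L) \<Longrightarrow>
      \<exists>\<psi> \<in> lin_homs R N L. \<forall>b \<in> B. \<psi> (q b) = y b"
proof -
  interpret R: ring R by (rule R)
  obtain B :: "'u set" and f where f: "f \<in> lin_homs R (span_module R B) N"
    and bij: "bij_betw f (carrier (span_module R B)) (carrier N)" and kN: "left_module R N"
    using N by (auto simp: free_left_module_def)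
  note S = left_module_span[OF R, of B]
  let ?q = "\<lambda>b. f (delta R B b \<one>\<^bsub>R\<^esub>)"
  have d: "delta R B b \<one>\<^bsub>R\<^esub> \<in> carrier (span_module R B)" if "b \<in> B" for b
    by (rule delta_closed[OF R that R.one_closed])
  have im: "f ` carrier (span_module R B) = carrier N" and inj: "inj_on f (carrier (span_module R B))"
    using bij unfolding bij_betw_def by blast+
  show thesis
  proof
    show "?q b \<in> carrier N" if "b \<in> B" for b by (rule lin_homs_closed[OF f d[OF that]])
    show "H = carrier N" if H: "submodule H R N" and q: "\<And>b. b \<in> B \<Longrightarrow> ?q b \<in> H" for H
    proof -
      have "{x \<in> carrier (span_module R B). f x \<in> H} = carrier (span_module R B)"
        by (rule span_submodule_eq[OF R submodule_vimage[OF S kN f H]]) (use q d in blast)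
      then have "carrier N \<subseteq> H" unfolding im[symmetric] by blast
      moreover have "H \<subseteq> carrier N" by (rule H[unfolded left_module.submodule_iff[OF kN], THEN conjunct1])
      ultimately show ?thesis by simp
    qed
    fix L :: "('r, 'u) module" and y
    assume L: "left_module R L" and y: "\<And>b. b \<in> B \<Longrightarrow> y b \<in> carrier L"
    interpret L: left_module R L by (rule L)
    let ?s = "span_lift R B L y"
    let ?\<psi> = "\<lambda>x. ?s (inv_into (carrier (span_module R B)) f x)"
    show "\<exists>\<psi> \<in> lin_homs R N L. \<forall>b \<in> B. \<psi> (?q b) = y b"
    proof (intro bexI ballI)
      show "?\<psi> \<in> lin_homs R N L"
        by (rule lin_homs_compose[OF bij_lin_homs_inv[OF S f bij] span_lift_lin[OF R L y]])
      show "?\<psi> (?q b) = y b" if b: "b \<in> B" for b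
        using span_lift_delta[OF R L y b R.one_closed] L.smult_one[OF y[OF b]]
        by (simp only: inv_into_f_f[OF inj d[OF b]])
    qed
  qed
qed

context kc_setting
begin

interpretation K: cring K by (rule cring_K)

text \<open>The images of the Yoneda generators generate: a submodule of \<open>val M d\<close>
  containing their translates has full preimage in the free module.\<close>

lemma fin_genE:
  assumes "fin_gen K C M"
  obtains B :: "'o \<Rightarrow> nat set" and y where "finite_basis C B"
    "\<And>i. i \<in> Sigma (Obj C) B \<Longrightarrow> y i \<in> carrier (val M (fst i))"
    "\<And>d H. d \<in> Obj C \<Longrightarrow> submodule H K (val M d) \<Longrightarrow>
      (\<And>i v. i \<in> Sigma (Obj C) B \<Longrightarrow> v \<in> homs C (fst i) d \<Longrightarrow> act M v (y i) \<in> H) \<Longrightarrow> H = carrier (val M d)"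
proof -
  obtain B :: "'o \<Rightarrow> nat set" and f where M: "kcm M" and B: "finite_basis C B" and f: "f \<in> nat_trans K C (free_on K C B) M"
    and surj: "\<And>d. d \<in> Obj C \<Longrightarrow> f d ` carrier (val (free_on K C B) d) = carrier (val M d)"
    using assms by (auto simp: fin_gen_def)
  note base = free_on_basis[of B, where 'n = nat] and fh = nat_trans_kc_hom[OF f]
  note kF = kc_basis_kcm[OF base]
  show thesis
  proof
    show "finite_basis C B" by (rule B)
    show "f (fst i) (free_gen B i) \<in> carrier (val M (fst i))" if "i \<in> Sigma (Obj C) B" for i
      by (rule kc_hom_closed[OF fh kc_basis_ob[OF base that] kc_basis_gen[OF base that]])
    fix d H assume d: "d \<in> Obj C" and H: "submodule H K (val M d)"
      and gens: "\<And>i v. i \<in> Sigma (Obj C) B \<Longrightarrow> v \<in> homs C (fst i) d \<Longrightarrow> act M v (f (fst i) (free_gen B i)) \<in> H"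
    have "{x \<in> carrier (val (free_on K C B) d). f d x \<in> H} = carrier (val (free_on K C B) d)"
    proof (rule kc_basis_span[OF base d submodule_vimage[OF kcm_val[OF kF d] kcm_val[OF M d] kc_hom_lin[OF fh d] H]])
      fix i v assume iv: "i \<in> Sigma (Obj C) B" "v \<in> homs C (fst i) d"
      have "f d (act (free_on K C B) v (free_gen B i)) \<in> H"
        using gens[OF iv] by (simp only: kc_hom_nat[OF fh iv(2) kc_basis_gen[OF base iv(1)]])
      then show "act (free_on K C B) v (free_gen B i) \<in> {x \<in> carrier (val (free_on K C B) d). f d x \<in> H}"
        using kcm_act_closed[OF kF iv(2) kc_basis_gen[OF base iv(1)]] by blast
    qed
    then have "carrier (val M d) \<subseteq> H" unfolding surj[OF d, symmetric] by blast
    moreover have "H \<subseteq> carrier (val M d)" by (rule H[unfolded left_module.submodule_iff[OF kcm_val[OF M d]], THEN conjunct1])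
    ultimately show "H = carrier (val M d)" by simp
  qed
qed

text \<open>\<open>fin_gen\<close> demands index sets of natural numbers. Finiteness per class makes
  each \<open>B c\<close> finite, so it is replaced by an initial segment of the naturals of the
  same size.\<close>

lemma fin_genI:
  fixes B :: "'o \<Rightarrow> 'b set"
  assumes M: "kcm M" and B: "finite_basis C B"
    and y: "\<And>i. i \<in> Sigma (Obj C) B \<Longrightarrow> y i \<in> carrier (val M (fst i))"
    and span: "\<And>d H. d \<in> Obj C \<Longrightarrow> submodule H K (val M d) \<Longrightarrow>
      (\<And>i v. i \<in> Sigma (Obj C) B \<Longrightarrow> v \<in> homs C (fst i) d \<Longrightarrow> act M v (y i) \<in> H) \<Longrightarrow> H = carrier (val M d)"
  shows "fin_gen K C M"
proof -
  have fin: "finite (B c)" if c: "c \<in> Obj C" for c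
  proof -
    \<comment> \<open>An object belongs to its own class, so its index set embeds into the finite
      sum over the class.\<close>
    have "Pair c ` B c \<subseteq> (SIGMA d : cl C c. B d)" using c Id_nonempty by (auto simp: cl_iff)
    moreover have "finite (SIGMA d : cl C c. B d)" using B c by (simp add: finite_basis_def)
    ultimately have "finite (Pair c ` B c)" by (rule finite_subset)
    then show ?thesis by (rule finite_imageD) (simp add: inj_on_def)
  qed
  have "\<forall>c. \<exists>h. c \<in> Obj C \<longrightarrow> bij_betw h {0..<card (B c)} (B c)"
    using ex_bij_betw_nat_finite[OF fin] by blast
  from choice[OF this] obtain h where h: "\<And>c. c \<in> Obj C \<Longrightarrow> bij_betw (h c) {0..<card (B c)} (B c)"
    by blast
  define B' where "B' = (\<lambda>c. {0..<card (B c)})"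
  have h_inj: "inj_on (h c) (B' c)" and h_im: "h c ` B' c = B c" if "c \<in> Obj C" for c
    using h[OF that] by (auto simp: bij_betw_def B'_def)
  have B': "finite_basis C B'"
    unfolding finite_basis_def finite_type_def
  proof (intro conjI ballI)
    have "finite {cl C c |c. c \<in> Obj C \<and> B c \<noteq> {}}" using B by (simp add: finite_basis_def finite_type_def)
    then show "finite {cl C c |c. c \<in> Obj C \<and> B' c \<noteq> {}}"
      by (rule rev_finite_subset) (auto simp: B'_def)
    fix c assume c: "c \<in> Obj C"
    have sub: "d \<in> Obj C" if "d \<in> cl C c" for d using that c by (simp add: cl_iff)
    have "finite (SIGMA d : cl C c. B d)" using B c by (simp add: finite_basis_def)
    moreover have "(\<lambda>(d, n). (d, h d n)) ` (SIGMA d : cl C c. B' d) \<subseteq> (SIGMA d : cl C c. B d)"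
      using h_im[OF sub] by auto
    ultimately have "finite ((\<lambda>(d, n). (d, h d n)) ` (SIGMA d : cl C c. B' d))" by (rule rev_finite_subset)
    then show "finite (SIGMA d : cl C c. B' d)"
      by (rule finite_imageD) (use h_inj[OF sub] in \<open>auto simp: inj_on_def\<close>)
  qed
  let ?y = "\<lambda>i. y (fst i, h (fst i) (snd i))"
  have hi: "(fst i, h (fst i) (snd i)) \<in> Sigma (Obj C) B" if "i \<in> Sigma (Obj C) B'" for i
    using that h_im by fastforce
  note base = free_on_basis[of B', where 'n = 'c]
  note kF = kc_basis_kcm[OF base]
  have y': "?y i \<in> carrier (val M (fst i))" if "i \<in> Sigma (Obj C) B'" for i
    using y[OF hi[OF that]] by simp
  show ?thesis
  proof (rule kc_basis_universal[OF base M y'])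
    fix f assume f: "kc_hom K C (free_on K C B') M f"
      and fv: "\<And>i d v. i \<in> Sigma (Obj C) B' \<Longrightarrow> v \<in> homs C (fst i) d \<Longrightarrow>
        f d (act (free_on K C B') v (free_gen B' i)) = act M v (?y i)"
    have surj: "f d ` carrier (val (free_on K C B') d) = carrier (val M d)" if d: "d \<in> Obj C" for d
    proof (rule span[OF d submodule_image[OF kcm_val[OF kF d] kcm_val[OF M d] kc_hom_lin[OF f d]
            left_module.submodule_carrier[OF kcm_val[OF kF d]]]])
      fix i v assume i: "i \<in> Sigma (Obj C) B" and v: "v \<in> homs C (fst i) d"
      obtain c b where cb: "i = (c, b)" "c \<in> Obj C" "b \<in> B c" using i by auto
      obtain n where n: "n \<in> B' c" "h c n = b" using cb(3) unfolding h_im[OF cb(2), symmetric] by auto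
      have j: "(c, n) \<in> Sigma (Obj C) B'" using n cb by simp
      have vj: "v \<in> homs C (fst (c, n)) d" using v cb by simp
      have "f d (act (free_on K C B') v (free_gen B' (c, n))) = act M v (y i)"
        using fv[OF j vj] n cb by simp
      then show "act M v (y i) \<in> f d ` carrier (val (free_on K C B') d)"
        using kcm_act_closed[OF kF vj kc_basis_gen[OF base j]] by (metis image_eqI)
    qed
    let ?f = "\<lambda>c\<in>Obj C. restrict (f c) (carrier (val (free_on K C B') c))"
    have "?f \<in> nat_trans K C (free_on K C B') M" by (rule kc_hom_nat_trans[OF kF f])
    moreover have "?f d ` carrier (val (free_on K C B') d) = carrier (val M d)" if "d \<in> Obj C" for d
      using surj[OF that] that by simp
    ultimately show "fin_gen K C M" unfolding fin_gen_def using M B' by blast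
  qed
qed

text \<open>A projective cover in terms of surjections and submodules, together with a support
  bound. The bound is part of the notion because the kernel inherits it and needs it for the next
  step.\<close>

definition min_cover ::
  "'o set set \<Rightarrow> ('o, 'm, 'k, 'u) kc_module \<Rightarrow> ('o, 'm, 'k, 'u) kc_module \<Rightarrow> ('o \<Rightarrow> 'u \<Rightarrow> 'u) \<Rightarrow> bool" where
  "min_cover U M P f \<longleftrightarrow> kcm P \<and> projective (kC_cat K C) P \<and> kc_hom K C P M f \<and>
    (\<forall>d \<in> Obj C. f d ` carrier (val P d) = carrier (val M d)) \<and>
    (\<forall>L. kc_submodule K C P L \<longrightarrow> (\<forall>d \<in> Obj C. f d ` L d = carrier (val M d)) \<longrightarrow>
      (\<forall>d \<in> Obj C. L d = carrier (val P d))) \<and>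
    supp_in U P"

lemma min_cover_projective_cover:
  assumes M: "kcm M" and P: "min_cover U M P f"
  shows "projective_cover (kC_cat K C) (kc_arrow C P M f) M"
proof -
  have kP: "kcm P" and pP: "projective (kC_cat K C) P" and f: "kc_hom K C P M f"
    and surj: "\<And>d. d \<in> Obj C \<Longrightarrow> f d ` carrier (val P d) = carrier (val M d)"
    and sup: "\<And>L. kc_submodule K C P L \<Longrightarrow> (\<And>d. d \<in> Obj C \<Longrightarrow> f d ` L d = carrier (val M d)) \<Longrightarrow>
      (\<And>d. d \<in> Obj C \<Longrightarrow> L d = carrier (val P d))"
    using P by (simp_all add: min_cover_def)
  let ?p = "kc_arrow C P M f"
  have pm: "?p \<in> Mor (kC_cat K C)" by (rule kc_arrow_Mor[OF kP M f])
  have im: "fn ?p d ` L = f d ` L" if "d \<in> Obj C" "L \<subseteq> carrier (val P d)" for d L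
    using that by (intro image_cong) auto
  have ep: "epic (kC_cat K C) ?p"
    unfolding epic_kC_iff using pm im surj by simp
  have "superfluous (kC_cat K C) ?p"
  proof (rule superfluous_kCI[OF ep])
    fix L d
    assume L: "kc_submodule K C (src ?p) L"
      and e: "\<And>c. c \<in> Obj C \<Longrightarrow> fn ?p c ` L c = carrier (val (tgt ?p) c)" and d: "d \<in> Obj C"
    have L': "kc_submodule K C P L" using L by simp
    have "f c ` L c = carrier (val M c)" if "c \<in> Obj C" for c
      using e[OF that] im[OF that kc_submoduleD(1)[OF kP L' that]] by simp
    from sup[OF L' this d] show "L d = carrier (val (src ?p) d)" by simp
  qed
  then show ?thesis using pm pP by (simp add: projective_cover_def)
qed

lemma supp_in_mono_sub:
  assumes "supp_in U P" and N: "kcm N" and "\<And>c. c \<in> Obj C \<Longrightarrow> carrier (val N c) \<subseteq> carrier (val P c)"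
    and z: "\<And>c. c \<in> Obj C \<Longrightarrow> \<zero>\<^bsub>val N c\<^esub> = \<zero>\<^bsub>val P c\<^esub>"
  shows "supp_in U N"
  unfolding supp_in_def
proof (intro ballI impI)
  fix c assume c: "c \<in> Obj C" and ne: "carrier (val N c) \<noteq> {\<zero>\<^bsub>val N c\<^esub>}"
  interpret V: left_module K "val N c" by (rule kcm_val[OF N c])
  have "carrier (val P c) \<noteq> {\<zero>\<^bsub>val P c\<^esub>}"
  proof
    assume "carrier (val P c) = {\<zero>\<^bsub>val P c\<^esub>}"
    then show False using ne assms(3)[OF c] z[OF c] V.M.zero_closed by auto
  qed
  then show "cl C c \<in> U" using assms(1) c by (auto simp: supp_in_def)
qed

lemma split_nonzero_supp:
  assumes "supp_in U N" and N: "kcm N" and c: "c \<in> Obj C" and ne: "non N c \<noteq> carrier (val N c)"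
  shows "cl C c \<in> U"
proof -
  have "submodule (non N c) K (val N c)" by (rule submodule_non[OF N c])
  then have "\<zero>\<^bsub>val N c\<^esub> \<in> non N c" by (simp add: left_module.submodule_iff[OF kcm_val[OF N c]])
  then have "carrier (val N c) \<noteq> {\<zero>\<^bsub>val N c\<^esub>}" using ne non_carrier[OF N c] by auto
  then show ?thesis using assms(1) c by (auto simp: supp_in_def)
qed

lemma cover_unique:
  assumes M: "kcm M" and P: "min_cover U M P f" and p': "projective_cover (kC_cat K C) p' M"
  obtains h where "kc_hom K C P (src p') h"
    "\<And>d. d \<in> Obj C \<Longrightarrow> bij_betw (h d) (carrier (val P d)) (carrier (val (src p') d))"
proof -
  interpret cat: category "kC_cat K C" by (rule category_kC_cat[OF category_axioms])
  let ?p = "kc_arrow C P M f" and ?K = "kC_cat K C"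
  have pc: "projective_cover ?K ?p M" by (rule min_cover_projective_cover[OF M P])
  have pm: "?p \<in> homs ?K P M" using pc by (simp add: projective_cover_def homs_def)
  have pm': "p' \<in> homs ?K (src p') M" using p' by (simp add: projective_cover_def homs_def)
  have sup: "superfluous ?K ?p" and sup': "superfluous ?K p'" using pc p' by (simp_all add: projective_cover_def)
  have ep: "epic ?K ?p" and ep': "epic ?K p'" using sup sup' by (simp_all add: superfluous_def)
  have pP: "projective ?K P" and pP': "projective ?K (src p')" using pc p' by (simp_all add: projective_cover_def)
  obtain h where h: "h \<in> homs ?K P (src p')" "p' \<diamondop>\<^bsub>?K\<^esub> h = ?p"
    using pP[unfolded projective_def, THEN conjunct2, rule_format, of p' ?p] ep' pm pm'
    by (auto simp: homs_def simp del: kC_cat_simps(4))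
  have "epic ?K h"
    using sup'[unfolded superfluous_def, THEN conjunct2, rule_format, of h] h ep
    by (simp add: homs_def del: kC_cat_simps(4))
  moreover have id: "Id ?K (src p') \<in> homs ?K (src p') (src p')"
    by (rule cat.Id_closed) (use pP' in \<open>simp add: projective_def\<close>)
  ultimately obtain s where s: "s \<in> homs ?K (src p') P" "h \<diamondop>\<^bsub>?K\<^esub> s = Id ?K (src p')"
    using pP'[unfolded projective_def, THEN conjunct2, rule_format, of h "Id ?K (src p')"] h
    by (auto simp: homs_def simp del: kC_cat_simps(4))
  have "?p \<diamondop>\<^bsub>?K\<^esub> s = p' \<diamondop>\<^bsub>?K\<^esub> (h \<diamondop>\<^bsub>?K\<^esub> s)"
    unfolding h(2)[symmetric] by (rule cat.Comp_assoc[OF s(1) h(1) pm'])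
  also have "\<dots> = p'" unfolding s(2) by (rule cat.Comp_Id_right[OF pm'])
  finally have "epic ?K s"
    using sup[unfolded superfluous_def, THEN conjunct2, rule_format, of s] s ep'
    by (simp add: homs_def del: kC_cat_simps(4))
  then have s_surj: "fn s d ` carrier (val (src p') d) = carrier (val P d)" if "d \<in> Obj C" for d
    using that s(1) by (simp add: epic_kC_iff homs_def)
  have hs: "fn h d (fn s d z) = z" if "d \<in> Obj C" "z \<in> carrier (val (src p') d)" for d z
  proof -
    have "fn (h \<diamondop>\<^bsub>?K\<^esub> s) d z = fn (Id ?K (src p')) d z" by (simp only: s(2))
    then show ?thesis using that s(1) by (simp add: kC_cat_def homs_def compose_def)
  qed
  have hm: "h \<in> Mor ?K" "src h = P" "tgt h = src p'" using h(1) by (simp_all add: homs_def)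
  show thesis
  proof
    show hh: "kc_hom K C P (src p') (fn h)" using Mor_kc_hom[OF hm(1)] hm by simp
    fix d assume d: "d \<in> Obj C"
    have sc: "fn s d z \<in> carrier (val P d)" if "z \<in> carrier (val (src p') d)" for z
      using s_surj[OF d] that by blast
    show "bij_betw (fn h d) (carrier (val P d)) (carrier (val (src p') d))"
      unfolding bij_betw_def
    proof
      show "inj_on (fn h d) (carrier (val P d))"
        unfolding s_surj[OF d, symmetric] by (rule inj_onI) (auto simp: hs[OF d])
      show "fn h d ` carrier (val P d) = carrier (val (src p') d)"
        unfolding s_surj[OF d, symmetric] by (force simp: hs[OF d] image_image)
    qed
  qed
qed

lemma free_kc_module_iso:
  fixes P N :: "('o, 'm, 'k, 'u) kc_module"
  assumes P: "free_kc_module K C P" and N: "kcm N" and h: "kc_hom K C P N h"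
    and bij: "\<And>d. d \<in> Obj C \<Longrightarrow> bij_betw (h d) (carrier (val P d)) (carrier (val N d))"
  shows "free_kc_module K C N"
proof -
  obtain B :: "'o \<Rightarrow> 'u set" and f where f: "f \<in> nat_trans K C (free_on K C B) P"
    and fb: "\<And>d. d \<in> Obj C \<Longrightarrow> bij_betw (f d) (carrier (val (free_on K C B) d)) (carrier (val P d))"
    using P by (auto simp: free_kc_module_def)
  note kF = kc_basis_kcm[OF free_on_basis[of B, where 'n = nat]]
  let ?F = "free_on K C B"
  let ?f = "\<lambda>c\<in>Obj C. restrict (\<lambda>x. h c (f c x)) (carrier (val ?F c))"
  have "?f \<in> nat_trans K C ?F N"
    by (rule kc_hom_nat_trans[OF kF kc_hom_compose[OF nat_trans_kc_hom[OF f] h]])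
  moreover have "bij_betw (?f d) (carrier (val ?F d)) (carrier (val N d))" if d: "d \<in> Obj C" for d
    using bij_betw_trans[OF fb[OF d] bij[OF d]] d
    by (subst bij_betw_cong[where g = "h d \<circ> f d"]) auto
  ultimately show ?thesis unfolding free_kc_module_def using N by blast
qed

text \<open>The locale construction for an arbitrary generating family \<open>q\<close>. Finiteness
  of the family gives finite generation of \<open>P\<close>; if \<open>q\<close> admits extensions
  like a basis, \<open>P\<close> is all of \<open>F\<close> and so free.\<close>

lemma cover_exists:
  fixes M :: "('o, 'm, 'k, 'u) kc_module" and B :: "'o \<Rightarrow> 'u set"
  assumes univ: "infinite (UNIV :: 'u set)" "carrier K \<lesssim> (UNIV :: 'u set)" "Mor C \<lesssim> (UNIV :: 'u set)"
    and kM: "kcm M" and A: "artinian C A" "upper_set C A" "supp_in A M"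
    and D: "D = {c \<in> Obj C. crep c = c \<and> non M c \<noteq> carrier (val M c)}"
    and U: "upper_set C U" "\<And>c. c \<in> D \<Longrightarrow> cl C c \<in> U"
    and B: "\<And>c. c \<in> Obj C \<Longrightarrow> c \<notin> D \<Longrightarrow> B c = {}"
    and p: "\<And>c. c \<in> D \<Longrightarrow> projective_cover (Mod_cat (R c)) (p c) (spl M c)"
    and q: "\<And>c b. c \<in> D \<Longrightarrow> b \<in> B c \<Longrightarrow> q c b \<in> carrier (src (p c))"
    and q_span: "\<And>c H. c \<in> D \<Longrightarrow> submodule H (R c) (src (p c)) \<Longrightarrow> (\<And>b. b \<in> B c \<Longrightarrow> q c b \<in> H) \<Longrightarrow>
      H = carrier (src (p c))"
  obtains P f where "min_cover U M P f" "finite_basis C B \<Longrightarrow> fin_gen K C P"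
    "(\<And>c (N :: ('m \<Rightarrow> 'k, 'u) module) y. c \<in> D \<Longrightarrow> left_module (R c) N \<Longrightarrow> (\<And>b. b \<in> B c \<Longrightarrow> y b \<in> carrier N) \<Longrightarrow>
       \<exists>\<psi> \<in> lin_homs (R c) (src (p c)) N. \<forall>b \<in> B c. \<psi> (q c b) = y b) \<Longrightarrow> free_kc_module K C P"
proof (rule free_in_universe[OF univ, of B])
  fix F :: "('o, 'm, 'k, 'u) kc_module" and \<phi> g
  assume basis: "kc_basis TYPE('u) F (Sigma (Obj C) B) fst g" and \<phi>: "kc_hom K C (free_on K C B) F \<phi>"
    and bij: "\<And>d. d \<in> Obj C \<Longrightarrow> bij_betw (\<phi> d) (carrier (val (free_on K C B) d)) (carrier (val F d))"
  interpret cover_data C K M F A D B q g p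
    by unfold_locales (fact kM A D B p q q_span basis)+
  show thesis
  proof (rule that)
    show "min_cover U M P f"
      unfolding min_cover_def
      using kP P_projective f_hom P_surj P_superfluous P_supp[OF U] by simp
    show "fin_gen K C P" if "finite_basis C B"
      by (rule fin_genI[OF kP that s_P P_span])
    assume \<psi>: "\<And>c (N :: ('m \<Rightarrow> 'k, 'u) module) y. c \<in> D \<Longrightarrow> left_module (R c) N \<Longrightarrow> (\<And>b. b \<in> B c \<Longrightarrow> y b \<in> carrier N) \<Longrightarrow>
       \<exists>\<psi> \<in> lin_homs (R c) (src (p c)) N. \<forall>b \<in> B c. \<psi> (q c b) = y b"
    have "\<exists>\<psi> \<in> lin_homs (R c) (src (p c)) (loc F c). \<forall>b \<in> B c. \<psi> (q c b) = g (c, b)" if c: "c \<in> D" for c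
      by (rule \<psi>[OF c left_module_loc[OF kF D_Obj[OF c]]]) (use gen_closed D_Obj[OF c] in force)
    then have Ed: "E d = carrier (val F d)" if "d \<in> Obj C" for d
      by (rule P_free[OF _ that])
    have \<phi>P: "kc_hom K C (free_on K C B) P \<phi>"
      using \<phi> Ed by (auto simp: kc_hom_def lin_homs_def)
    note kfree = kc_basis_kcm[OF free_on_basis[of B, where 'n = nat]]
    let ?f = "\<lambda>c\<in>Obj C. restrict (\<phi> c) (carrier (val (free_on K C B) c))"
    have "?f \<in> nat_trans K C (free_on K C B) P" by (rule kc_hom_nat_trans[OF kfree \<phi>P])
    moreover have "bij_betw (?f d) (carrier (val (free_on K C B) d)) (carrier (val P d))" if d: "d \<in> Obj C" for d
      using bij[OF d] d Ed[OF d] by (subst bij_betw_cong[where g = "\<phi> d"]) auto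
    ultimately show "free_kc_module K C P" unfolding free_kc_module_def using kP by blast
  qed
qed


section \<open>Minimal covers under the perfect, free and semi-perfect hypotheses\<close>

context
  fixes M :: "('o, 'm, 'k, 'u) kc_module" and A U :: "'o set set"
  assumes univ: "infinite (UNIV :: 'u set)" "carrier K \<lesssim> (UNIV :: 'u set)" "Mor C \<lesssim> (UNIV :: 'u set)"
    and kM: "kcm M" and A: "artinian C A" "upper_set C A" "supp_in A M"
    \<comment> \<open>\<open>U\<close> is required to contain the classes with nonzero split
      quotient, while the support is bounded by \<open>A\<close>. This is the information available
      for the initial module and suffices to apply the ring hypotheses.\<close>
    and U: "upper_set C U" and nz: "\<And>c. c \<in> Obj C \<Longrightarrow> non M c \<noteq> carrier (val M c) \<Longrightarrow> cl C c \<in> U"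
begin

abbreviation (input) "Dm \<equiv> {c \<in> Obj C. crep c = c \<and> non M c \<noteq> carrier (val M c)}"

lemma Dm_U: "c \<in> Dm \<Longrightarrow> cl C c \<in> U"
  using nz by simp

lemma choose_covers:
  assumes "\<And>c. c \<in> Obj C \<Longrightarrow> cl C c \<in> U \<Longrightarrow> \<exists>p. projective_cover (Mod_cat (R c)) p (spl M c)"
  obtains p where "\<And>c. c \<in> Dm \<Longrightarrow> projective_cover (Mod_cat (R c)) (p c) (spl M c)"
proof -
  have "\<forall>c. \<exists>p. c \<in> Dm \<longrightarrow> projective_cover (Mod_cat (R c)) p (spl M c)"
    using assms Dm_U by blast
  from choice[OF this] show thesis using that by blast
qed

text \<open>All elements of the covering module serve as its generators.\<close>

lemma cover_perfect:
  assumes perf: "\<And>c. c \<in> Obj C \<Longrightarrow> cl C c \<in> U \<Longrightarrow> perfect_ring TYPE('u) (R c)"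
  shows "\<exists>P f. min_cover U M P f"
proof (rule choose_covers)
  show "\<exists>p. projective_cover (Mod_cat (R c)) p (spl M c)" if "c \<in> Obj C" "cl C c \<in> U" for c
    using perf[OF that] left_module_spl[OF kM that(1)] by (simp add: perfect_ring_def)
  fix p assume p: "\<And>c. c \<in> Dm \<Longrightarrow> projective_cover (Mod_cat (R c)) (p c) (spl M c)"
  let ?B = "\<lambda>c. if c \<in> Dm then carrier (src (p c)) else {}"
  show ?thesis
  proof (rule cover_exists[OF univ kM A refl U Dm_U, of ?B p "\<lambda>_ b. b"])
    fix c H assume c: "c \<in> Dm" and H: "submodule H (R c) (src (p c))" and sub: "\<And>b. b \<in> ?B c \<Longrightarrow> b \<in> H"
    have Q: "left_module (R c) (src (p c))"
      using p[OF c] by (simp add: projective_cover_def projective_def)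
    have "carrier (src (p c)) \<subseteq> H" using sub c by auto
    moreover have "H \<subseteq> carrier (src (p c))" by (rule H[unfolded left_module.submodule_iff[OF Q], THEN conjunct1])
    ultimately show "H = carrier (src (p c))" by simp
  qed (use p in \<open>auto split: if_splits\<close>)
qed

text \<open>The covering modules over the group rings are projective, hence free, and a basis of
  each is used as generating family.\<close>

lemma cover_free:
  assumes perf: "\<And>c. c \<in> Obj C \<Longrightarrow> cl C c \<in> U \<Longrightarrow> perfect_ring TYPE('u) (R c)"
    and free: "\<And>c (N :: ('m \<Rightarrow> 'k, 'u) module). c \<in> Obj C \<Longrightarrow> cl C c \<in> U \<Longrightarrow>
      projective (Mod_cat (R c)) N \<Longrightarrow> free_left_module (R c) N"
  shows "\<exists>P f. min_cover U M P f \<and> free_kc_module K C P"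
proof (rule choose_covers)
  show "\<exists>p. projective_cover (Mod_cat (R c)) p (spl M c)" if "c \<in> Obj C" "cl C c \<in> U" for c
    using perf[OF that] left_module_spl[OF kM that(1)] by (simp add: perfect_ring_def)
  fix p assume p: "\<And>c. c \<in> Dm \<Longrightarrow> projective_cover (Mod_cat (R c)) (p c) (spl M c)"
  \<comment> \<open>An index set and a family of elements are packed into a pair, so that one choice
    over all objects yields both.\<close>
  define G where "G c Bq \<longleftrightarrow> (\<forall>b \<in> fst Bq. snd Bq b \<in> carrier (src (p c))) \<and>
    (\<forall>H. submodule H (R c) (src (p c)) \<longrightarrow> (\<forall>b \<in> fst Bq. snd Bq b \<in> H) \<longrightarrow> H = carrier (src (p c))) \<and>
    (\<forall>(L :: ('m \<Rightarrow> 'k, 'u) module) y. left_module (R c) L \<longrightarrow> (\<forall>b \<in> fst Bq. y b \<in> carrier L) \<longrightarrow>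
      (\<exists>\<psi> \<in> lin_homs (R c) (src (p c)) L. \<forall>b \<in> fst Bq. \<psi> (snd Bq b) = y b))"
    for c and Bq :: "'u set \<times> ('u \<Rightarrow> 'u)"
  have "\<exists>Bq :: 'u set \<times> ('u \<Rightarrow> 'u). G c Bq" if c: "c \<in> Dm" for c
  proof -
    have cO: "c \<in> Obj C" using c by simp
    have "projective (Mod_cat (R c)) (src (p c))" using p[OF c] by (simp add: projective_cover_def)
    then have "free_left_module (R c) (src (p c))" by (rule free[OF cO Dm_U[OF c]])
    then show ?thesis
    proof (rule free_left_module_generators[OF ring_R[OF cO]])
      fix B :: "'u set" and q
      assume 1: "\<And>b. b \<in> B \<Longrightarrow> q b \<in> carrier (src (p c))"
        and 2: "\<And>H. submodule H (R c) (src (p c)) \<Longrightarrow> (\<And>b. b \<in> B \<Longrightarrow> q b \<in> H) \<Longrightarrow> H = carrier (src (p c))"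
        and 3: "\<And>(L :: ('m \<Rightarrow> 'k, 'u) module) y. left_module (R c) L \<Longrightarrow> (\<And>b. b \<in> B \<Longrightarrow> y b \<in> carrier L) \<Longrightarrow>
          \<exists>\<psi> \<in> lin_homs (R c) (src (p c)) L. \<forall>b \<in> B. \<psi> (q b) = y b"
      show ?thesis
      proof (rule exI[of _ "(B, q)"], unfold G_def fst_conv snd_conv, intro conjI ballI allI impI)
        show "q b \<in> carrier (src (p c))" if "b \<in> B" for b by (rule 1[OF that])
        show "H = carrier (src (p c))" if "submodule H (R c) (src (p c))" "\<forall>b \<in> B. q b \<in> H" for H
          by (rule 2[OF that(1)]) (use that(2) in blast)
        show "\<exists>\<psi> \<in> lin_homs (R c) (src (p c)) L. \<forall>b \<in> B. \<psi> (q b) = y b"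
          if "left_module (R c) L" "\<forall>b \<in> B. y b \<in> carrier L" for L :: "('m \<Rightarrow> 'k, 'u) module" and y
          by (rule 3[OF that(1)]) (use that(2) in blast)
      qed
    qed
  qed
  then have "\<forall>c. \<exists>Bq :: 'u set \<times> ('u \<Rightarrow> 'u). c \<in> Dm \<longrightarrow> G c Bq" by blast
  from choice[OF this] obtain Bq :: "'o \<Rightarrow> 'u set \<times> ('u \<Rightarrow> 'u)" where Bq: "\<And>c. c \<in> Dm \<Longrightarrow> G c (Bq c)"
    by blast
  let ?B = "\<lambda>c. if c \<in> Dm then fst (Bq c) else {}"
  show ?thesis
  proof (rule cover_exists[OF univ kM A refl U Dm_U, of ?B p "\<lambda>c. snd (Bq c)"])
    fix P f assume P: "min_cover U M P f"
      and fr: "(\<And>c (N :: ('m \<Rightarrow> 'k, 'u) module) y. c \<in> Dm \<Longrightarrow> left_module (R c) N \<Longrightarrow> (\<And>b. b \<in> ?B c \<Longrightarrow> y b \<in> carrier N) \<Longrightarrow>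
       \<exists>\<psi> \<in> lin_homs (R c) (src (p c)) N. \<forall>b \<in> ?B c. \<psi> (snd (Bq c) b) = y b) \<Longrightarrow> free_kc_module K C P"
    have "free_kc_module K C P"
    proof (rule fr)
      fix c and N :: "('m \<Rightarrow> 'k, 'u) module" and y
      assume c: "c \<in> Dm" and "left_module (R c) N" "\<And>b. b \<in> ?B c \<Longrightarrow> y b \<in> carrier N"
      then show "\<exists>\<psi> \<in> lin_homs (R c) (src (p c)) N. \<forall>b \<in> ?B c. \<psi> (snd (Bq c) b) = y b"
        using Bq[OF c, unfolded G_def, THEN conjunct2, THEN conjunct2, rule_format, of N y] by simp
    qed
    then show ?thesis using P by blast
  next
    fix c b assume c: "c \<in> Dm" "b \<in> ?B c"
    then show "snd (Bq c) b \<in> carrier (src (p c))" using Bq[OF c(1), unfolded G_def, THEN conjunct1] by auto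
  next
    fix c H assume c: "c \<in> Dm" and "submodule H (R c) (src (p c))" "\<And>b. b \<in> ?B c \<Longrightarrow> snd (Bq c) b \<in> H"
    then show "H = carrier (src (p c))"
      using Bq[OF c, unfolded G_def, THEN conjunct2, THEN conjunct1, rule_format, of H] by simp
  qed (use p in auto)
qed

text \<open>Generators of \<open>M\<close> at objects not isomorphic to \<open>c\<close> reach
  \<open>c\<close> through non-isomorphisms and vanish in the split quotient. The remaining ones
  belong to a single class, so they are finitely many; each is moved to \<open>c\<close> by one
  chosen isomorphism.\<close>

lemma spl_fin_gen:
  fixes B :: "'o \<Rightarrow> 'b set"
  assumes span: "\<And>H. submodule H K (val M c) \<Longrightarrow>
      (\<And>i v. i \<in> Sigma (Obj C) B \<Longrightarrow> v \<in> homs C (fst i) c \<Longrightarrow> act M v (y i) \<in> H) \<Longrightarrow> H = carrier (val M c)"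
    and B: "finite_basis C B" and y: "\<And>i. i \<in> Sigma (Obj C) B \<Longrightarrow> y i \<in> carrier (val M (fst i))"
    and c: "c \<in> Obj C"
  shows "fin_gen_left_module (R c) (spl M c)"
proof -
  let ?I = "{i \<in> Sigma (Obj C) B. homs C (fst i) c \<noteq> {} \<and> homs C c (fst i) \<noteq> {}}"
  define v where "v = (\<lambda>i :: 'o \<times> 'b. SOME v. v \<in> homs C (fst i) c)"
  have v: "v i \<in> homs C (fst i) c" if "i \<in> ?I" for i
    using that unfolding v_def by (intro someI_ex[of "\<lambda>v. v \<in> homs C (fst i) c"]) auto
  let ?g = "\<lambda>i. rho M c (act M (v i) (y i))"
  let ?S = "?g ` ?I"
  have "?I \<subseteq> (SIGMA d : cl C c. B d)" using c by (auto simp: cl_iff)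
  then have fin: "finite ?S"
    using B c by (intro finite_imageI) (auto simp: finite_basis_def intro: finite_subset)
  have S: "?S \<subseteq> carrier (spl M c)"
    using kcm_act_closed[OF kM v y] by auto
  interpret Sp: left_module "R c" "spl M c" by (rule left_module_spl[OF kM c])
  define H where "H = (\<lambda>H. submodule H (R c) (spl M c)) hull ?S"
  have H: "submodule H (R c) (spl M c)" unfolding H_def by (rule Sp.submodule_hull[OF S])
  have gH: "?g i \<in> H" if "i \<in> ?I" for i
    unfolding H_def using that by (intro hull_inc imageI)
  have Hsub: "H \<subseteq> carrier (spl M c)" and H0: "\<zero>\<^bsub>spl M c\<^esub> \<in> H"
    and Hs: "\<And>a x. a \<in> carrier (R c) \<Longrightarrow> x \<in> H \<Longrightarrow> a \<odot>\<^bsub>spl M c\<^esub> x \<in> H"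
    using H unfolding Sp.submodule_iff by blast+
  note m = monoid_aut_group[OF c]
  note rl = scalar_of_loc[OF kM c rho_lin[OF kM c]]
  have "{x \<in> carrier (val M c). rho M c x \<in> H} = carrier (val M c)"
  proof (rule span[OF submodule_vimage[OF kcm_val[OF kM c] left_module_scalar[OF cring_K m Sp.left_module_axioms] rl
        scalar_submodule[OF cring_K m Sp.left_module_axioms H]]])
    fix i w assume i: "i \<in> Sigma (Obj C) B" and w: "w \<in> homs C (fst i) c"
    have wy: "act M w (y i) \<in> carrier (val M c)" by (rule kcm_act_closed[OF kM w y[OF i]])
    have "rho M c (act M w (y i)) \<in> H"
    proof (cases "homs C c (fst i) = {}")
      case True
      then have "rho M c (act M w (y i)) = \<zero>\<^bsub>spl M c\<^esub>"
        using rho_zero_iff[OF kM c wy] act_in_non[OF w True y[OF i]] by blast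
      then show ?thesis using H0 by (simp only:)
    next
      case False
      then have iI: "i \<in> ?I" using i w by auto
      \<comment> \<open>With \<open>u\<close> inverse to the chosen isomorphism \<open>v i\<close>,
        any \<open>w\<close> equals \<open>w\<close> after \<open>u\<close> after
        \<open>v i\<close>. So \<open>w\<close> acts on the generator as an automorphism of
        \<open>c\<close> applied to its moved copy.\<close>
      obtain u where u: "u \<in> homs C c (fst i)" "u \<diamondop> v i = Id C (fst i)"
        by (rule iso_inverse[OF v[OF iI] False]) blast
      have wu: "w \<diamondop> u \<in> homs C c c" by (rule Comp_closed[OF u(1) w])
      have vy: "act M (v i) (y i) \<in> carrier (val M c)" by (rule kcm_act_closed[OF kM v[OF iI] y[OF i]])
      have "(w \<diamondop> u) \<diamondop> v i = w" using Comp_assoc[OF v[OF iI] u(1) w] u(2) Comp_Id_right[OF w] by simp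
      then have "act M w (y i) = act M (w \<diamondop> u) (act M (v i) (y i))"
        using kcm_comp[OF kM v[OF iI] wu y[OF i]] by simp
      also have "\<dots> = gdl c (w \<diamondop> u) \<one>\<^bsub>K\<^esub> \<odot>\<^bsub>loc M c\<^esub> act M (v i) (y i)"
        using loc_gd1[OF kM c wu vy] by simp
      finally have "rho M c (act M w (y i)) = gdl c (w \<diamondop> u) \<one>\<^bsub>K\<^esub> \<odot>\<^bsub>spl M c\<^esub> ?g i"
        using lin_homs_smult[OF rho_lin[OF kM c] gdl_closed[OF c wu K.one_closed], of "act M (v i) (y i)"] vy by simp
      then show ?thesis
        using Hs[OF gdl_closed[OF c wu K.one_closed] gH[OF iI]] by (simp only:)
    qed
    then show "act M w (y i) \<in> {x \<in> carrier (val M c). rho M c x \<in> H}" using wy by blast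
  qed
  then have "carrier (spl M c) \<subseteq> H" by auto
  then have "H = carrier (spl M c)" using Hsub by blast
  then show ?thesis
    unfolding H_def fin_gen_left_module_def using Sp.left_module_axioms fin S by blast
qed

text \<open>The split quotients are finitely generated, so they have covers, and superfluity makes
  these covers finitely generated as well. The resulting basis of the free module is finite because
  its classes occur among those of a given finite basis.\<close>

lemma cover_semiperfect:
  assumes semi: "\<And>c. c \<in> Obj C \<Longrightarrow> cl C c \<in> U \<Longrightarrow> semiperfect_ring TYPE('u) (R c)"
    and fg: "fin_gen K C M"
  shows "\<exists>P f. min_cover U M P f \<and> fin_gen K C P"
proof (rule fin_genE[OF fg])
  fix B0 :: "'o \<Rightarrow> nat set" and y
  assume B0: "finite_basis C B0" and y: "\<And>i. i \<in> Sigma (Obj C) B0 \<Longrightarrow> y i \<in> carrier (val M (fst i))"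
    and span: "\<And>d H. d \<in> Obj C \<Longrightarrow> submodule H K (val M d) \<Longrightarrow>
      (\<And>i v. i \<in> Sigma (Obj C) B0 \<Longrightarrow> v \<in> homs C (fst i) d \<Longrightarrow> act M v (y i) \<in> H) \<Longrightarrow> H = carrier (val M d)"
  have fgl: "fin_gen_left_module (R c) (spl M c)" if "c \<in> Obj C" for c
    by (rule spl_fin_gen[OF span[OF that] B0 y that])
  show ?thesis
  proof (rule choose_covers)
    show "\<exists>p. projective_cover (Mod_cat (R c)) p (spl M c)" if "c \<in> Obj C" "cl C c \<in> U" for c
      using semi[OF that] fgl[OF that(1)] by (simp add: semiperfect_ring_def)
    fix p assume p: "\<And>c. c \<in> Dm \<Longrightarrow> projective_cover (Mod_cat (R c)) (p c) (spl M c)"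
    define G where "G c S \<longleftrightarrow> finite S \<and> S \<subseteq> carrier (src (p c)) \<and>
        (\<forall>H. submodule H (R c) (src (p c)) \<longrightarrow> S \<subseteq> H \<longrightarrow> H = carrier (src (p c)))" for c S
    have "\<exists>S. G c S" if c: "c \<in> Dm" for c
    proof -
      note pc = p[OF c, unfolded projective_cover_def]
      have cO: "c \<in> Obj C" using c by simp
      have t: "tgt (p c) = spl M c" using pc by simp
      have Q: "left_module (R c) (src (p c))" and lin: "fn (p c) \<in> lin_homs (R c) (src (p c)) (spl M c)"
        using pc by (auto simp: Mod_cat_Mor t)
      have sup: "superfluous (Mod_cat (R c)) (p c)" using pc by simp
      have surj: "fn (p c) ` carrier (src (p c)) = carrier (spl M c)"
        using sup by (simp only: superfluous_def epic_Mod_cat_iff t)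
      obtain T where T: "finite T" "T \<subseteq> carrier (spl M c)"
        "(\<lambda>H. submodule H (R c) (spl M c)) hull T = carrier (spl M c)"
        using fgl[OF cO] by (auto simp: fin_gen_left_module_def simp del: rep_quotient_simps)
      \<comment> \<open>Preimages of finitely many generators of the split quotient. A submodule
        containing them maps onto the split quotient, so superfluity makes it everything.\<close>
      obtain S where S: "finite S" "S \<subseteq> carrier (src (p c))" "T = fn (p c) ` S"
        using finite_subset_image[OF T(1), of "fn (p c)" "carrier (src (p c))"] T(2) unfolding surj[symmetric] by blast
      have "H = carrier (src (p c))" if H: "submodule H (R c) (src (p c))" and SH: "S \<subseteq> H" for H
      proof (rule superfluous_Mod_cat_submodule[OF sup H])
        have sm: "submodule (fn (p c) ` H) (R c) (spl M c)"
          by (rule submodule_image[OF Q left_module_spl[OF kM cO] lin H])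
        have "(\<lambda>H. submodule H (R c) (spl M c)) hull T \<subseteq> fn (p c) ` H"
          by (rule hull_minimal) (use sm SH S(3) in auto)
        moreover have "fn (p c) ` H \<subseteq> carrier (spl M c)"
          by (rule sm[unfolded left_module.submodule_iff[OF left_module_spl[OF kM cO]], THEN conjunct1])
        ultimately show "fn (p c) ` H = carrier (tgt (p c))" unfolding t T(3) by simp
      qed
      then have "G c S" unfolding G_def using S(1,2) by simp
      then show ?thesis by blast
    qed
    then have "\<forall>c. \<exists>S. c \<in> Dm \<longrightarrow> G c S" by blast
    from choice[OF this] obtain S where "\<And>c. c \<in> Dm \<Longrightarrow> G c (S c)" by blast
    then have S: "\<And>c. c \<in> Dm \<Longrightarrow> finite (S c)" "\<And>c. c \<in> Dm \<Longrightarrow> S c \<subseteq> carrier (src (p c))"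
      "\<And>c H. c \<in> Dm \<Longrightarrow> submodule H (R c) (src (p c)) \<Longrightarrow> S c \<subseteq> H \<Longrightarrow> H = carrier (src (p c))"
      unfolding G_def by simp_all
    let ?B = "\<lambda>c. if c \<in> Dm then S c else {}"
    have fb: "finite_basis C ?B"
      unfolding finite_basis_def finite_type_def
    proof (intro conjI ballI)
      have "finite {cl C c |c. c \<in> Obj C \<and> B0 c \<noteq> {}}"
        using B0 by (simp add: finite_basis_def finite_type_def)
      \<comment> \<open>If no original generator sat at an object isomorphic to \<open>c\<close>,
        then \<open>M\<close> at \<open>c\<close> would consist of images of non-isomorphisms and
        the split quotient would vanish.\<close>
      moreover have "cl C c \<in> {cl C c |c. c \<in> Obj C \<and> B0 c \<noteq> {}}" if c: "c \<in> Dm" for c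
      proof -
        have cO: "c \<in> Obj C" using c by simp
        have "\<exists>i w. i \<in> Sigma (Obj C) B0 \<and> w \<in> homs C (fst i) c \<and> homs C c (fst i) \<noteq> {}"
        proof (rule ccontr)
          assume no: "\<not> ?thesis"
          have "non M c = carrier (val M c)"
          proof (rule span[OF cO submodule_non[OF kM cO]])
            fix i w assume iw: "i \<in> Sigma (Obj C) B0" "w \<in> homs C (fst i) c"
            then have "homs C c (fst i) = {}" using no by blast
            then show "act M w (y i) \<in> non M c" by (rule act_in_non[OF iw(2) _ y[OF iw(1)]])
          qed
          then show False using c by simp
        qed
        then obtain i w where i: "i \<in> Sigma (Obj C) B0" "w \<in> homs C (fst i) c" "homs C c (fst i) \<noteq> {}"
          by blast
        then have "cl C c = cl C (fst i)" using cl_eq_iff[OF cO, of "fst i"] by auto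
        then show ?thesis using i(1) by auto
      qed
      then have "{cl C c |c. c \<in> Obj C \<and> ?B c \<noteq> {}} \<subseteq> {cl C c |c. c \<in> Obj C \<and> B0 c \<noteq> {}}"
        by (auto split: if_splits)
      ultimately show "finite {cl C c |c. c \<in> Obj C \<and> ?B c \<noteq> {}}" by (rule rev_finite_subset)
      fix c assume c: "c \<in> Obj C"
      \<comment> \<open>New generators sit at chosen representatives only, so a class contributes at
        most one finite index set.\<close>
      have "d = crep c" if "d \<in> cl C c" "d \<in> Dm" for d
      proof (rule crep_eqI)
        show "d \<in> Obj C" "crep d = d" using that by auto
        show "crep c \<in> Obj C" "crep (crep c) = crep c" by (rule crep[OF c])+
        show "homs C d (crep c) \<noteq> {}" "homs C (crep c) d \<noteq> {}"
          using Comp_nonempty[of d c "crep c"] Comp_nonempty[of "crep c" c d] crep[OF c] that(1)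
          by (auto simp: cl_iff[OF c])
      qed
      then have "(SIGMA d : cl C c. ?B d) \<subseteq> {crep c} \<times> ?B (crep c)" by (auto split: if_splits)
      moreover have "finite (?B (crep c))" using S(1) by simp
      ultimately show "finite (SIGMA d : cl C c. ?B d)" by (rule finite_subset[OF _ finite_cartesian_product[OF finite.insertI[OF finite.emptyI]]])
    qed
    show ?thesis
    proof (rule cover_exists[OF univ kM A refl U Dm_U, of ?B p "\<lambda>_ b. b"])
      fix P f assume "min_cover U M P f" "finite_basis C ?B \<Longrightarrow> fin_gen K C P"
      then show ?thesis using fb by (intro exI conjI) simp_all
    next
      fix c H assume c: "c \<in> Dm" and H: "submodule H (R c) (src (p c))" and sub: "\<And>b. b \<in> ?B c \<Longrightarrow> b \<in> H"
      have "S c \<subseteq> H" using sub c by auto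
      then show "H = carrier (src (p c))" by (rule S(3)[OF c H])
    next
      show "b \<in> carrier (src (p c))" if "c \<in> Dm" "b \<in> ?B c" for c b using S(2)[OF that(1)] that by auto
    qed (use p in auto)
  qed
qed

end

subsection \<open>Minimal resolutions\<close>

definition syzygy ::
  "('o, 'm, 'k, 'u) kc_module \<Rightarrow> ('o, 'm, 'k, 'u) kc_module \<Rightarrow> ('o \<Rightarrow> 'u \<Rightarrow> 'u) \<Rightarrow> ('o, 'm, 'k, 'u) kc_module" where
  "syzygy N P f = restrict_kc P (arrow_kernel (kc_arrow C P N f))"

lemma syzygy_kcm:
  assumes N: "kcm N" and P: "min_cover U N P f"
  shows "kcm (syzygy N P f)" "supp_in U (syzygy N P f)"
    and "kc_submodule K C P (arrow_kernel (kc_arrow C P N f))"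
proof -
  have kP: "kcm P" and f: "kc_hom K C P N f" and s: "supp_in U P" using P by (simp_all add: min_cover_def)
  show sub: "kc_submodule K C P (arrow_kernel (kc_arrow C P N f))"
    using kc_submodule_kernel[OF kc_arrow_Mor[OF kP N f]] by simp
  show k: "kcm (syzygy N P f)" unfolding syzygy_def by (rule kcm_restrict[OF kP sub])
  show "supp_in U (syzygy N P f)"
    by (rule supp_in_mono_sub[OF s k]) (use kc_submoduleD(1)[OF kP sub] in \<open>auto simp: syzygy_def\<close>)
qed

text \<open>Modules cut out by an image and by a kernel agree at objects of \<open>C\<close> only,
  since arrows are unspecified elsewhere. Equality of the records is therefore replaced by agreement
  on \<open>Obj C\<close>.\<close>

lemma kcm_cong:
  assumes N: "kcm N" and eq: "\<And>c. c \<in> Obj C \<Longrightarrow> val N' c = val N c" "act N' = act N"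
  shows "kcm N'"
  using N unfolding is_kc_module_def by (auto simp: eq Dom_closed Cod_closed)

lemma min_cover_cong:
  assumes P: "min_cover U N P f" and eq: "\<And>c. c \<in> Obj C \<Longrightarrow> val N' c = val N c" "act N' = act N"
  shows "min_cover U N' P f"
  using P unfolding min_cover_def kc_hom_def by (simp add: eq cong: ball_cong)

text \<open>\<open>G\<close> is an invariant that yields a minimal cover and survives the passage to
  its kernel. Splicing the covers of successive kernels gives the resolution; both the perfect and
  the Noetherian case are instances.\<close>

lemma resolution_of_covers:
  fixes M :: "('o, 'm, 'k, 'u) kc_module"
  assumes M: "G M" and kcm: "\<And>N. G N \<Longrightarrow> kcm N"
    and step: "\<And>N. G N \<Longrightarrow> \<exists>P f. min_cover U N P f \<and> G (syzygy N P f)"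
  shows "\<exists>P d. minimal_projective_resolution K C M P d"
proof -
  have "\<forall>N. \<exists>Pf. G N \<longrightarrow> min_cover U N (fst Pf) (snd Pf) \<and> G (syzygy N (fst Pf) (snd Pf))"
    using step by fastforce
  from choice[OF this] obtain Pf where
    Pf: "\<And>N. G N \<Longrightarrow> min_cover U N (fst (Pf N)) (snd (Pf N)) \<and> G (syzygy N (fst (Pf N)) (snd (Pf N)))"
    by blast
  \<comment> \<open>The successive syzygies, starting with \<open>M\<close> itself at index
    zero.\<close>
  define N where "N = rec_nat M (\<lambda>_ N. syzygy N (fst (Pf N)) (snd (Pf N)))"
  define P where "P n = fst (Pf (N n))" for n
  define f where "f n = snd (Pf (N n))" for n
  have N0: "N 0 = M" and NS: "N (Suc n) = syzygy (N n) (P n) (f n)" for n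
    by (simp_all add: N_def P_def f_def)
  have GN: "G (N n)" for n
  proof (induction n)
    case 0
    then show ?case using M N0 by simp
  next
    case (Suc n)
    then show ?case using Pf[OF Suc] by (simp add: NS P_def f_def)
  qed
  have kN: "kcm (N n)" for n by (rule kcm[OF GN])
  have mc: "min_cover U (N n) (P n) (f n)" for n
    using Pf[OF GN[of n]] by (simp add: P_def f_def)
  have kP: "kcm (P n)" and pP: "projective (kC_cat K C) (P n)" and fh: "kc_hom K C (P n) (N n) (f n)"
    and surj: "\<And>c. c \<in> Obj C \<Longrightarrow> f n c ` carrier (val (P n) c) = carrier (val (N n) c)" for n
    using mc[of n] by (simp_all add: min_cover_def)
  \<comment> \<open>The module containing the syzygy \<open>N n\<close> and receiving
    \<open>d n\<close>: the augmented module at zero, the preceding projective afterwards.\<close>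
  define T where "T n = (case n of 0 \<Rightarrow> M | Suc k \<Rightarrow> P k)" for n
  define d where "d n = kc_arrow C (P n) (T n) (f n)" for n
  have NT: "val (N n) c = (val (T n) c)\<lparr>carrier := carrier (val (N n) c)\<rparr>" "act (N n) = act (T n)" for n c
    by (cases n; simp add: N0 NS T_def syzygy_def)+
  have kT: "kcm (T n)" for n
    using kP kN[of 0] by (cases n) (simp_all add: T_def N0)
  have fT: "kc_hom K C (P n) (T n) (f n)" for n
  proof (cases n)
    case 0
    then show ?thesis using fh[of 0] by (simp add: T_def N0)
  next
    case (Suc k)
    have "kc_hom K C (N n) (T n) (\<lambda>c x. x)"
      unfolding Suc NS T_def syzygy_def using kc_hom_inclusion[OF kP syzygy_kcm(3)[OF kN mc]] by simp
    from kc_hom_compose[OF fh this] show ?thesis by simp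
  qed
  have dm: "d n \<in> homs (kC_cat K C) (P n) (T n)" for n
    using kc_arrow_Mor[OF kP kT fT] by (simp add: d_def homs_def)
  have im: "arrow_image (d n) c = carrier (val (N n) c)" if c: "c \<in> Obj C" for n c
  proof -
    have "arrow_image (d n) c = f n c ` carrier (val (P n) c)"
      unfolding arrow_image_def d_def using c by (simp add: kc_arrow_def)
    then show ?thesis using surj[OF c] by simp
  qed
  have ker: "arrow_kernel (d n) c = carrier (val (N (Suc n)) c)" if "c \<in> Obj C" for n c
  proof -
    have z: "\<zero>\<^bsub>val (N n) c\<^esub> = \<zero>\<^bsub>val (T n) c\<^esub>" by (subst NT) simp
    show ?thesis
      using that z by (simp add: NS syzygy_def arrow_kernel_def d_def kc_arrow_def)
  qed
  have pc0: "projective_cover (kC_cat K C) (d 0) M"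
    using min_cover_projective_cover[OF kN mc, of 0] by (simp add: d_def T_def N0)
  have pcS: "projective_cover (kC_cat K C) (corestrict (d (Suc n))) (restrict_kc (P n) (arrow_image (d (Suc n))))" for n
  proof -
    let ?N = "restrict_kc (P n) (arrow_image (d (Suc n)))"
    \<comment> \<open>The image of the differential is the syzygy at every object, so the cover of
      the syzygy is also the cover demanded of the corestricted differential.\<close>
    have eq: "val ?N c = val (N (Suc n)) c" if "c \<in> Obj C" for c
      using im[OF that, of "Suc n"] NT(1)[of "Suc n" c] by (simp add: T_def)
    have eq2: "act ?N = act (N (Suc n))" using NT(2)[of "Suc n"] by (simp add: T_def)
    have "projective_cover (kC_cat K C) (kc_arrow C (P (Suc n)) ?N (f (Suc n))) ?N"
      by (rule min_cover_projective_cover[OF kcm_cong[OF kN eq eq2] min_cover_cong[OF mc eq eq2]])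
    moreover have "corestrict (d (Suc n)) = kc_arrow C (P (Suc n)) ?N (f (Suc n))"
      by (simp add: corestrict_def d_def kc_arrow_def T_def)
    ultimately show ?thesis by (simp only:)
  qed
  have "projective_resolution K C M P d"
    unfolding projective_resolution_def
  proof (intro conjI allI ballI)
    show "d 0 \<in> homs (kC_cat K C) (P 0) M" "d (Suc n) \<in> homs (kC_cat K C) (P (Suc n)) (P n)" for n
      using dm[of 0] dm[of "Suc n"] by (simp_all add: T_def)
    show "epic (kC_cat K C) (d 0)" using pc0 by (simp add: projective_cover_def superfluous_def)
    show "arrow_image (d (Suc n)) c = arrow_kernel (d n) c" if "c \<in> Obj C" for n c
      using im[OF that] ker[OF that] by simp
  qed (rule pP)
  then show ?thesis using pc0 pcS unfolding minimal_projective_resolution_def by blast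
qed

end

section \<open>Assembly: an invariant of supports that is preserved by syzygies\<close>

theorem theorem6p5:
  fixes K :: "'k ring" and C :: "('o, 'm) category" and M :: "('o, 'm, 'k, 'u) kc_module"
  assumes "infinite (UNIV :: 'u set)"
    and "carrier K \<lesssim> (UNIV :: 'u set)"
    and "Mor C \<lesssim> (UNIV :: 'u set)"
    and "cring K"
    and "EI_category C"
    and "is_kc_module K C M"
    and "artinian C (upper_closure C (supp C M))"
  shows
    "((\<forall>c \<in> Obj C. cl C c \<in> upper_closure C (minsupp K C M) \<longrightarrow>
          perfect_ring TYPE('u) (group_ring K (aut_group C c))) \<longrightarrow>
        (\<exists>P d. minimal_projective_resolution K C M P d) \<and>
        ((\<forall>c \<in> Obj C. cl C c \<in> upper_closure C (minsupp K C M) \<longrightarrow>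
            (\<forall>N :: ('m \<Rightarrow> 'k, 'u) module.
              projective (Mod_cat (group_ring K (aut_group C c))) N \<longrightarrow>
              free_left_module (group_ring K (aut_group C c)) N)) \<longrightarrow>
          (\<forall>P d. minimal_projective_resolution K C M P d \<longrightarrow> (\<forall>n. free_kc_module K C (P n)))))
     \<and> ((\<forall>c \<in> Obj C. cl C c \<in> upper_closure C (minsupp K C M) \<longrightarrow>
          semiperfect_ring TYPE('u) (group_ring K (aut_group C c))) \<and>
        fin_gen K C M \<longrightarrow>
        (\<exists>p. projective_cover (kC_cat K C) p M) \<and>
        (noetherian_kc TYPE('u) K C \<longrightarrow>
          (\<exists>P d. minimal_projective_resolution K C M P d)))"
proof -
  interpret kc_setting C K
    using assms(4,5) EI_iff[of C] by (simp add: kc_setting_def kc_setting_axioms_def)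
  note univ = assms(1-3)
  define A where "A = upper_closure C (supp C M)"
  \<comment> \<open>The first factor makes the ring hypotheses available. The second keeps modules
    supported in \<open>U\<close> within the Artinian set \<open>A\<close>, where Nakayama
    applies.\<close>
  define U where "U = upper_closure C (minsupp K C M) \<inter> A"
  have kM: "kcm M" by (rule assms(6))
  have upA: "upper_set C A" unfolding A_def by (rule upper_closure_upper_set) (auto simp: supp_def)
  have upS: "upper_set C (upper_closure C (minsupp K C M))"
    by (rule upper_closure_upper_set) (auto simp: minsupp_def)
  have upU: "upper_set C U"
    unfolding upper_set_def[of C U]
  proof (intro conjI ballI impI)
    show "U \<subseteq> cl C ` Obj C" using upA by (auto simp: U_def upper_set_def)
    show "b \<in> U" if "a \<in> U" "b \<in> cl C ` Obj C" "cl_le C a b" for a b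
      using that upA[unfolded upper_set_def, THEN conjunct2, rule_format, of a b]
        upS[unfolded upper_set_def, THEN conjunct2, rule_format, of a b] by (simp only: U_def Int_iff)
  qed
  have artA: "artinian C A" unfolding A_def by (rule assms(7))
  have supA: "supp_in A M"
    unfolding supp_in_def A_def upper_closure_def by (auto intro!: hull_inc simp: supp_def)
  have UA: "supp_in A N" if "supp_in U N" for N :: "('o, 'm, 'k, 'u) kc_module"
    using that by (auto simp: supp_in_def U_def)
  have nzM: "cl C c \<in> U" if c: "c \<in> Obj C" "non M c \<noteq> carrier (val M c)" for c
    using split_nonzero_supp[OF supA kM c] minsuppI[OF kM c]
    by (auto simp: U_def upper_closure_def intro: hull_inc)
  \<comment> \<open>Weaker than support in \<open>U\<close>, so that it covers \<open>M\<close>,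
    whose split quotients are controlled by \<open>minsupp\<close> while its support is bounded by
    \<open>A\<close>. Syzygies have their whole support in \<open>U\<close> and satisfy it by
    \<open>goodU\<close>.\<close>
  define good where "good N \<longleftrightarrow> kcm N \<and> supp_in A N \<and>
    (\<forall>c \<in> Obj C. non N c \<noteq> carrier (val N c) \<longrightarrow> cl C c \<in> U)" for N :: "('o, 'm, 'k, 'u) kc_module"
  have goodM: "good M" using kM supA nzM by (simp add: good_def)
  have goodU: "good N" if "kcm N" "supp_in U N" for N :: "('o, 'm, 'k, 'u) kc_module"
    using that UA split_nonzero_supp[OF that(2,1)] by (simp add: good_def)
  have good_syz: "good (syzygy N P f)" if "good N" "min_cover U N P f" for N P f
    using syzygy_kcm(1,2)[OF _ that(2)] that(1) by (intro goodU) (simp_all add: good_def)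
  show ?thesis
  proof (intro conjI impI allI; (elim conjE)?)
    assume "\<forall>c \<in> Obj C. cl C c \<in> upper_closure C (minsupp K C M) \<longrightarrow> perfect_ring TYPE('u) (R c)"
    then have perf: "perfect_ring TYPE('u) (R c)" if "c \<in> Obj C" "cl C c \<in> U" for c
      using that by (simp add: U_def)
    show "\<exists>P d. minimal_projective_resolution K C M P d"
    proof (rule resolution_of_covers[of good M U])
      fix N assume N: "good N"
      have "\<exists>P f. min_cover U N P f"
        by (rule cover_perfect[OF univ _ artA upA _ upU _ perf]) (use N in \<open>auto simp: good_def\<close>)
      then show "\<exists>P f. min_cover U N P f \<and> good (syzygy N P f)" using good_syz[OF N] by blast
    qed (use goodM in \<open>auto simp: good_def\<close>)
    fix P d n
    assume "\<forall>c \<in> Obj C. cl C c \<in> upper_closure C (minsupp K C M) \<longrightarrow>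
            (\<forall>N :: ('m \<Rightarrow> 'k, 'u) module. projective (Mod_cat (R c)) N \<longrightarrow> free_left_module (R c) N)"
      and res: "minimal_projective_resolution K C M P d"
    then have fr: "free_left_module (R c) N" if "c \<in> Obj C" "cl C c \<in> U" "projective (Mod_cat (R c)) N"
      for c and N :: "('m \<Rightarrow> 'k, 'u) module"
      using that by (simp add: U_def)
    \<comment> \<open>The constructed free cover is isomorphic to an arbitrary one by uniqueness,
      which transfers both freeness and the support bound.\<close>
    have free_cover: "free_kc_module K C (src p) \<and> supp_in U (src p)"
      if N: "good N" and p: "projective_cover (kC_cat K C) p N" for N p
    proof -
      have kN: "kcm N" using N by (simp add: good_def)
      have "\<exists>P f. min_cover U N P f \<and> free_kc_module K C P"
        by (rule cover_free[OF univ kN artA upA _ upU _ perf fr]) (use N in \<open>auto simp: good_def\<close>)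
      then obtain P' f where P': "min_cover U N P' f" "free_kc_module K C P'" by blast
      have kp: "kcm (src p)" using p by (simp add: projective_cover_def kC_cat_Mor)
      show ?thesis
      proof (rule cover_unique[OF kN P'(1) p])
        fix h assume h: "kc_hom K C P' (src p) h"
          and bij: "\<And>d. d \<in> Obj C \<Longrightarrow> bij_betw (h d) (carrier (val P' d)) (carrier (val (src p) d))"
        have kP': "kcm P'" and sP': "supp_in U P'" using P'(1) by (simp_all add: min_cover_def)
        have "supp_in U (src p)"
          unfolding supp_in_def
        proof (intro ballI impI)
          fix c assume c: "c \<in> Obj C" and ne: "carrier (val (src p) c) \<noteq> {\<zero>\<^bsub>val (src p) c\<^esub>}"
          have im: "h c ` carrier (val P' c) = carrier (val (src p) c)" using bij[OF c] by (simp add: bij_betw_def)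
          have "carrier (val P' c) \<noteq> {\<zero>\<^bsub>val P' c\<^esub>}"
            using ne im lin_homs_zero[OF kcm_val[OF kP' c] kcm_val[OF kp c] kc_hom_lin[OF h c]] by auto
          then show "cl C c \<in> U" using sP' c by (auto simp: supp_in_def)
        qed
        then show ?thesis using free_kc_module_iso[OF P'(2) kp h bij] by blast
      qed
    qed
    \<comment> \<open>The support bound is part of the induction: it makes the image of the next
      differential good, so that \<open>free_cover\<close> applies to it.\<close>
    have "free_kc_module K C (P n) \<and> supp_in U (P n)" for n
    proof (induction n)
      case 0
      have "src (d 0) = P 0" "projective_cover (kC_cat K C) (d 0) M"
        using res by (simp_all add: minimal_projective_resolution_def projective_resolution_def homs_def)
      then show ?case using free_cover[OF goodM, of "d 0"] by simp
    next
      case (Suc n)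
      let ?N = "restrict_kc (P n) (arrow_image (d (Suc n)))"
      have dS: "d (Suc n) \<in> homs (kC_cat K C) (P (Suc n)) (P n)"
        and pc: "projective_cover (kC_cat K C) (corestrict (d (Suc n))) ?N"
        using res by (simp_all add: minimal_projective_resolution_def projective_resolution_def)
      have dm: "d (Suc n) \<in> Mor (kC_cat K C)" and st: "src (d (Suc n)) = P (Suc n)" "tgt (d (Suc n)) = P n"
        using dS by (simp_all add: homs_def)
      have "kcm ?N" using pc by (auto simp: projective_cover_def kC_cat_Mor)
      moreover have "supp_in U ?N"
      proof (rule supp_in_mono_sub[OF _ \<open>kcm ?N\<close>])
        show "supp_in U (P n)" using Suc by simp
        show "carrier (val ?N c) \<subseteq> carrier (val (P n) c)" if "c \<in> Obj C" for c
          using kc_hom_closed[OF Mor_kc_hom[OF dm] that] st by (auto simp: arrow_image_def)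
      qed simp
      ultimately have "good ?N" by (rule goodU)
      then show ?case using free_cover[OF _ pc] st by (simp add: corestrict_def)
    qed
    then show "free_kc_module K C (P n)" by blast
  next
    assume "\<forall>c \<in> Obj C. cl C c \<in> upper_closure C (minsupp K C M) \<longrightarrow> semiperfect_ring TYPE('u) (R c)"
      and fg: "fin_gen K C M"
    then have semi: "semiperfect_ring TYPE('u) (R c)" if "c \<in> Obj C" "cl C c \<in> U" for c
      using that by (simp add: U_def)
    have cov: "\<exists>P f. min_cover U N P f \<and> fin_gen K C P" if "good N" "fin_gen K C N" for N
      by (rule cover_semiperfect[OF univ _ artA upA _ upU _ semi that(2)]) (use that in \<open>auto simp: good_def\<close>)
    show "\<exists>p. projective_cover (kC_cat K C) p M"
      using cov[OF goodM fg] min_cover_projective_cover[OF kM] by blast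
    assume noeth: "noetherian_kc TYPE('u) K C"
    show "\<exists>P d. minimal_projective_resolution K C M P d"
    \<comment> \<open>Finite generation joins the invariant: the cover is finitely generated, and
      the Noetherian property passes this on to its submodule, the syzygy.\<close>
    proof (rule resolution_of_covers[of "\<lambda>N. good N \<and> fin_gen K C N" M U])
      fix N assume N: "good N \<and> fin_gen K C N"
      then have kN: "kcm N" by (simp add: good_def)
      obtain P f where P: "min_cover U N P f" "fin_gen K C P" using cov N by blast
      have "fin_gen K C (syzygy N P f)"
        unfolding syzygy_def using noeth P(2) syzygy_kcm(3)[OF kN P(1)] unfolding noetherian_kc_def by blast
      then show "\<exists>P f. min_cover U N P f \<and> (good (syzygy N P f) \<and> fin_gen K C (syzygy N P f))"
        using P(1) good_syz N by blast
    qed (use goodM fg in \<open>auto simp: good_def\<close>)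
  qed
qed

end
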